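(* There exists a crystalline measure $\mu$ on $\mathbb{R}$ such that for some $\psi\in S(\mathbb{R})$ the function $(\mu\star\psi)(t)$ is unbounded in $t\in\mathbb{R}$. In particular, $\mu$ is neither an s-almost periodic distribution nor a Fourier quasicrystal.
   Context: $S(\mathbb{R}^d)$ is the Schwartz space and $S^*(\mathbb{R}^d)$ is the space of temperate (tempered) distributions. The Fourier transform of a test function is $\hat\varphi(y)=\int_{\mathbb{R}^d}\varphi(x)e^{-2\pi i\langle x,y\rangle}dx$, and for $f\in S^*(\mathbb{R}^d)$ it is defined by $\hat f(\varphi)=f(\hat\varphi)$. A measure means a complex-valued (locally finite, Radon) measure on $\mathbb{R}^d$; $|\mu|$ is the variation of $\mu$. A set $A\subset\mathbb{R}^d$ is locally finite if its intersection with every ball is finite. An element $\mu\in S^*(\mathbb{R}^d)$ is a crystalline measure if both $\mu$ and $\hat\mu$ are complex-valued measures on $\mathbb{R}^d$ with locally finite supports. It is a Fourier quasicrystal if $\mu$ and $\hat\mu$ are measures and both $|\mu|$ and $|\hat\mu|$ have locally finite supports and belong to $S^*(\mathbb{R}^d)$. For $f\in S^*(\mathbb{R}^d)$ and $\psi\in S(\mathbb{R}^d)$, $(f\star\psi)(t)=(\psi\star f)(t)=f(\psi(t-\cdot))$. A continuous function $g$ on $\mathbb{R}^d$ is almost periodic if for every $\varepsilon>0$ the set $\{\tau\in\mathbb{R}^d:\sup_{x}|g(x+\tau)-g(x)|<\varepsilon\}$ is relatively dense (i.e. for some $R<\infty$ it meets every ball of radius $R$). A distribution $f\in S^*(\mathbb{R}^d)$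 is s-almost periodic if $t\mapsto(\psi\star f)(t)$ is almost periodic for every $\psi\in S(\mathbb{R}^d)$. *)

theory Defs
  imports "HOL-Analysis.Analysis"
begin

section \<open>Schwartz functions and tempered distributions on the real line\<close>

primrec vderivs :: "nat \<Rightarrow> (real \<Rightarrow> complex) \<Rightarrow> real \<Rightarrow> complex" where
  "vderivs 0 \<phi> = \<phi>"
| "vderivs (Suc n) \<phi> = (\<lambda>x. vector_derivative (vderivs n \<phi>) (at x))"

definition smooth :: "(real \<Rightarrow> complex) \<Rightarrow> bool" where
  "smooth \<phi> \<longleftrightarrow> (\<forall>n x. vderivs n \<phi> differentiable (at x))"

definition schwartz :: "(real \<Rightarrow> complex) set" where
  "schwartz = {\<phi>. smooth \<phi> \<and> (\<forall>k n. bounded (range (\<lambda>x. x ^ k *\<^sub>R vderivs n \<phi> x)))}"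

definition test_functions :: "(real \<Rightarrow> complex) set" where
  "test_functions = {\<phi>. smooth \<phi> \<and> bounded {x. \<phi> x \<noteq> 0}}"

text \<open>Only meaningful on \<^const>\<open>schwartz\<close>, where the supremum is over a bounded set.\<close>

definition schwartz_seminorm :: "nat \<Rightarrow> nat \<Rightarrow> (real \<Rightarrow> complex) \<Rightarrow> real" where
  "schwartz_seminorm k n \<phi> = (SUP x. norm (x ^ k *\<^sub>R vderivs n \<phi> x))"

text \<open>
  Distributions are functionals on all functions, of which only the values on
  \<^const>\<open>schwartz\<close> matter.  The second conjunct is linearity; the third is
  continuity at each point for the topology generated by the seminorms.
\<close>

definition tempered_distribution :: "((real \<Rightarrow> complex) \<Rightarrow> complex) \<Rightarrow> bool" where
  "tempered_distribution f \<longleftrightarrow>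
     (\<forall>\<phi>\<in>schwartz. \<forall>\<psi>\<in>schwartz. f (\<lambda>x. \<phi> x + \<psi> x) = f \<phi> + f \<psi>) \<and>
     (\<forall>c. \<forall>\<phi>\<in>schwartz. f (\<lambda>x. c * \<phi> x) = c * f \<phi>) \<and>
     (\<forall>\<phi>\<in>schwartz. \<forall>\<epsilon>>0. \<exists>N. \<exists>\<delta>>0. \<forall>\<psi>\<in>schwartz.
        (\<forall>k\<le>N. \<forall>n\<le>N. schwartz_seminorm k n (\<lambda>x. \<psi> x - \<phi> x) < \<delta>) \<longrightarrow>
        norm (f \<psi> - f \<phi>) < \<epsilon>)"

definition fourier :: "(real \<Rightarrow> complex) \<Rightarrow> real \<Rightarrow> complex" where
  "fourier \<phi> y = (LINT x|lborel. \<phi> x * exp (- 2 * of_real pi * \<i> * of_real (x * y)))"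

definition fourier_dist ::
    "((real \<Rightarrow> complex) \<Rightarrow> complex) \<Rightarrow> (real \<Rightarrow> complex) \<Rightarrow> complex" where
  "fourier_dist f \<phi> = f (fourier \<phi>)"

definition dist_conv ::
    "((real \<Rightarrow> complex) \<Rightarrow> complex) \<Rightarrow> (real \<Rightarrow> complex) \<Rightarrow> real \<Rightarrow> complex" where
  "dist_conv f \<psi> t = f (\<lambda>s. \<psi> (t - s))"


section \<open>Locally finite complex measures\<close>

definition bounded_borel :: "real set set" where
  "bounded_borel = {B \<in> sets borel. bounded B}"

text \<open>
  A locally finite complex measure need not have values on unbounded sets, so it is a
  countably additive set function on the bounded Borel sets (its values elsewhere are
  irrelevant).  On the real line the regularity required of a Radon measure is automatic.
\<close>

definition complex_measure :: "(real set \<Rightarrow> complex) \<Rightarrow> bool" where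
  "complex_measure \<nu> \<longleftrightarrow>
     (\<forall>A::nat \<Rightarrow> real set. range A \<subseteq> bounded_borel \<and> disjoint_family A \<and> bounded (\<Union>i. A i)
        \<longrightarrow> (\<lambda>i. \<nu> (A i)) sums \<nu> (\<Union>i. A i))"

text \<open>
  The variation, with values in \<open>[0, \<infinity>]\<close> on all Borel sets.  For bounded \<open>E\<close>, adding the
  complement of \<open>\<Union>P\<close> in \<open>E\<close> to \<open>P\<close> shows that this is the supremum over the
  finite Borel partitions of \<open>E\<close>.
\<close>

definition variation :: "(real set \<Rightarrow> complex) \<Rightarrow> real measure" where
  "variation \<nu> = measure_of UNIV (sets borel)
     (\<lambda>E. SUP P\<in>{P. finite P \<and> disjoint P \<and> P \<subseteq> bounded_borel \<and> \<Union>P \<subseteq> E}.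
        \<Sum>B\<in>P. ennreal (norm (\<nu> B)))"

text \<open>
  The positive part in the Jordan decomposition of a real-valued \<open>u\<close>; \<^const>\<open>ennreal\<close>
  truncates negative values to 0, which is harmless since the empty set contributes 0.
\<close>

definition positive_part :: "(real set \<Rightarrow> real) \<Rightarrow> real measure" where
  "positive_part u = measure_of UNIV (sets borel)
     (\<lambda>E. SUP B\<in>{B \<in> bounded_borel. B \<subseteq> E}. ennreal (u B))"

definition signed_integral :: "(real set \<Rightarrow> real) \<Rightarrow> (real \<Rightarrow> complex) \<Rightarrow> complex" where
  "signed_integral u \<phi> =
     (LINT x|positive_part u. \<phi> x) - (LINT x|positive_part (\<lambda>B. - u B). \<phi> x)"

definition complex_measure_integral :: "(real set \<Rightarrow> complex) \<Rightarrow> (real \<Rightarrow> complex) \<Rightarrow> complex" where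
  "complex_measure_integral \<nu> \<phi> =
     signed_integral (\<lambda>B. Re (\<nu> B)) \<phi> + \<i> * signed_integral (\<lambda>B. Im (\<nu> B)) \<phi>"

definition measure_support :: "real measure \<Rightarrow> real set" where
  "measure_support M = {x. \<forall>U. open U \<and> x \<in> U \<longrightarrow> emeasure M U \<noteq> 0}"

definition locally_finite :: "real set \<Rightarrow> bool" where
  "locally_finite A \<longleftrightarrow> (\<forall>x r. finite (A \<inter> ball x r))"

text \<open>
  A distribution and a measure are identified through compactly supported test functions:
  since the variation may grow fast, Schwartz functions need not be integrable against \<open>\<nu>\<close>.
\<close>

definition given_by_measure ::
    "((real \<Rightarrow> complex) \<Rightarrow> complex) \<Rightarrow> (real set \<Rightarrow> complex) \<Rightarrow> bool" where
  "given_by_measure f \<nu> \<longleftrightarrow>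
     complex_measure \<nu> \<and> (\<forall>\<phi>\<in>test_functions. f \<phi> = complex_measure_integral \<nu> \<phi>)"

definition tempered_measure :: "real measure \<Rightarrow> bool" where
  "tempered_measure M \<longleftrightarrow>
     (\<exists>f. tempered_distribution f \<and> (\<forall>\<phi>\<in>test_functions. f \<phi> = (LINT x|M. \<phi> x)))"


section \<open>Crystalline measures, Fourier quasicrystals, almost periodicity\<close>

text \<open>The support of a complex measure is that of its variation.\<close>

definition crystalline_measure :: "((real \<Rightarrow> complex) \<Rightarrow> complex) \<Rightarrow> bool" where
  "crystalline_measure f \<longleftrightarrow> tempered_distribution f \<and>
     (\<exists>\<nu> \<nu>'. given_by_measure f \<nu> \<and> given_by_measure (fourier_dist f) \<nu>' \<and>
        locally_finite (measure_support (variation \<nu>)) \<and>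
        locally_finite (measure_support (variation \<nu>')))"

definition fourier_quasicrystal :: "((real \<Rightarrow> complex) \<Rightarrow> complex) \<Rightarrow> bool" where
  "fourier_quasicrystal f \<longleftrightarrow> tempered_distribution f \<and>
     (\<exists>\<nu> \<nu>'. given_by_measure f \<nu> \<and> given_by_measure (fourier_dist f) \<nu>' \<and>
        locally_finite (measure_support (variation \<nu>)) \<and>
        locally_finite (measure_support (variation \<nu>')) \<and>
        tempered_measure (variation \<nu>) \<and> tempered_measure (variation \<nu>'))"

definition relatively_dense :: "real set \<Rightarrow> bool" where
  "relatively_dense A \<longleftrightarrow> (\<exists>R. \<forall>x. A \<inter> ball x R \<noteq> {})"

text \<open>The supremum is taken in \<^typ>\<open>ennreal\<close> because it may be infinite.\<close>

definition almost_periodic :: "(real \<Rightarrow> complex) \<Rightarrow> bool" where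
  "almost_periodic g \<longleftrightarrow> continuous_on UNIV g \<and>
     (\<forall>\<epsilon>>0. relatively_dense {\<tau>. (SUP x. ennreal (norm (g (x + \<tau>) - g x))) < ennreal \<epsilon>})"

definition s_almost_periodic :: "((real \<Rightarrow> complex) \<Rightarrow> complex) \<Rightarrow> bool" where
  "s_almost_periodic f \<longleftrightarrow> tempered_distribution f \<and>
     (\<forall>\<psi>\<in>schwartz. almost_periodic (dist_conv f \<psi>))"

end

theory Submission
  imports Defs "HOL-Computational_Algebra.Polynomial"
begin

text \<open>
  For every \<open>R\<close> there is a comb, periodic with a large period \<open>L\<close>, that vanishes near 0 and
  whose Fourier transform vanishes on \<open>[-R, R]\<close>: convolve the Dirac comb of \<open>L \<int>\<close> with a
  finite measure whose Fourier transform has zeros at the finitely many unwanted points of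
  \<open>(1 / L) \<int>\<close>.  Multiplied by \<open>cis (2 * pi * \<epsilon> * x) - 1\<close> it keeps its gaps (the spectrum is
  doubled and shifted by \<open>\<epsilon>\<close>); as a tempered distribution it is of order \<open>\<epsilon>\<close>, but its
  convolutions near \<open>x = 1 / (2 * \<epsilon>)\<close> and the masses of its Fourier transform do not shrink with
  \<open>\<epsilon>\<close>.  Hence multiples \<open>C j\<close> of such combs, with gaps tending to infinity, \<open>C j\<close> growing
  fast, and \<open>\<epsilon> j\<close> so small that the sum converges, add up to a crystalline measure with an
  unbounded convolution, whose Fourier transform has variation of more than polynomial growth.
\<close>

section \<open>Atomic measures\<close>

text \<open>Two demands pull against each other: the masses \<open>C j\<close> must grow fast, yet
  the sum has to stay tempered. The modulating factor reconciles them differently on the two sides.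
  At a point \<open>x\<close> it is at most \<open>2 * pi * \<epsilon> * \<bar>x\<bar>\<close>, so
  the large weights sit only at distance about \<open>1 / \<epsilon>\<close>, where cubic decay of a
  test function outweighs them. On the frequency side each atom becomes a pair of opposite atoms at
  distance \<epsilon>, nearly invisible to smooth functions but with full mass in the variation.
  Hence the quasicrystal property is refuted on the Fourier transform, with a test function that
  sees only one atom of a pair. The gaps give local finiteness, since a bounded set meets finitely
  many combs on either side. They also help to make the estimates triangular: at the j-th test the
  earlier combs are outweighed by \<open>C j\<close>, which is chosen after them, while the later
  ones vanish exactly on the frequency side and are small at the earlier peaks because their
  \<epsilon> is chosen last.\<close>

definition atoms :: "(real \<Rightarrow> real) \<Rightarrow> real measure" where
  "atoms w = distr (point_measure UNIV (\<lambda>x. ennreal (w x))) borel (\<lambda>x. x)"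

text \<open>On a bounded set only finitely many terms survive when the support of \<open>c\<close>
  is locally finite. On other sets the index set may be infinite and the sum takes the default value
  0; \<open>complex_measure\<close> never looks there.\<close>

definition atomic :: "(real \<Rightarrow> 'a) \<Rightarrow> real set \<Rightarrow> 'a::comm_monoid_add" where
  "atomic c B = (\<Sum>x\<in>{x \<in> B. c x \<noteq> 0}. c x)"

lemma locally_finite_Int_bounded:
  assumes "locally_finite A" "bounded B"
  shows "finite (A \<inter> B)"
proof -
  obtain r where "B \<subseteq> ball 0 r"
    using assms(2) bounded_subset_ballD by blast
  then have "A \<inter> B \<subseteq> A \<inter> ball 0 r" by auto
  then show ?thesis
    using assms(1) unfolding locally_finite_def by (meson finite_subset)
qed

lemma locally_finite_subset: "locally_finite A \<Longrightarrow> B \<subseteq> A \<Longrightarrow> locally_finite B"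
  unfolding locally_finite_def by (meson finite_subset Int_mono order_refl)

lemma locally_finite_bounded_Collect:
  assumes "locally_finite {x. P x}" "bounded B"
  shows "finite {x \<in> B. P x}"
  using locally_finite_Int_bounded[OF assms] by (simp add: Int_def conj_commute)

lemma atomic_superset:
  assumes "finite S" "\<And>x. x \<in> B \<Longrightarrow> c x \<noteq> 0 \<Longrightarrow> x \<in> S" "S \<subseteq> B"
  shows "atomic c B = sum c S"
  unfolding atomic_def using assms by (intro sum.mono_neutral_left) auto

lemma sets_atoms [simp, measurable_cong]: "sets (atoms w) = sets borel"
  by (simp add: atoms_def)

lemma space_atoms [simp]: "space (atoms w) = UNIV"
  by (simp add: atoms_def)

lemma emeasure_atoms_finite:
  assumes "locally_finite {x. w x \<noteq> 0}" "\<And>x. w x \<ge> 0" "B \<in> sets borel" "bounded B"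
  shows "emeasure (atoms w) B = ennreal (atomic w B)"
proof -
  have "{a \<in> B. 0 < ennreal (w a)} = {a \<in> B. w a \<noteq> 0}"
    using assms(2) by (auto simp: less_le)
  moreover have "finite {a \<in> B. w a \<noteq> 0}"
    using assms by (intro locally_finite_bounded_Collect)
  ultimately show ?thesis
    unfolding atoms_def atomic_def using assms
    by (subst emeasure_distr) (auto simp: point_measure_def measurable_def emeasure_point_measure[unfolded point_measure_def] sum_ennreal)
qed

text \<open>Reduces unbounded Borel sets to bounded ones, where the measure is a finite sum.\<close>

lemma emeasure_atoms_SUP:
  assumes "E \<in> sets borel"
  shows "emeasure (atoms w) E = (SUP n. emeasure (atoms w) (E \<inter> {- real n..real n}))"
proof -
  have "(SUP n. emeasure (atoms w) (E \<inter> {- real n..real n})) = emeasure (atoms w) (\<Union>n. E \<inter> {- real n..real n})"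
    using assms by (intro SUP_emeasure_incseq) (auto simp: incseq_def)
  also have "(\<Union>n. E \<inter> {- real n..real n}) = E"
  proof -
    have "\<exists>n. x \<in> {- real n..real n}" for x
      using real_arch_simple[of "\<bar>x\<bar>"] by (auto simp: abs_le_iff) (metis minus_le_iff)
    then show ?thesis by blast
  qed
  finally show ?thesis by simp
qed

text \<open>\<open>measure_of\<close> keeps a set function only if it is a measure. Comparison with
  \<open>emeasure (atoms w)\<close> supplies this, so countable additivity of the suprema in
  \<open>positive_part\<close> and \<open>variation\<close> need not be checked separately for
  atomic measures.\<close>

lemma measure_of_eq_atoms:
  assumes "\<And>E. E \<in> sets borel \<Longrightarrow> g E = emeasure (atoms w) E"
  shows "measure_of UNIV (sets borel) g = atoms w"
proof -
  have "measure_of UNIV (sets borel) g = measure_of UNIV (sets borel) (emeasure (atoms w))"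
    using assms by (intro measure_of_eq) (auto simp: sets.sigma_sets_eq[of borel, simplified])
  also have "\<dots> = atoms w"
    using measure_of_of_measure[of "atoms w"] by simp
  finally show ?thesis .
qed

lemma integral_atoms:
  fixes \<phi> :: "real \<Rightarrow> complex"
  assumes "locally_finite {x. w x \<noteq> 0}" "\<And>x. w x \<ge> 0" "\<phi> \<in> borel_measurable borel"
    and "bounded {x. \<phi> x \<noteq> 0}"
  shows "(LINT x|atoms w. \<phi> x) = (\<Sum>x\<in>{x. w x \<noteq> 0 \<and> \<phi> x \<noteq> 0}. of_real (w x) * \<phi> x)"
proof -
  \<comment> \<open>\<open>point_measure\<close> lives on the full power set, so the identity into
    the Borel sets is measurable for trivial reasons.\<close>
  have [simp]: "(\<lambda>x. x) \<in> measurable (point_measure UNIV (\<lambda>x. ennreal (w x))) borel"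
    by (simp add: point_measure_def measurable_def)
  have "(LINT x|atoms w. \<phi> x) = (LINT x|point_measure UNIV (\<lambda>x. ennreal (w x)). \<phi> x)"
    unfolding atoms_def using assms by (subst integral_distr) auto
  also have "\<dots> = (LINT x|count_space UNIV. w x *\<^sub>R \<phi> x)"
    unfolding point_measure_def using assms by (subst integral_density) auto
  also have "\<dots> = (\<Sum>x\<in>{x. w x \<noteq> 0 \<and> \<phi> x \<noteq> 0}. w x *\<^sub>R \<phi> x)"
    using locally_finite_bounded_Collect[OF assms(1,4)]
    by (subst lebesgue_integral_count_space_finite_support) (auto simp: conj_commute)
  finally show ?thesis by (simp add: scaleR_conv_of_real)
qed

text \<open>Inside \<open>E \<inter> {- real n..real n}\<close> the best set consists of the
  finitely many points with \<open>u x > 0\<close>; exhaustion by these bounded pieces covers all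
  Borel sets \<open>E\<close>.\<close>

lemma positive_part_atomic:
  fixes u :: "real \<Rightarrow> real"
  assumes u: "locally_finite {x. u x \<noteq> 0}"
  shows "positive_part (atomic u) = atoms (\<lambda>x. max 0 (u x))"
  unfolding positive_part_def
proof (rule measure_of_eq_atoms, rule antisym)
  let ?w = "\<lambda>x. max 0 (u x)"
  let ?M = "atoms ?w"
  have lf: "locally_finite {x. ?w x \<noteq> 0}"
    by (rule locally_finite_subset[OF u]) auto
  fix E :: "real set" assume E: "E \<in> sets borel"
  show "(SUP B\<in>{B \<in> bounded_borel. B \<subseteq> E}. ennreal (atomic u B)) \<le> emeasure ?M E"
  proof (rule SUP_least)
    fix B assume "B \<in> {B \<in> bounded_borel. B \<subseteq> E}"
    then have B: "B \<in> sets borel" "bounded B" "B \<subseteq> E" by (auto simp: bounded_borel_def)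
    have fin: "finite {x \<in> B. u x \<noteq> 0}" using locally_finite_bounded_Collect[OF u B(2)] .
    have "atomic u B \<le> sum ?w {x \<in> B. u x \<noteq> 0}"
      unfolding atomic_def by (rule sum_mono) auto
    also have "\<dots> = atomic ?w B"
      by (rule atomic_superset[symmetric]) (use fin in auto)
    finally have "ennreal (atomic u B) \<le> emeasure ?M B"
      using emeasure_atoms_finite[OF lf _ B(1,2)] by (simp add: ennreal_leI)
    also have "\<dots> \<le> emeasure ?M E" using B E by (intro emeasure_mono) auto
    finally show "ennreal (atomic u B) \<le> emeasure ?M E" .
  qed
  show "emeasure ?M E \<le> (SUP B\<in>{B \<in> bounded_borel. B \<subseteq> E}. ennreal (atomic u B))"
    unfolding emeasure_atoms_SUP[OF E]
  proof (rule SUP_least)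
    fix n
    let ?E = "E \<inter> {- real n..real n}"
    have bE: "bounded ?E" by (rule bounded_subset[of "{- real n..real n}"]) auto
    define B where "B = {x \<in> ?E. u x > 0}"
    have fin: "finite B"
      using locally_finite_bounded_Collect[OF u bE] by (rule rev_finite_subset) (auto simp: B_def)
    have "emeasure ?M ?E = ennreal (atomic ?w ?E)"
      using E bE by (intro emeasure_atoms_finite[OF lf]) auto
    also have "atomic ?w ?E = sum ?w B"
      by (rule atomic_superset[OF fin]) (auto simp: B_def max_def split: if_splits)
    also have "\<dots> = sum u B" by (rule sum.cong) (auto simp: B_def)
    also have "\<dots> = atomic u B"
      by (rule atomic_superset[symmetric, OF fin]) (auto simp: B_def)
    finally have "emeasure ?M ?E = ennreal (atomic u B)" .
    moreover have "B \<in> {B \<in> bounded_borel. B \<subseteq> E}"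
      using fin by (auto simp: bounded_borel_def B_def finite_imp_bounded intro: borel_closed finite_imp_closed)
    ultimately show "emeasure ?M ?E \<le> (SUP B\<in>{B \<in> bounded_borel. B \<subseteq> E}. ennreal (atomic u B))"
      by (auto intro: SUP_upper2)
  qed
qed

text \<open>Splitting a bounded piece into the singletons of its atoms leaves nothing to cancel, so
  families of singletons already reach the value. The upper bound is the triangle inequality on each
  member of a family.\<close>

lemma variation_atomic:
  fixes c :: "real \<Rightarrow> complex"
  assumes c: "locally_finite {x. c x \<noteq> 0}"
  shows "variation (atomic c) = atoms (\<lambda>x. norm (c x))"
  unfolding variation_def
proof (rule measure_of_eq_atoms, rule antisym)
  let ?w = "\<lambda>x. norm (c x)"
  let ?M = "atoms ?w"
  let ?\<P> = "\<lambda>E. {P. finite P \<and> disjoint P \<and> P \<subseteq> bounded_borel \<and> \<Union> P \<subseteq> E}"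
  have lf: "locally_finite {x. ?w x \<noteq> 0}" using c by simp
  fix E :: "real set" assume E: "E \<in> sets borel"
  show "(SUP P\<in>?\<P> E. \<Sum>B\<in>P. ennreal (norm (atomic c B))) \<le> emeasure ?M E"
  proof (rule SUP_least)
    fix P assume "P \<in> ?\<P> E"
    then have P: "finite P" "disjoint P" "P \<subseteq> bounded_borel" "\<Union> P \<subseteq> E" by auto
    have "ennreal (norm (atomic c B)) \<le> emeasure ?M B" if "B \<in> P" for B
    proof -
      have B: "B \<in> sets borel" "bounded B" using that P(3) by (auto simp: bounded_borel_def)
      have "norm (atomic c B) \<le> atomic ?w B"
        unfolding atomic_def by (simp add: norm_sum)
      then show ?thesis
        using emeasure_atoms_finite[OF lf _ B] by (simp add: ennreal_leI)
    qed
    then have "(\<Sum>B\<in>P. ennreal (norm (atomic c B))) \<le> (\<Sum>B\<in>P. emeasure ?M B)"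
      by (rule sum_mono)
    also have "\<dots> = emeasure ?M (\<Union> P)"
      using P sum_emeasure[of "\<lambda>B. B" P ?M]
      by (simp add: bounded_borel_def disjoint_def disjoint_family_on_def subset_iff)
    also have "\<dots> \<le> emeasure ?M E" using P E by (intro emeasure_mono) auto
    finally show "(\<Sum>B\<in>P. ennreal (norm (atomic c B))) \<le> emeasure ?M E" .
  qed
  show "emeasure ?M E \<le> (SUP P\<in>?\<P> E. \<Sum>B\<in>P. ennreal (norm (atomic c B)))"
    unfolding emeasure_atoms_SUP[OF E]
  proof (rule SUP_least)
    fix n
    let ?E = "E \<inter> {- real n..real n}"
    have bE: "bounded ?E" by (rule bounded_subset[of "{- real n..real n}"]) auto
    define X where "X = {x \<in> ?E. c x \<noteq> 0}"
    have fin: "finite X" unfolding X_def by (rule locally_finite_bounded_Collect[OF c bE])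
    have "emeasure ?M ?E = ennreal (atomic ?w ?E)"
      using E bE by (intro emeasure_atoms_finite[OF lf]) auto
    also have "atomic ?w ?E = sum ?w X"
      by (rule atomic_superset[OF fin]) (auto simp: X_def)
    also have "ennreal \<dots> = (\<Sum>x\<in>X. ennreal (norm (c x)))" by (simp add: sum_ennreal)
    also have "\<dots> = (\<Sum>x\<in>X. ennreal (norm (atomic c {x})))"
    proof (rule sum.cong[OF refl])
      fix x assume "x \<in> X"
      then have "{y \<in> {x}. c y \<noteq> 0} = {x}" by (auto simp: X_def)
      then show "ennreal (norm (c x)) = ennreal (norm (atomic c {x}))" by (simp add: atomic_def)
    qed
    also have "\<dots> = (\<Sum>B\<in>(\<lambda>x. {x}) ` X. ennreal (norm (atomic c B)))"
      by (subst sum.reindex) (auto simp: inj_on_def)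
    finally have "emeasure ?M ?E = (\<Sum>B\<in>(\<lambda>x. {x}) ` X. ennreal (norm (atomic c B)))" .
    moreover have "(\<lambda>x. {x}) ` X \<in> ?\<P> E"
      using fin by (auto simp: X_def disjoint_def bounded_borel_def)
    ultimately show "emeasure ?M ?E \<le> (SUP P\<in>?\<P> E. \<Sum>B\<in>P. ennreal (norm (atomic c B)))"
      by (auto intro: SUP_upper2)
  qed
qed

lemma atomic_linear_image:
  assumes c: "locally_finite {x. c x \<noteq> 0}" and B: "bounded B"
    and h: "h 0 = 0" "\<And>x y. h (x + y) = h x + h y"
  shows "h (atomic c B) = atomic (\<lambda>x. h (c x)) B"
proof -
  have fin: "finite {x \<in> B. c x \<noteq> 0}" by (rule locally_finite_bounded_Collect[OF c B])
  have "h (sum c S) = (\<Sum>x\<in>S. h (c x))" if "finite S" for S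
    using that by induction (auto simp: h)
  then have "h (atomic c B) = (\<Sum>x\<in>{x \<in> B. c x \<noteq> 0}. h (c x))"
    using fin by (simp add: atomic_def)
  also have "\<dots> = atomic (\<lambda>x. h (c x)) B"
    using h(1) by (intro atomic_superset[symmetric, OF fin]) auto
  finally show ?thesis .
qed

section \<open>Integration against an atomic complex measure\<close>

lemma positive_part_cong:
  assumes "\<And>B. B \<in> bounded_borel \<Longrightarrow> u B = v B"
  shows "positive_part u = positive_part v"
proof -
  have "(\<lambda>E. SUP B\<in>{B \<in> bounded_borel. B \<subseteq> E}. ennreal (u B)) =
        (\<lambda>E. SUP B\<in>{B \<in> bounded_borel. B \<subseteq> E}. ennreal (v B))"
    using assms by (intro ext SUP_cong) auto
  then show ?thesis by (simp add: positive_part_def)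
qed

lemma variation_cong:
  assumes "\<And>B. B \<in> bounded_borel \<Longrightarrow> \<mu> B = \<nu> B"
  shows "variation \<mu> = variation \<nu>"
proof -
  have "(\<lambda>E. SUP P\<in>{P. finite P \<and> disjoint P \<and> P \<subseteq> bounded_borel \<and> \<Union>P \<subseteq> E}.
        \<Sum>B\<in>P. ennreal (norm (\<mu> B))) = (\<lambda>E. SUP P\<in>{P. finite P \<and> disjoint P \<and> P \<subseteq> bounded_borel \<and> \<Union>P \<subseteq> E}.
        \<Sum>B\<in>P. ennreal (norm (\<nu> B)))"
    using assms by (intro ext SUP_cong sum.cong) auto
  then show ?thesis by (simp add: variation_def)
qed

text \<open>\<open>S\<close> may be any finite set containing the relevant atoms, so that one set
  serves the positive and negative parts here and the real and imaginary parts below; its other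
  points contribute 0.\<close>

lemma signed_integral_atomic:
  fixes u :: "real \<Rightarrow> real" and \<phi> :: "real \<Rightarrow> complex"
  assumes u: "locally_finite {x. u x \<noteq> 0}"
    and v: "\<And>B. B \<in> bounded_borel \<Longrightarrow> v B = atomic u B"
    and \<phi>: "\<phi> \<in> borel_measurable borel" "bounded {x. \<phi> x \<noteq> 0}"
    and S: "finite S" "{x. u x \<noteq> 0 \<and> \<phi> x \<noteq> 0} \<subseteq> S"
  shows "signed_integral v \<phi> = (\<Sum>x\<in>S. of_real (u x) * \<phi> x)"
proof -
  have lf1: "locally_finite {x. max 0 (u x) \<noteq> 0}" by (rule locally_finite_subset[OF u]) auto
  have lf2: "locally_finite {x. max 0 (- u x) \<noteq> 0}" by (rule locally_finite_subset[OF u]) auto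
  have "- v B = atomic (\<lambda>x. - u x) B" if "B \<in> bounded_borel" for B
    using atomic_linear_image[OF u, of B uminus] v[OF that] that by (simp add: bounded_borel_def)
  then have p2: "positive_part (\<lambda>B. - v B) = atoms (\<lambda>x. max 0 (- u x))"
    using u by (subst positive_part_cong[where v = "atomic (\<lambda>x. - u x)"]) (auto intro: positive_part_atomic)
  have p1: "positive_part v = atoms (\<lambda>x. max 0 (u x))"
    using u v by (subst positive_part_cong[where v = "atomic u"]) (auto intro: positive_part_atomic)
  have "(LINT x|atoms (\<lambda>x. max 0 (u x)). \<phi> x) = (\<Sum>x\<in>S. of_real (max 0 (u x)) * \<phi> x)"
    using S by (subst integral_atoms[OF lf1 _ \<phi>]) (auto intro!: sum.mono_neutral_left)
  moreover have "(LINT x|atoms (\<lambda>x. max 0 (- u x)). \<phi> x) = (\<Sum>x\<in>S. of_real (max 0 (- u x)) * \<phi> x)"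
    using S by (subst integral_atoms[OF lf2 _ \<phi>]) (auto intro!: sum.mono_neutral_left)
  ultimately have "signed_integral v \<phi> = (\<Sum>x\<in>S. of_real (max 0 (u x)) * \<phi> x - of_real (max 0 (- u x)) * \<phi> x)"
    unfolding signed_integral_def p1 p2 by (simp add: sum_subtractf)
  also have "\<dots> = (\<Sum>x\<in>S. of_real (u x) * \<phi> x)"
    by (rule sum.cong) (auto simp: max_def)
  finally show ?thesis .
qed

lemma complex_measure_integral_atomic:
  fixes c :: "real \<Rightarrow> complex" and \<phi> :: "real \<Rightarrow> complex"
  assumes c: "locally_finite {x. c x \<noteq> 0}"
    and v: "\<And>B. B \<in> bounded_borel \<Longrightarrow> \<nu> B = atomic c B"
    and \<phi>: "\<phi> \<in> borel_measurable borel" "bounded {x. \<phi> x \<noteq> 0}"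
    and S: "finite S" "{x. c x \<noteq> 0 \<and> \<phi> x \<noteq> 0} \<subseteq> S"
  shows "complex_measure_integral \<nu> \<phi> = (\<Sum>x\<in>S. c x * \<phi> x)"
proof -
  have "Re (\<nu> B) = atomic (\<lambda>x. Re (c x)) B" "Im (\<nu> B) = atomic (\<lambda>x. Im (c x)) B"
    if "B \<in> bounded_borel" for B
    using atomic_linear_image[OF c, of B Re] atomic_linear_image[OF c, of B Im] v[OF that] that
    by (simp_all add: bounded_borel_def)
  then have "complex_measure_integral \<nu> \<phi> = (\<Sum>x\<in>S. of_real (Re (c x)) * \<phi> x) + \<i> * (\<Sum>x\<in>S. of_real (Im (c x)) * \<phi> x)"
    unfolding complex_measure_integral_def using S
    by (subst (1 2) signed_integral_atomic[OF _ _ \<phi> S(1)])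
       (auto intro!: locally_finite_subset[OF c] subsetD[OF S(2)])
  also have "\<dots> = (\<Sum>x\<in>S. (of_real (Re (c x)) + \<i> * of_real (Im (c x))) * \<phi> x)"
    by (simp add: sum_distrib_left sum.distrib algebra_simps)
  finally show ?thesis by (simp add: complex_eq[symmetric])
qed

text \<open>A bounded union contains finitely many atoms, so all but finitely many members of the
  family carry none and the series is a finite sum. \<open>ix\<close> sends each atom to the one
  member that contains it.\<close>

lemma complex_measure_atomic:
  assumes c: "locally_finite {x. c x \<noteq> 0}"
  shows "complex_measure (atomic c)"
  unfolding complex_measure_def
proof safe
  fix A :: "nat \<Rightarrow> real set"
  assume A: "disjoint_family A" "bounded (\<Union>i. A i)"
  let ?X = "{x \<in> (\<Union>i. A i). c x \<noteq> 0}"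
  have fin: "finite ?X" by (rule locally_finite_bounded_Collect[OF c A(2)])
  have fin': "finite {x \<in> A i. c x \<noteq> 0}" for i by (rule finite_subset[OF _ fin]) auto
  have "\<forall>x\<in>?X. \<exists>i. x \<in> A i" by auto
  then obtain ix where ix: "\<And>x. x \<in> ?X \<Longrightarrow> x \<in> A (ix x)" by metis
  have ix': "ix x = i" if "x \<in> A i" "c x \<noteq> 0" for x i
    using ix[of x] that A(1) by (auto simp: disjoint_family_on_def)
  have "(\<lambda>i. atomic c (A i)) sums (\<Sum>i\<in>ix ` ?X. atomic c (A i))"
  proof (rule sums_finite)
    show "finite (ix ` ?X)" using fin by simp
    fix i assume "i \<notin> ix ` ?X"
    then have "{x \<in> A i. c x \<noteq> 0} = {}" using ix' by blast
    then show "atomic c (A i) = 0" by (simp add: atomic_def)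
  qed
  also have "(\<Sum>i\<in>ix ` ?X. atomic c (A i)) = sum c (\<Union>i\<in>ix ` ?X. {x \<in> A i. c x \<noteq> 0})"
    unfolding atomic_def using fin fin' A(1)
    by (subst sum.UNION_disjoint) (auto simp: disjoint_family_on_def)
  also have "(\<Union>i\<in>ix ` ?X. {x \<in> A i. c x \<noteq> 0}) = ?X" using ix by blast
  finally show "(\<lambda>i. atomic c (A i)) sums atomic c (\<Union>i. A i)" by (simp add: atomic_def)
qed

text \<open>A point that is no atom has an open neighbourhood of measure 0, namely the unit ball
  around it without its finitely many atoms. So the support lies in the set of atoms.\<close>

lemma measure_support_variation_atomic:
  fixes c :: "real \<Rightarrow> complex"
  assumes c: "locally_finite {x. c x \<noteq> 0}"
  shows "locally_finite (measure_support (variation (atomic c)))"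
proof (rule locally_finite_subset[OF c], rule subsetI, rule ccontr)
  fix x assume x: "x \<in> measure_support (variation (atomic c))" "x \<notin> {x. c x \<noteq> 0}"
  have "finite ({x. c x \<noteq> 0} \<inter> ball x 1)" using c by (auto simp: locally_finite_def)
  then have "open (ball x 1 - ({x. c x \<noteq> 0} \<inter> ball x 1))"
    by (intro open_Diff) (auto intro: finite_imp_closed)
  moreover have "emeasure (variation (atomic c)) (ball x 1 - ({x. c x \<noteq> 0} \<inter> ball x 1)) = 0"
  proof -
    have "locally_finite {x. norm (c x) \<noteq> 0}" using c by simp
    then have "emeasure (variation (atomic c)) (ball x 1 - ({x. c x \<noteq> 0} \<inter> ball x 1)) =
        ennreal (atomic (\<lambda>x. norm (c x)) (ball x 1 - ({x. c x \<noteq> 0} \<inter> ball x 1)))"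
      unfolding variation_atomic[OF c]
      by (rule emeasure_atoms_finite) (use \<open>open _\<close> in \<open>auto intro: bounded_subset[OF bounded_ball[of x 1]]\<close>)
    also have "atomic (\<lambda>x. norm (c x)) (ball x 1 - ({x. c x \<noteq> 0} \<inter> ball x 1)) = 0"
      unfolding atomic_def by (rule sum.neutral) auto
    finally show ?thesis by simp
  qed
  ultimately show False using x by (auto simp: measure_support_def)
qed

section \<open>The variation of a complex measure\<close>

text \<open>The set function that \<open>variation\<close> hands to \<open>measure_of\<close>. The
  quasicrystal property admits an arbitrary representing measure, so countable additivity has to be
  shown for every \<open>\<nu>\<close>; this is what makes \<open>emeasure (variation \<nu>)\<close>
  return these values.\<close>

definition variation_on :: "(real set \<Rightarrow> complex) \<Rightarrow> real set \<Rightarrow> ennreal" where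
  "variation_on \<nu> E = (SUP P\<in>{P. finite P \<and> disjoint P \<and> P \<subseteq> bounded_borel \<and> \<Union>P \<subseteq> E}.
        \<Sum>B\<in>P. ennreal (norm (\<nu> B)))"

lemma bounded_borel_empty [simp]: "{} \<in> bounded_borel"
  by (simp add: bounded_borel_def)

lemma bounded_borel_Int: "B \<in> bounded_borel \<Longrightarrow> E \<in> sets borel \<Longrightarrow> B \<inter> E \<in> bounded_borel"
  by (auto simp: bounded_borel_def intro: bounded_subset)

lemma complex_measure_empty:
  assumes "complex_measure \<nu>"
  shows "\<nu> {} = 0"
proof -
  have "(\<lambda>i::nat. \<nu> {}) sums \<nu> (\<Union>i::nat. {})"
    using assms[unfolded complex_measure_def, rule_format, of "\<lambda>_. {}"] by (simp add: disjoint_family_on_def)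
  then have "summable (\<lambda>i::nat. \<nu> {})" by (rule sums_summable)
  then show ?thesis by (simp add: summable_const_iff)
qed

lemma complex_measure_Un:
  assumes \<nu>: "complex_measure \<nu>" and "A \<in> bounded_borel" "B \<in> bounded_borel" "A \<inter> B = {}"
  shows "\<nu> (A \<union> B) = \<nu> A + \<nu> B"
proof -
  let ?A = "binaryset A B"
  have "range ?A \<subseteq> bounded_borel" "disjoint_family ?A" "bounded (\<Union>i. ?A i)"
    using assms by (auto simp: binaryset_def disjoint_family_on_def UN_binaryset_eq bounded_borel_def)
  then have "(\<lambda>i. \<nu> (?A i)) sums \<nu> (\<Union>i. ?A i)"
    using \<nu> unfolding complex_measure_def by blast
  moreover have "(\<lambda>i. \<nu> (?A i)) sums (\<nu> A + \<nu> B)"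
    by (rule binaryset_sums) (rule complex_measure_empty[OF \<nu>])
  ultimately show ?thesis
    using sums_unique2 by (metis UN_binaryset_eq)
qed

lemma complex_measure_finite_set:
  assumes \<nu>: "complex_measure \<nu>" and "finite X"
  shows "\<nu> X = (\<Sum>x\<in>X. \<nu> {x})"
  using assms(2)
proof (induction X)
  case empty
  then show ?case by (simp add: complex_measure_empty[OF \<nu>])
next
  case (insert x X)
  have "\<nu> ({x} \<union> X) = \<nu> {x} + \<nu> X"
    using insert by (intro complex_measure_Un[OF \<nu>])
      (auto simp: bounded_borel_def finite_imp_bounded intro: borel_closed finite_imp_closed)
  then show ?case using insert by simp
qed

lemma sum_le_variation_on:
  assumes "finite P" "disjoint P" "P \<subseteq> bounded_borel" "\<Union>P \<subseteq> E"
  shows "(\<Sum>B\<in>P. ennreal (norm (\<nu> B))) \<le> variation_on \<nu> E"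
  unfolding variation_on_def using assms by (intro SUP_upper) auto

lemma norm_le_variation_on:
  assumes "B \<in> bounded_borel" "B \<subseteq> E"
  shows "ennreal (norm (\<nu> B)) \<le> variation_on \<nu> E"
  using sum_le_variation_on[of "{B}" E \<nu>] assms by auto

lemma variation_on_mono: "E \<subseteq> F \<Longrightarrow> variation_on \<nu> E \<le> variation_on \<nu> F"
  unfolding variation_on_def by (rule SUP_subset_mono) auto

text \<open>Families inside disjoint sets can be merged. The only member they can share is the empty
  set, where \<open>\<nu>\<close> vanishes.\<close>

lemma variation_on_superadditive:
  assumes \<nu>: "complex_measure \<nu>" and "E \<inter> F = {}"
  shows "variation_on \<nu> E + variation_on \<nu> F \<le> variation_on \<nu> (E \<union> F)"
proof -
  let ?\<P> = "\<lambda>E. {P. finite P \<and> disjoint P \<and> P \<subseteq> bounded_borel \<and> \<Union> P \<subseteq> E}"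
  let ?s = "\<lambda>P. \<Sum>B\<in>P. ennreal (norm (\<nu> B))"
  have ne: "?\<P> E \<noteq> {}" for E by (auto intro!: exI[of _ "{}"])
  have *: "?s P + ?s Q \<le> variation_on \<nu> (E \<union> F)" if P: "P \<in> ?\<P> E" and Q: "Q \<in> ?\<P> F" for P Q
  proof -
    have "P \<inter> Q \<subseteq> {{}}" using P Q assms(2) by blast
    then have "?s (P \<inter> Q) = 0"
      by (intro sum.neutral) (auto simp: complex_measure_empty[OF \<nu>])
    then have "?s P + ?s Q = ?s (P \<union> Q)"
      using P Q sum.union_inter[of P Q "\<lambda>B. ennreal (norm (\<nu> B))"] by simp
    also have "disjoint (P \<union> Q)"
      using P Q assms(2) by (intro disjoint_union) blast+
    then have "?s (P \<union> Q) \<le> variation_on \<nu> (E \<union> F)"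
      using P Q by (intro sum_le_variation_on) auto
    finally show ?thesis .
  qed
  have "variation_on \<nu> E + ?s Q \<le> variation_on \<nu> (E \<union> F)" if "Q \<in> ?\<P> F" for Q
    unfolding variation_on_def[of \<nu> E]
    by (subst ennreal_SUP_add_left[symmetric, OF ne]) (rule SUP_least, rule *[OF _ that])
  then show ?thesis
    unfolding variation_on_def[of \<nu> F]
    by (subst ennreal_SUP_add_right[OF ne]) (rule SUP_least)
qed

lemma variation_on_empty:
  assumes \<nu>: "complex_measure \<nu>"
  shows "variation_on \<nu> {} = 0"
proof -
  have "(\<Sum>B\<in>P. ennreal (norm (\<nu> B))) = 0" if "\<Union> P \<subseteq> {}" for P
    using that by (intro sum.neutral) (auto simp: complex_measure_empty[OF \<nu>])
  then have "variation_on \<nu> {} \<le> 0" unfolding variation_on_def by (intro SUP_least) auto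
  then show ?thesis by simp
qed

text \<open>Each member \<open>B\<close> of a family is cut along the sets \<open>A i\<close>.
  Countable additivity on the bounded set \<open>B\<close> and the triangle inequality bound its
  contribution, and exchanging the sums groups the pieces by \<open>i\<close>.\<close>

lemma variation_on_countably_subadditive:
  assumes \<nu>: "complex_measure \<nu>" and A: "range A \<subseteq> sets borel" "disjoint_family A"
  shows "variation_on \<nu> (\<Union>i. A i) \<le> (\<Sum>i. variation_on \<nu> (A i))"
proof -
  have "(\<Sum>B\<in>P. ennreal (norm (\<nu> B))) \<le> (\<Sum>i. variation_on \<nu> (A i))"
    if P: "finite P" "disjoint P" "P \<subseteq> bounded_borel" "\<Union> P \<subseteq> (\<Union>i. A i)" for P
  proof -
    have "(\<Sum>B\<in>P. ennreal (norm (\<nu> B))) \<le> (\<Sum>B\<in>P. \<Sum>i. ennreal (norm (\<nu> (B \<inter> A i))))"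
    proof (rule sum_mono)
      fix B assume "B \<in> P"
      then have B: "B \<in> bounded_borel" "(\<Union>i. B \<inter> A i) = B" using P(3,4) by blast+
      have "(\<lambda>i. \<nu> (B \<inter> A i)) sums \<nu> (\<Union>i. B \<inter> A i)"
      proof -
        have "range (\<lambda>i. B \<inter> A i) \<subseteq> bounded_borel" using B(1) A(1) by (auto intro: bounded_borel_Int)
        moreover have "disjoint_family (\<lambda>i. B \<inter> A i)"
          using A(2) by (auto simp: disjoint_family_on_def)
        moreover have "bounded (\<Union>i. B \<inter> A i)" unfolding B(2) using B(1) by (simp add: bounded_borel_def)
        ultimately show ?thesis using \<nu> unfolding complex_measure_def by blast
      qed
      then have s: "(\<lambda>i. \<nu> (B \<inter> A i)) sums \<nu> B" unfolding B(2) .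
      show "ennreal (norm (\<nu> B)) \<le> (\<Sum>i. ennreal (norm (\<nu> (B \<inter> A i))))"
      proof (cases "summable (\<lambda>i. norm (\<nu> (B \<inter> A i)))")
        case True
        then have "norm (\<nu> B) \<le> (\<Sum>i. norm (\<nu> (B \<inter> A i)))"
          using summable_norm[OF True] s by (simp add: sums_iff)
        then have "ennreal (norm (\<nu> B)) \<le> ennreal (\<Sum>i. norm (\<nu> (B \<inter> A i)))" by (rule ennreal_leI)
        also have "\<dots> = (\<Sum>i. ennreal (norm (\<nu> (B \<inter> A i))))"
          by (rule suminf_ennreal2[symmetric, OF norm_ge_zero True])
        finally show ?thesis .
      next
        \<comment> \<open>If the norms are not summable, their sum in \<open>ennreal\<close> is
          infinite and the bound is trivial.\<close>
        case False
        then have "(\<Sum>i. ennreal (norm (\<nu> (B \<inter> A i)))) = top"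
          using summable_suminf_not_top[of "\<lambda>i. norm (\<nu> (B \<inter> A i))", OF norm_ge_zero] by blast
        then show ?thesis by (simp only: top_greatest)
      qed
    qed
    also have "\<dots> = (\<Sum>i. \<Sum>B\<in>P. ennreal (norm (\<nu> (B \<inter> A i))))"
      by (rule suminf_sum[symmetric]) auto
    also have "\<dots> \<le> (\<Sum>i. variation_on \<nu> (A i))"
    proof (rule suminf_le)
      fix i
      \<comment> \<open>Different members may share the empty trace on \<open>A i\<close>;
        discarding these makes the trace map injective.\<close>
      let ?Q = "{B \<in> P. B \<inter> A i \<noteq> {}}"
      have inj: "inj_on (\<lambda>B. B \<inter> A i) ?Q"
      proof (rule inj_onI, rule ccontr)
        fix B B' assume B: "B \<in> ?Q" "B' \<in> ?Q" "B \<inter> A i = B' \<inter> A i" "B \<noteq> B'"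
        then have "B \<inter> B' = {}" using P(2) by (auto simp: disjoint_def)
        then show False using B by blast
      qed
      have disj: "disjoint ((\<lambda>B. B \<inter> A i) ` ?Q)"
      proof (rule disjointI)
        fix X Y assume XY: "X \<in> (\<lambda>B. B \<inter> A i) ` ?Q" "Y \<in> (\<lambda>B. B \<inter> A i) ` ?Q" "X \<noteq> Y"
        then obtain B B' where "B \<in> P" "B' \<in> P" "X = B \<inter> A i" "Y = B' \<inter> A i" by blast
        moreover from this have "B \<inter> B' = {}" using P(2) XY(3) by (metis disjointD)
        ultimately show "X \<inter> Y = {}" by blast
      qed
      have "(\<Sum>B\<in>P. ennreal (norm (\<nu> (B \<inter> A i)))) = (\<Sum>B\<in>?Q. ennreal (norm (\<nu> (B \<inter> A i))))"
        using P(1) by (intro sum.mono_neutral_right) (auto simp: complex_measure_empty[OF \<nu>])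
      also have "\<dots> = (\<Sum>B\<in>(\<lambda>B. B \<inter> A i) ` ?Q. ennreal (norm (\<nu> B)))"
        using inj by (simp add: sum.reindex)
      also have "\<dots> \<le> variation_on \<nu> (A i)"
        using P A(1) by (intro sum_le_variation_on disj) (auto intro!: bounded_borel_Int)
      finally show "(\<Sum>B\<in>P. ennreal (norm (\<nu> (B \<inter> A i)))) \<le> variation_on \<nu> (A i)" .
    qed auto
    finally show ?thesis .
  qed
  then show ?thesis unfolding variation_on_def[of \<nu> "\<Union>i. A i"] by (intro SUP_least) auto
qed

lemma emeasure_variation:
  assumes \<nu>: "complex_measure \<nu>" and E: "E \<in> sets borel"
  shows "emeasure (variation \<nu>) E = variation_on \<nu> E"
proof -
  have eq: "variation \<nu> = measure_of UNIV (sets borel) (variation_on \<nu>)"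
    unfolding variation_def variation_on_def ..
  have "(\<Sum>i. variation_on \<nu> (A i)) = variation_on \<nu> (\<Union>i. A i)"
    if A: "range A \<subseteq> sets borel" "disjoint_family A" for A :: "nat \<Rightarrow> real set"
  proof (rule antisym)
    have "(\<Sum>i<n. variation_on \<nu> (A i)) \<le> variation_on \<nu> (\<Union>i<n. A i)" for n
    proof (induction n)
      case (Suc n)
      have "A i \<inter> A n = {}" if "i < n" for i using A(2) that by (auto simp: disjoint_family_on_def)
      then have "(\<Union>i<n. A i) \<inter> A n = {}" by blast
      from variation_on_superadditive[OF \<nu> this] Suc show ?case
        by (simp add: lessThan_Suc Un_commute add.commute)
           (meson add_left_mono order_trans)
    qed simp
    then have "(\<Sum>i<n. variation_on \<nu> (A i)) \<le> variation_on \<nu> (\<Union>i. A i)" for n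
      by (rule order_trans) (auto intro!: variation_on_mono)
    then show "(\<Sum>i. variation_on \<nu> (A i)) \<le> variation_on \<nu> (\<Union>i. A i)"
      by (intro suminf_le_const) auto
  qed (rule variation_on_countably_subadditive[OF \<nu> A])
  then have "countably_additive (sets borel) (variation_on \<nu>)"
    by (auto simp: countably_additive_def)
  then show ?thesis
    unfolding eq using E
    by (intro emeasure_measure_of_sigma) (auto simp: positive_def variation_on_empty[OF \<nu>] intro: sets.sigma_algebra_axioms[of borel, simplified])
qed

text \<open>The complement of the support is a union of open null sets. By Lindelof countably many
  of them suffice, so it is null and \<open>\<nu>\<close> vanishes on its bounded Borel subsets.
  What remains of a bounded set is finite, which makes \<open>\<nu>\<close> a sum of point
  masses.\<close>

lemma complex_measure_eq_atomic:
  assumes \<nu>: "complex_measure \<nu>" and lf: "locally_finite (measure_support (variation \<nu>))"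
  obtains c where "locally_finite {x. c x \<noteq> 0}" "\<And>B. B \<in> bounded_borel \<Longrightarrow> \<nu> B = atomic c B"
proof -
  let ?S = "measure_support (variation \<nu>)"
  have sets: "sets (variation \<nu>) = sets borel"
    unfolding variation_def using sets.sigma_sets_eq[of "borel :: real measure"] by (simp add: sets_measure_of_conv)
  define \<U> where "\<U> = {U. open U \<and> emeasure (variation \<nu>) U = 0}"
  have "\<And>U. U \<in> \<U> \<Longrightarrow> open U" by (simp add: \<U>_def)
  from Lindelof[OF this] obtain \<U>' where \<U>': "\<U>' \<subseteq> \<U>" "countable \<U>'" "\<Union>\<U>' = \<Union>\<U>"
    by blast
  have cov: "\<Union>\<U> = - ?S" by (auto simp: \<U>_def measure_support_def)
  have "\<Union>\<U>' \<in> null_sets (variation \<nu>)"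
    using \<U>'(1,2) by (intro null_sets_UN'[of \<U>' "\<lambda>U. U", simplified]) (auto simp: \<U>_def null_sets_def sets)
  then have null: "emeasure (variation \<nu>) (- ?S) = 0" using \<U>'(3) cov by auto
  have oS: "open (- ?S)" unfolding cov[symmetric] by (auto simp: \<U>_def)
  have zero: "\<nu> B = 0" if "B \<in> bounded_borel" "B \<inter> ?S = {}" for B
  proof -
    have "ennreal (norm (\<nu> B)) \<le> variation_on \<nu> (- ?S)"
      using that by (intro norm_le_variation_on) auto
    also have "\<dots> = 0" using emeasure_variation[OF \<nu>, of "- ?S"] null oS by simp
    finally show ?thesis by simp
  qed
  define c where "c x = \<nu> {x}" for x
  have sub: "{x. c x \<noteq> 0} \<subseteq> ?S"
  proof
    fix x assume "x \<in> {x. c x \<noteq> 0}"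
    then have "\<nu> {x} \<noteq> 0" by (simp add: c_def)
    moreover have "{x} \<in> bounded_borel" by (simp add: bounded_borel_def)
    ultimately show "x \<in> ?S" using zero[of "{x}"] by blast
  qed
  show thesis
  proof
    show lfc: "locally_finite {x. c x \<noteq> 0}" by (rule locally_finite_subset[OF lf sub])
    fix B assume B: "B \<in> bounded_borel"
    then have bB: "bounded B" "B \<in> sets borel" by (auto simp: bounded_borel_def)
    have fin: "finite (?S \<inter> B)" by (rule locally_finite_Int_bounded[OF lf bB(1)])
    then have bor: "?S \<inter> B \<in> bounded_borel"
      by (auto simp: bounded_borel_def finite_imp_bounded intro: borel_closed finite_imp_closed)
    have "B - ?S \<in> bounded_borel"
      using bB oS bounded_borel_Int[OF B, of "- ?S"] by (simp add: Diff_eq)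
    then have "\<nu> ((?S \<inter> B) \<union> (B - ?S)) = \<nu> (?S \<inter> B) + \<nu> (B - ?S)"
      using bor by (intro complex_measure_Un[OF \<nu>]) auto
    moreover have "(?S \<inter> B) \<union> (B - ?S) = B" by auto
    moreover have "\<nu> (B - ?S) = 0" using \<open>B - ?S \<in> bounded_borel\<close> by (intro zero) auto
    ultimately have "\<nu> B = \<nu> (?S \<inter> B)" by simp
    also have "\<dots> = (\<Sum>x\<in>?S \<inter> B. c x)"
      unfolding c_def by (rule complex_measure_finite_set[OF \<nu> fin])
    also have "\<dots> = atomic c B"
      using sub by (intro atomic_superset[symmetric, OF fin]) auto
    finally show "\<nu> B = atomic c B" .
  qed
qed

text \<open>Serves to pass from a lower bound obtained with a narrow \<open>\<phi>\<close> to a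
  wider profile \<open>\<psi>\<close> of fixed shape, for which a tempered variation gives a growth
  bound. It holds since \<open>\<nu>\<close> consists of point masses \<open>c x\<close> and its
  variation of the masses \<open>norm (c x)\<close>.\<close>

lemma norm_complex_measure_integral_le:
  assumes \<nu>: "complex_measure \<nu>" and lf: "locally_finite (measure_support (variation \<nu>))"
    and \<phi>: "\<phi> \<in> borel_measurable borel" "bounded {x. \<phi> x \<noteq> 0}"
    and \<psi>: "\<psi> \<in> borel_measurable borel" "bounded {x. \<psi> x \<noteq> (0::real)}"
    and le: "\<And>x. norm (\<phi> x) \<le> \<psi> x"
  shows "norm (complex_measure_integral \<nu> \<phi>) \<le> norm (LINT x|variation \<nu>. complex_of_real (\<psi> x))"
proof -
  obtain c where c: "locally_finite {x. c x \<noteq> 0}" "\<And>B. B \<in> bounded_borel \<Longrightarrow> \<nu> B = atomic c B"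
    using complex_measure_eq_atomic[OF \<nu> lf] by blast
  define S where "S = {x. c x \<noteq> 0 \<and> \<psi> x \<noteq> 0}"
  have fin: "finite S"
    using locally_finite_bounded_Collect[OF c(1) \<psi>(2)] by (simp add: S_def conj_commute)
  have "\<phi> x = 0" if "\<psi> x = 0" for x using le[of x] that by simp
  then have "{x. c x \<noteq> 0 \<and> \<phi> x \<noteq> 0} \<subseteq> S" by (auto simp: S_def)
  then have "complex_measure_integral \<nu> \<phi> = (\<Sum>x\<in>S. c x * \<phi> x)"
    by (intro complex_measure_integral_atomic[OF c \<phi> fin])
  then have "norm (complex_measure_integral \<nu> \<phi>) \<le> (\<Sum>x\<in>S. norm (c x) * norm (\<phi> x))"
    using norm_sum[of "\<lambda>x. c x * \<phi> x" S] by (simp add: norm_mult)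
  also have "\<dots> \<le> (\<Sum>x\<in>S. norm (c x) * \<psi> x)"
    by (intro sum_mono mult_left_mono le) auto
  finally have "norm (complex_measure_integral \<nu> \<phi>) \<le> (\<Sum>x\<in>S. norm (c x) * \<psi> x)" .
  moreover have "variation \<nu> = atoms (\<lambda>x. norm (c x))"
    using c(2) by (subst variation_cong[of \<nu> "atomic c"]) (auto intro: variation_atomic[OF c(1)])
  then have "(LINT x|variation \<nu>. complex_of_real (\<psi> x)) = (\<Sum>x\<in>S. of_real (norm (c x)) * of_real (\<psi> x))"
    using c(1) \<psi> by (simp only:) (subst integral_atoms, auto simp: S_def)
  then have "(LINT x|variation \<nu>. complex_of_real (\<psi> x)) = of_real (\<Sum>x\<in>S. norm (c x) * \<psi> x)"
    by simp
  ultimately show ?thesis by (simp only: norm_of_real)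
qed

text \<open>
  Distinct indices may carry the same point, where the weights are added up.
\<close>

lemma given_by_measure_indexed:
  fixes s :: "'i \<Rightarrow> real" and w :: "'i \<Rightarrow> complex"
  assumes fin: "\<And>r. finite {i \<in> I. \<bar>s i\<bar> \<le> r}"
    and f: "\<And>\<phi>. \<phi> \<in> test_functions \<Longrightarrow>
      \<exists>J. finite J \<and> J \<subseteq> I \<and> (\<forall>i\<in>I - J. \<phi> (s i) = 0) \<and> f \<phi> = (\<Sum>i\<in>J. w i * \<phi> (s i))"
    and cont: "\<And>\<phi>. \<phi> \<in> test_functions \<Longrightarrow> \<phi> \<in> borel_measurable borel"
  shows "\<exists>\<nu>. given_by_measure f \<nu> \<and> locally_finite (measure_support (variation \<nu>))"
proof -
  define c where "c x = (\<Sum>i\<in>{i \<in> I. s i = x}. w i)" for x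
  have finx: "finite {i \<in> I. s i = x}" for x
    by (rule finite_subset[OF _ fin[of "\<bar>x\<bar>"]]) auto
  have c: "locally_finite {x. c x \<noteq> 0}"
  proof (rule locally_finite_subset)
    show "locally_finite (s ` I)"
      unfolding locally_finite_def
    proof safe
      fix x r
      have "s ` I \<inter> ball x r \<subseteq> s ` {i \<in> I. \<bar>s i\<bar> \<le> \<bar>x\<bar> + r}"
        by (auto simp: dist_real_def)
      then show "finite (s ` I \<inter> ball x r)" using fin by (meson finite_imageI finite_subset)
    qed
    show "{x. c x \<noteq> 0} \<subseteq> s ` I"
    proof
      fix x assume "x \<in> {x. c x \<noteq> 0}"
      then have "(\<Sum>i\<in>{i \<in> I. s i = x}. w i) \<noteq> 0" by (simp add: c_def)
      then have "{i \<in> I. s i = x} \<noteq> {}" by (metis sum.empty)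
      then show "x \<in> s ` I" by blast
    qed
  qed
  have "given_by_measure f (atomic c)"
    unfolding given_by_measure_def
  proof (intro conjI ballI complex_measure_atomic[OF c])
    fix \<phi> assume \<phi>: "\<phi> \<in> test_functions"
    then have bd: "bounded {x. \<phi> x \<noteq> 0}" by (simp add: test_functions_def)
    then obtain r where r: "\<And>x. \<phi> x \<noteq> 0 \<Longrightarrow> \<bar>x\<bar> \<le> r" by (auto simp: bounded_iff)
    define J where "J = {i \<in> I. \<bar>s i\<bar> \<le> r}"
    have J: "finite J" "J \<subseteq> I" using fin by (auto simp: J_def)
    obtain J' where J': "finite J'" "J' \<subseteq> I" "\<forall>i\<in>I - J'. \<phi> (s i) = 0" "f \<phi> = (\<Sum>i\<in>J'. w i * \<phi> (s i))"
      using f[OF \<phi>] by blast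
    \<comment> \<open>The finite set from the hypothesis is arbitrary. It is traded for
      \<open>J\<close>, which contains every index whose point lies in the support of
      \<open>\<phi>\<close>; only then are the fibres over these points complete, so that their
      weights add up to \<open>c x\<close>.\<close>
    have "f \<phi> = (\<Sum>i\<in>J \<union> J'. w i * \<phi> (s i))"
      unfolding J'(4) using J J' by (intro sum.mono_neutral_left) auto
    also have "\<dots> = (\<Sum>i\<in>J. w i * \<phi> (s i))"
      using J J' r by (intro sum.mono_neutral_right) (auto simp: J_def)
    finally have "f \<phi> = (\<Sum>i\<in>J. w i * \<phi> (s i))" .
    also have "\<dots> = (\<Sum>x\<in>s ` J. \<Sum>i\<in>{i \<in> J. s i = x}. w i * \<phi> (s i))"
      using J(1) by (rule sum.image_gen)
    also have "\<dots> = (\<Sum>x\<in>s ` J. c x * \<phi> x)"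
    proof (rule sum.cong[OF refl])
      fix x assume "x \<in> s ` J"
      then have "{i \<in> J. s i = x} = {i \<in> I. s i = x}" by (auto simp: J_def)
      then show "(\<Sum>i\<in>{i \<in> J. s i = x}. w i * \<phi> (s i)) = c x * \<phi> x"
        by (auto simp: c_def sum_distrib_right)
    qed
    also have "\<dots> = complex_measure_integral (atomic c) \<phi>"
    proof (rule complex_measure_integral_atomic[symmetric, OF c _ cont[OF \<phi>] bd])
      show "{x. c x \<noteq> 0 \<and> \<phi> x \<noteq> 0} \<subseteq> s ` J"
      proof safe
        fix x assume x: "c x \<noteq> 0" "\<phi> x \<noteq> 0"
        then have "{i \<in> I. s i = x} \<noteq> {}" unfolding c_def by (metis sum.empty)
        then obtain i where "i \<in> I" "s i = x" by blast
        then show "x \<in> s ` J" using r[OF x(2)] by (auto simp: J_def)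
      qed
    qed (use J in auto)
    finally show "f \<phi> = complex_measure_integral (atomic c) \<phi>" .
  qed
  then show ?thesis using measure_support_variation_atomic[OF c] by blast
qed

section \<open>Smooth functions and a bump\<close>

lemma smooth_has_vector_derivative:
  assumes "smooth \<phi>"
  shows "(vderivs n \<phi> has_vector_derivative vderivs (Suc n) \<phi> x) (at x)"
  using assms by (simp add: smooth_def vector_derivative_works)

text \<open>Meant for families closed under differentiation, where no closed formula for the n-th
  derivative is at hand.\<close>

lemma smooth_coinduct:
  assumes "P \<phi>" and step: "\<And>f. P f \<Longrightarrow> \<exists>f'. P f' \<and> (\<forall>x. (f has_vector_derivative f' x) (at x))"
  shows "smooth \<phi>"
proof -
  have P: "P (vderivs n \<phi>)" for n
  proof (induction n)
    case (Suc n)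
    then obtain f' where f': "P f'" "\<And>x. (vderivs n \<phi> has_vector_derivative f' x) (at x)"
      using step by blast
    then have "vderivs (Suc n) \<phi> = f'" by (auto simp: vector_derivative_at)
    then show ?case using f'(1) by simp
  qed (use assms(1) in simp)
  show ?thesis
    unfolding smooth_def
  proof (intro allI)
    fix n x
    show "vderivs n \<phi> differentiable (at x)"
      using step[OF P[of n]] by (auto intro: differentiableI_vector)
  qed
qed

lemma vderivs_affine:
  assumes "smooth \<phi>"
  shows "vderivs n (\<lambda>x. c * \<phi> (a * x + b)) = (\<lambda>x. c * (a ^ n *\<^sub>R vderivs n \<phi> (a * x + b)))"
proof (induction n)
  case (Suc n)
  have "((\<lambda>x. c * (a ^ n *\<^sub>R vderivs n \<phi> (a * x + b))) has_vector_derivative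
         c * (a ^ n *\<^sub>R (a *\<^sub>R vderivs (Suc n) \<phi> (a * x + b)))) (at x)" for x
  proof -
    have "((\<lambda>x. a * x + b) has_real_derivative a) (at x)"
      by (auto intro!: derivative_eq_intros)
    from vector_diff_chain_at[OF this[unfolded has_real_derivative_iff_has_vector_derivative] smooth_has_vector_derivative[OF assms, of n]]
    have "((\<lambda>x. vderivs n \<phi> (a * x + b)) has_vector_derivative a *\<^sub>R vderivs (Suc n) \<phi> (a * x + b)) (at x)"
      by (simp add: o_def)
    then show ?thesis
      by (intro has_vector_derivative_mult_right bounded_linear.has_vector_derivative[OF bounded_linear_scaleR_right])
  qed
  then show ?case
    by (simp only: vderivs.simps Suc) (auto simp: vector_derivative_at mult.commute)
qed simp

lemma smooth_affine:
  assumes "smooth \<phi>"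
  shows "smooth (\<lambda>x. c * \<phi> (a * x + b))"
  unfolding smooth_def vderivs_affine[OF assms]
proof (intro allI)
  fix n x
  have "(\<lambda>x. a * x + b) differentiable (at x)" by (auto intro!: derivative_intros)
  then have "(\<lambda>x. vderivs n \<phi> (a * x + b)) differentiable (at x)"
    using assms differentiable_compose[of "vderivs n \<phi>" "\<lambda>x. a * x + b" x UNIV]
    by (simp add: smooth_def)
  then have "(\<lambda>x. a ^ n *\<^sub>R vderivs n \<phi> (a * x + b)) differentiable (at x)"
    by (auto intro!: derivative_intros)
  then show "(\<lambda>x. c * (a ^ n *\<^sub>R vderivs n \<phi> (a * x + b))) differentiable (at x)"
    by (intro differentiable_mult differentiable_const)
qed

lemma smooth_continuous: "smooth \<phi> \<Longrightarrow> continuous_on A (vderivs n \<phi>)"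
  by (intro continuous_at_imp_continuous_on ballI differentiable_imp_continuous_within)
     (simp add: smooth_def)

lemma test_functions_smooth: "\<phi> \<in> test_functions \<Longrightarrow> smooth \<phi>"
  by (simp add: test_functions_def)

lemma test_functions_continuous: "\<phi> \<in> test_functions \<Longrightarrow> continuous_on A \<phi>"
  using smooth_continuous[of \<phi> A 0] by (simp add: test_functions_def)

lemma test_functions_borel: "\<phi> \<in> test_functions \<Longrightarrow> \<phi> \<in> borel_measurable borel"
  by (intro borel_measurable_continuous_onI test_functions_continuous)

lemma test_functions_affine:
  assumes "\<phi> \<in> test_functions" "a \<noteq> 0"
  shows "(\<lambda>x. c * \<phi> (a * x + b)) \<in> test_functions"
proof -
  have "{x. c * \<phi> (a * x + b) \<noteq> 0} \<subseteq> (\<lambda>x. (1 / a) *\<^sub>R (- b + x)) ` {x. \<phi> x \<noteq> 0}"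
  proof
    fix x assume "x \<in> {x. c * \<phi> (a * x + b) \<noteq> 0}"
    then have "a * x + b \<in> {x. \<phi> x \<noteq> 0}" "x = (1 / a) *\<^sub>R (- b + (a * x + b))"
      using assms(2) by auto
    then show "x \<in> (\<lambda>x. (1 / a) *\<^sub>R (- b + x)) ` {x. \<phi> x \<noteq> 0}" by blast
  qed
  moreover have "bounded ((\<lambda>x. (1 / a) *\<^sub>R (- b + x)) ` {x. \<phi> x \<noteq> 0})"
    using bounded_scaling[OF bounded_translation[of "{x. \<phi> x \<noteq> 0}" "-b"], of "1 / a"] assms(1)
    by (simp add: image_image test_functions_def)
  ultimately show ?thesis
    using assms by (auto simp: test_functions_def smooth_affine intro: bounded_subset)
qed

lemma test_functions_shift:
  "\<phi> \<in> test_functions \<Longrightarrow> (\<lambda>x. \<phi> (x + b)) \<in> test_functions"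
  using test_functions_affine[of \<phi> 1 1 b] by simp

lemma vderivs_eq_0:
  assumes "smooth \<phi>" and supp: "\<And>x. \<bar>x\<bar> > M \<Longrightarrow> \<phi> x = 0" and "\<bar>x\<bar> > M"
  shows "vderivs n \<phi> x = 0"
  using assms(3)
proof (induction n arbitrary: x)
  case (Suc n)
  have "open {y::real. \<bar>y\<bar> > M}" by (intro open_Collect_less continuous_intros)
  then have "(vderivs n \<phi> has_vector_derivative 0) (at x)"
    by (rule has_vector_derivative_transform_within_open[OF has_vector_derivative_const])
       (use Suc in auto)
  then show ?case by (simp add: vector_derivative_at)
qed (use supp in simp)

lemma test_functions_bound:
  assumes "\<phi> \<in> test_functions"
  obtains M where "\<And>x. \<bar>x\<bar> > M \<Longrightarrow> \<phi> x = 0" "M \<ge> 0"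
proof -
  obtain M where "\<And>x. \<phi> x \<noteq> 0 \<Longrightarrow> \<bar>x\<bar> \<le> M"
    using assms by (auto simp: test_functions_def bounded_iff)
  then show thesis by (intro that[of "max 0 M"]) force+
qed

lemma test_functions_subset_schwartz: "test_functions \<subseteq> schwartz"
proof
  fix \<phi> assume \<phi>: "\<phi> \<in> test_functions"
  obtain M where M: "\<And>x. \<bar>x\<bar> > M \<Longrightarrow> \<phi> x = 0" using test_functions_bound[OF \<phi>] by blast
  have sm: "smooth \<phi>" by (rule test_functions_smooth[OF \<phi>])
  have "bounded (range (\<lambda>x. x ^ k *\<^sub>R vderivs n \<phi> x))" for k n
  proof -
    let ?f = "\<lambda>x. x ^ k *\<^sub>R vderivs n \<phi> x"
    have "compact (?f ` {-M..M})"
      by (intro compact_continuous_image continuous_intros smooth_continuous sm) auto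
    then have "bounded (insert 0 (?f ` {-M..M}))"
      by (simp add: compact_imp_bounded)
    moreover have "range ?f \<subseteq> insert 0 (?f ` {-M..M})"
    proof (rule image_subsetI)
      fix x
      show "?f x \<in> insert 0 (?f ` {-M..M})"
      proof (cases "\<bar>x\<bar> > M")
        case True
        then show ?thesis using vderivs_eq_0[OF sm M True] by simp
      next
        case False
        then have "x \<in> {-M..M}" by auto
        then show ?thesis by blast
      qed
    qed
    ultimately show ?thesis by (rule bounded_subset)
  qed
  then show "\<phi> \<in> schwartz" using sm by (simp add: schwartz_def)
qed

text \<open>The hypothesis at \<open>y = x\<close> gives \<open>f x = 0\<close>, so the difference
  quotient is at most \<open>C * \<bar>y - x\<bar>\<close>. It replaces the differentiation of a
  formula at the points outside the open unit interval, in particular at its ends.\<close>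

lemma has_vector_derivative_0_if_quadratic:
  fixes f :: "real \<Rightarrow> 'a::real_normed_vector"
  assumes "\<And>y. norm (f y) \<le> C * (y - x)\<^sup>2"
  shows "(f has_vector_derivative 0) (at x)"
  unfolding has_vector_derivative_def
proof (rule has_derivativeI_sandwich[of 1 _ _ _ _ "\<lambda>y. C * \<bar>y - x\<bar>"])
  have f0: "f x = 0" using assms[of x] by simp
  fix y :: real assume "y \<noteq> x"
  then show "norm (f y - f x - (y - x) *\<^sub>R 0) / norm (y - x) \<le> C * \<bar>y - x\<bar>"
    using assms[of y] f0 by (simp add: field_simps power2_eq_square abs_mult_self_eq)
  next
  have "((\<lambda>y. C * \<bar>y - x\<bar>) \<longlongrightarrow> C * \<bar>x - x\<bar>) (at x)" by (intro tendsto_intros)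
  then show "((\<lambda>y. C * \<bar>y - x\<bar>) \<longlongrightarrow> 0) (at x)" by simp
qed (auto intro: bounded_linear_intros)

text \<open>The exponential series of \<open>1 / u\<close> dominates its term of index
  \<open>m\<close>.\<close>

lemma exp_minus_inverse_le:
  fixes u :: real
  assumes u: "u > 0"
  shows "exp (- 1 / u) \<le> fact m * u ^ m"
proof -
  have "(1 / u) ^ m /\<^sub>R fact m \<le> (\<Sum>n. (1 / u) ^ n /\<^sub>R fact n)"
    using u sum_le_suminf[OF summable_exp_generic[of "1 / u"], of "{m}"] by simp
  then have "(1 / u) ^ m / fact m \<le> exp (1 / u)" by (simp add: exp_def divide_inverse mult.commute)
  then show ?thesis using u by (simp add: exp_minus field_simps)
qed

definition bump :: "real \<Rightarrow> real" where
  "bump x = (if \<bar>x\<bar> < 1 then exp (- 1 / (1 - x\<^sup>2)) else 0)"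

text \<open>
  The derivatives of \<^const>\<open>bump\<close> stay in the family of functions
  \<open>p(x) (1 - x\<^sup>2)\<^sup>-\<^sup>k exp (- 1 / (1 - x\<^sup>2))\<close> extended by 0, with \<open>p\<close> a polynomial.
\<close>

lemma smooth_bump: "smooth (\<lambda>x. complex_of_real (bump x))"
proof -
  define g where "g p k x = (if \<bar>x\<bar> < 1 then of_real (poly p x / (1 - x\<^sup>2) ^ k * exp (- 1 / (1 - x\<^sup>2))) else 0 :: complex)"
    for p :: "real poly" and k x
  \<comment> \<open>Numerator of the derivative over the denominator with exponent
    \<open>k + 2\<close>: \<open>[:1, 0, -1:]\<close> stands for \<open>1 - x\<^sup>2\<close>, and
    differentiating the exponential costs two powers of it.\<close>
  define q where "q p k = pderiv p * [:1, 0, -1:]\<^sup>2 + [:0, 2 * real k:] * [:1, 0, -1:] * p - [:0, 2:] * p"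
    for p and k :: nat
  have der: "(g p k has_vector_derivative g (q p k) (k + 2) x) (at x)" for p k x
  proof (cases "\<bar>x\<bar> < 1")
    case True
    then have u: "1 - x\<^sup>2 > 0" by (simp add: abs_square_less_1)
    let ?u = "1 - x\<^sup>2"
    let ?E = "exp (- 1 / ?u)"
    have d1: "((\<lambda>x. poly p x / (1 - x\<^sup>2) ^ k) has_real_derivative
      ((poly (pderiv p) x * ?u ^ k - poly p x * (real k * ?u ^ (k - 1) * (- (2 * x)))) / (?u ^ k * ?u ^ k))) (at x)"
      using u by (auto intro!: derivative_eq_intros)
    have d2: "((\<lambda>x. exp (- 1 / (1 - x\<^sup>2))) has_real_derivative (?E * (- (2 * x) / (?u * ?u)))) (at x)"
      using u by (auto intro!: derivative_eq_intros)
    have "((\<lambda>x. poly p x / (1 - x\<^sup>2) ^ k * exp (- 1 / (1 - x\<^sup>2))) has_real_derivative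
      ((poly (pderiv p) x * ?u ^ k - poly p x * (real k * ?u ^ (k - 1) * (- (2 * x)))) / (?u ^ k * ?u ^ k)) * ?E
        + (?E * (- (2 * x) / (?u * ?u))) * (poly p x / ?u ^ k)) (at x)"
      by (rule DERIV_mult[OF d1 d2])
    also have "((poly (pderiv p) x * ?u ^ k - poly p x * (real k * ?u ^ (k - 1) * (- (2 * x)))) / (?u ^ k * ?u ^ k)) * ?E
        + (?E * (- (2 * x) / (?u * ?u))) * (poly p x / ?u ^ k)
      = poly (q p k) x / ?u ^ (k + 2) * ?E"
    proof -
      have "real k * ?u ^ (k - 1) = real k * ?u ^ k / ?u"
        using u by (cases k) auto
      moreover have "poly (q p k) x = poly (pderiv p) x * ?u\<^sup>2 + 2 * real k * x * ?u * poly p x - 2 * x * poly p x"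
        by (simp add: q_def power2_eq_square algebra_simps)
      moreover have "((a * U - b * (k' * U / v * (- (2 * x)))) / (U * U)) * E + (E * (- (2 * x) / (v * v))) * (b / U)
         = (a * v\<^sup>2 + 2 * k' * x * v * b - 2 * x * b) / (U * v\<^sup>2) * E"
        if "U > 0" "v > 0" for a b U v k' E :: real
        using that by (simp add: field_simps power2_eq_square)
      ultimately show ?thesis using u by (simp add: power_add power2_eq_square)
    qed
    finally have "((\<lambda>x. of_real (poly p x / (1 - x\<^sup>2) ^ k * exp (- 1 / (1 - x\<^sup>2))) :: complex) has_vector_derivative
        of_real (poly (q p k) x / ?u ^ (k + 2) * ?E)) (at x)"
      by (intro has_vector_derivative_of_real) (simp add: has_real_derivative_iff_has_vector_derivative)
    then have "((\<lambda>x. of_real (poly p x / (1 - x\<^sup>2) ^ k * exp (- 1 / (1 - x\<^sup>2))) :: complex) has_vector_derivative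
        g (q p k) (k + 2) x) (at x)" using True by (simp add: g_def)
    then show ?thesis
      by (rule has_vector_derivative_transform_within_open[where S = "ball 0 1"])
         (use True in \<open>auto simp: g_def dist_real_def\<close>)
  next
    case False
    have "bounded (poly p ` {-1..1})"
      by (intro compact_imp_bounded compact_continuous_image continuous_intros) auto
    then have "\<exists>B. \<forall>y\<in>{-1..1}. \<bar>poly p y\<bar> \<le> B" by (simp add: bounded_iff)
    then obtain B where B: "\<And>y. y \<in> {-1..1} \<Longrightarrow> \<bar>poly p y\<bar> \<le> B" by blast
    have "\<bar>poly p 0\<bar> \<le> B" by (rule B) auto
    then have "B \<ge> 0" by linarith
    \<comment> \<open>Of the \<open>k + 2\<close> powers of \<open>u\<close> gained from the
      exponential, \<open>k\<close> cancel the denominator and two give the quadratic bound. Since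
      \<open>x\<close> is outside the open interval, \<open>u \<le> 2 * \<bar>y - x\<bar>\<close>;
      the square of this 2 is the factor 4.\<close>
    have "norm (g p k y) \<le> (4 * B * fact (k + 2)) * (y - x)\<^sup>2" for y
    proof (cases "\<bar>y\<bar> < 1")
      case True
      define u where "u = 1 - y\<^sup>2"
      have u: "u > 0" using True by (simp add: abs_square_less_1 u_def)
      have "exp (- 1 / u) \<le> fact (k + 2) * u ^ (k + 2)" by (rule exp_minus_inverse_le[OF u])
      moreover have "u ^ (k + 2) = u ^ k * u\<^sup>2" by (rule power_add)
      ultimately have "exp (- 1 / u) / u ^ k \<le> fact (k + 2) * u\<^sup>2"
        using u by (simp only: pos_divide_le_eq zero_less_power mult_ac)
      moreover have "u\<^sup>2 \<le> (2 * \<bar>y - x\<bar>)\<^sup>2"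
      proof (rule power_mono)
        have "u = (1 - \<bar>y\<bar>) * (1 + \<bar>y\<bar>)" by (simp add: u_def algebra_simps power2_eq_square)
        also have "\<dots> \<le> (1 - \<bar>y\<bar>) * 2" using True by (intro mult_left_mono) auto
        also have "\<dots> \<le> 2 * \<bar>y - x\<bar>" using False abs_triangle_ineq[of "x - y" y] by (simp add: abs_minus_commute)
        finally show "u \<le> 2 * \<bar>y - x\<bar>" .
      qed (use u in auto)
      ultimately have "exp (- 1 / u) / u ^ k \<le> fact (k + 2) * (2 * \<bar>y - x\<bar>)\<^sup>2"
        by (meson fact_ge_zero mult_left_mono order_trans)
      then have "\<bar>poly p y\<bar> * (exp (- 1 / u) / u ^ k) \<le> B * (fact (k + 2) * (2 * \<bar>y - x\<bar>)\<^sup>2)"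
      proof (intro mult_mono)
        show "\<bar>poly p y\<bar> \<le> B" using True by (intro B) auto
      qed (use u \<open>B \<ge> 0\<close> in simp_all)
      moreover have "norm (g p k y) = \<bar>poly p y\<bar> * (exp (- 1 / u) / u ^ k)"
        unfolding g_def u_def[symmetric] using True u by (simp only: if_True norm_of_real) (simp add: abs_mult)
      moreover have "B * (fact (k + 2) * (2 * \<bar>y - x\<bar>)\<^sup>2) = 4 * B * fact (k + 2) * (y - x)\<^sup>2"
        by (simp add: power_mult_distrib del: fact_Suc)
      ultimately show ?thesis by simp
    qed (use \<open>B \<ge> 0\<close> in \<open>auto simp: g_def\<close>)
    from has_vector_derivative_0_if_quadratic[of "g p k", OF this] show ?thesis
      using False by (simp add: g_def)
  qed
  have "(\<lambda>x. complex_of_real (bump x)) = g 1 0"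
    by (auto simp: bump_def g_def)
  moreover have "smooth (g 1 0)"
  proof (rule smooth_coinduct[where P = "\<lambda>f. \<exists>p k. f = g p k"])
    show "\<exists>f'. (\<exists>p k. f' = g p k) \<and> (\<forall>x. (f has_vector_derivative f' x) (at x))" if "\<exists>p k. f = g p k" for f
      using that der by blast
  qed blast
  ultimately show ?thesis by simp
qed

lemma bump_nonneg: "bump x \<ge> 0"
  by (simp add: bump_def)

lemma bump_pos: "\<bar>x\<bar> < 1 \<Longrightarrow> bump x > 0"
  by (simp add: bump_def)

lemma bump_eq_0: "\<bar>x\<bar> \<ge> 1 \<Longrightarrow> bump x = 0"
  by (simp add: bump_def)

lemma bump_le: "bump x \<le> bump 0"
proof (cases "\<bar>x\<bar> < 1")
  case True
  then have "1 - x\<^sup>2 > 0" by (simp add: abs_square_less_1)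
  then show ?thesis using True by (simp add: bump_def field_simps)
qed (simp add: bump_def)

lemma bump_decreasing:
  assumes "\<bar>x\<bar> \<le> \<bar>y\<bar>"
  shows "bump y \<le> bump x"
proof (cases "\<bar>y\<bar> < 1")
  case True
  then have "1 - y\<^sup>2 > 0" by (simp add: abs_square_less_1)
  moreover have "x\<^sup>2 \<le> y\<^sup>2" using assms abs_le_square_iff by blast
  ultimately have "- 1 / (1 - y\<^sup>2) \<le> - 1 / (1 - x\<^sup>2)" by (simp add: field_simps)
  then show ?thesis using True assms by (simp add: bump_def)
qed (auto simp: bump_def)

lemma bump_test_function: "(\<lambda>x. complex_of_real (bump x)) \<in> test_functions"
proof -
  have "{x. complex_of_real (bump x) \<noteq> 0} \<subseteq> {-1..1}"
    using bump_eq_0 by (auto simp: abs_le_iff not_le[symmetric]) (smt (verit))+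
  then have "bounded {x. complex_of_real (bump x) \<noteq> 0}"
    by (rule bounded_subset[OF bounded_closed_interval])
  then show ?thesis
    using smooth_bump by (simp add: test_functions_def)
qed

lemma bump_affine_test_function:
  "a \<noteq> 0 \<Longrightarrow> (\<lambda>x. c * complex_of_real (bump (a * x + b))) \<in> test_functions"
  using test_functions_affine[OF bump_test_function] by simp

text \<open>Continuity at 0 provides a neighbourhood described by finitely many seminorms. The
  translate of the bump by \<open>a\<close> has weighted derivatives of size at most a constant
  times \<open>(1 + \<bar>a\<bar>) ^ N\<close>; scaled down accordingly it enters the neighbourhood,
  and homogeneity turns this into polynomial growth. A tempered variation will be contradicted
  through this bound.\<close>

lemma tempered_distribution_bump_bound:
  assumes f: "tempered_distribution f"
  obtains D N where "\<And>a. norm (f (\<lambda>x. complex_of_real (bump (x - a)))) \<le> D * (1 + \<bar>a\<bar>) ^ N"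
proof -
  let ?\<chi> = "\<lambda>x. complex_of_real (bump x)"
  have ts: "(\<lambda>x. c * complex_of_real (bump (x - a))) \<in> schwartz" for c a
    using bump_affine_test_function[of 1 c "-a"] test_functions_subset_schwartz by auto
  have ts1: "(\<lambda>x. complex_of_real (bump (x - a))) \<in> schwartz" for a
    using ts[of 1 a] by simp
  have z: "(\<lambda>x. 0) \<in> schwartz" using ts[of 0] by simp
  have hom: "f (\<lambda>x. c * \<phi> x) = c * f \<phi>" if "\<phi> \<in> schwartz" for c \<phi>
    using f that unfolding tempered_distribution_def by blast
  have f0: "f (\<lambda>x. 0) = 0" using hom[OF z, of 0] by simp
  obtain N \<delta> where \<delta>: "\<delta> > 0" and N: "\<And>\<psi>. \<psi> \<in> schwartz \<Longrightarrow>
      (\<forall>k\<le>N. \<forall>n\<le>N. schwartz_seminorm k n (\<lambda>x. \<psi> x - 0) < \<delta>) \<Longrightarrow> norm (f \<psi> - f (\<lambda>x. 0)) < 1"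
  proof -
    have "\<forall>\<epsilon>>0. \<exists>N. \<exists>\<delta>>0. \<forall>\<psi>\<in>schwartz. (\<forall>k\<le>N. \<forall>n\<le>N. schwartz_seminorm k n (\<lambda>x. \<psi> x - 0) < \<delta>) \<longrightarrow>
        norm (f \<psi> - f (\<lambda>x. 0)) < \<epsilon>"
      by (rule f[unfolded tempered_distribution_def, THEN conjunct2, THEN conjunct2, THEN bspec, OF z])
    from this[THEN spec, THEN mp, OF zero_less_one] obtain N \<delta> where "\<delta> > 0"
      "\<forall>\<psi>\<in>schwartz. (\<forall>k\<le>N. \<forall>n\<le>N. schwartz_seminorm k n (\<lambda>x. \<psi> x - 0) < \<delta>) \<longrightarrow>
        norm (f \<psi> - f (\<lambda>x. 0)) < 1" by (elim exE conjE)
    then show thesis by (intro that[of \<delta> N]) (simp_all only:)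
  qed
  have "\<exists>M. \<forall>x. norm (vderivs n ?\<chi> x) \<le> M" for n
  proof -
    have "?\<chi> \<in> schwartz" using bump_test_function test_functions_subset_schwartz by blast
    then have "bounded (range (\<lambda>x. x ^ 0 *\<^sub>R vderivs n ?\<chi> x))" unfolding schwartz_def by blast
    then show ?thesis by (auto simp: bounded_iff)
  qed
  then obtain M where M: "\<And>n x. norm (vderivs n ?\<chi> x) \<le> M n" by metis
  define M' where "M' = 1 + (\<Sum>n\<le>N. M n)"
  have Mpos: "M n \<ge> 0" for n using M[of n 0] norm_ge_zero order_trans by blast
  have M'pos: "M' > 0" using Mpos using sum_nonneg[of "{..N}" M] by (simp add: M'_def add_pos_nonneg)
  have MM': "norm (vderivs n ?\<chi> x) \<le> M'" if "n \<le> N" for n x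
  proof -
    have "M n \<le> (\<Sum>n\<le>N. M n)" using that Mpos by (intro member_le_sum) auto
    then show ?thesis using M[of n x] by (simp add: M'_def)
  qed
  show thesis
  proof
    fix a :: real
    \<comment> \<open>The factor 2 leaves room for the supremum, which inherits only the weak
      inequality with \<open>\<delta> / 2\<close>.\<close>
    define c where "c = \<delta> / (2 * M' * (1 + \<bar>a\<bar>) ^ N)"
    have c: "c > 0" using \<delta> M'pos by (simp add: c_def)
    have "schwartz_seminorm k n (\<lambda>x. of_real c * complex_of_real (bump (x - a)) - 0) < \<delta>"
      if "k \<le> N" "n \<le> N" for k n
    proof -
      have vd: "vderivs n (\<lambda>x. of_real c * complex_of_real (bump (x - a))) =
            (\<lambda>x. of_real c * vderivs n ?\<chi> (x - a))"
        using vderivs_affine[OF smooth_bump, of n "of_real c" 1 "-a"] by simp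
      have "norm (x ^ k *\<^sub>R (of_real c * vderivs n ?\<chi> (x - a))) \<le> \<delta> / 2" for x
      proof (cases "\<bar>x - a\<bar> > 1")
        case True
        then have "vderivs n ?\<chi> (x - a) = 0"
          by (intro vderivs_eq_0[OF smooth_bump]) (auto simp: bump_eq_0)
        then show ?thesis using \<delta> by simp
      next
        case False
        have "norm (x ^ k *\<^sub>R (of_real c * vderivs n ?\<chi> (x - a))) = \<bar>x\<bar> ^ k * (c * norm (vderivs n ?\<chi> (x - a)))"
          using c by (simp add: norm_mult power_abs)
        also have "\<dots> \<le> (1 + \<bar>a\<bar>) ^ k * (c * M')"
        proof (intro mult_mono power_mono)
          show "\<bar>x\<bar> \<le> 1 + \<bar>a\<bar>" using False abs_triangle_ineq[of "x - y" y] by (simp add: abs_minus_commute)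
        qed (use c MM'[OF that(2)] in simp_all)
        also have "\<dots> \<le> (1 + \<bar>a\<bar>) ^ N * (c * M')"
          using c M'pos that by (intro mult_right_mono power_increasing) auto
        also have "\<dots> = \<delta> / 2"
        proof -
          have "(1 + \<bar>a\<bar>) ^ N > 0" by (intro zero_less_power) linarith
          then show ?thesis using M'pos unfolding c_def by (simp add: field_simps)
        qed
        finally show ?thesis .
      qed
      then have "schwartz_seminorm k n (\<lambda>x. of_real c * complex_of_real (bump (x - a)) - 0) \<le> \<delta> / 2"
        unfolding schwartz_seminorm_def by (intro cSUP_least) (auto simp: vd)
      then show ?thesis using \<delta> by linarith
    qed
    then have "norm (f (\<lambda>x. of_real c * complex_of_real (bump (x - a)))) < 1"
      using N[OF ts[of "of_real c" a]] f0 by simp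
    then have "c * norm (f (\<lambda>x. complex_of_real (bump (x - a)))) < 1"
      using c by (simp add: hom[OF ts1] norm_mult)
    then have "norm (f (\<lambda>x. complex_of_real (bump (x - a)))) \<le> 1 / c"
      using c by (simp add: field_simps)
    also have "1 / c = (2 * M' / \<delta>) * (1 + \<bar>a\<bar>) ^ N" by (simp add: c_def)
    finally show "norm (f (\<lambda>x. complex_of_real (bump (x - a)))) \<le> (2 * M' / \<delta>) * (1 + \<bar>a\<bar>) ^ N" .
  qed
qed

section \<open>Fourier series\<close>

text \<open>Half-open, so that its integer translates tile the line exactly.\<close>

abbreviation unit_lborel :: "real measure" where
  "unit_lborel \<equiv> restrict_space lborel {0..<1}"

definition fourier_coeff :: "(real \<Rightarrow> complex) \<Rightarrow> int \<Rightarrow> complex" where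
  "fourier_coeff G n = (LINT x|unit_lborel. G x * cis (- (2 * pi * of_int n * x)))"

lemma finite_measure_unit_lborel: "finite_measure unit_lborel"
  by (rule finite_measureI) (simp add: emeasure_restrict_space space_restrict_space)

lemma measure_unit_lborel: "measure unit_lborel (space unit_lborel) = 1"
  by (simp add: measure_restrict_space space_restrict_space)

lemma integrable_unit_lborel:
  fixes f :: "real \<Rightarrow> complex"
  assumes "f \<in> borel_measurable borel" "\<And>x. x \<in> {0..<1} \<Longrightarrow> norm (f x) \<le> B"
  shows "integrable unit_lborel f"
proof (rule finite_measure.integrable_const_bound[OF finite_measure_unit_lborel])
  show "AE x in unit_lborel. norm (f x) \<le> B"
    using assms(2) by (intro AE_I2) (auto simp: space_restrict_space)
  show "f \<in> borel_measurable unit_lborel"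
    using assms(1) by (intro measurable_restrict_space1) simp
qed

lemma norm_integral_unit_lborel_le:
  fixes f :: "real \<Rightarrow> complex"
  assumes "f \<in> borel_measurable borel" "\<And>x. x \<in> {0..<1} \<Longrightarrow> norm (f x) \<le> B"
  shows "norm (LINT x|unit_lborel. f x) \<le> B"
proof -
  interpret finite_measure unit_lborel by (rule finite_measure_unit_lborel)
  have "norm (LINT x|unit_lborel. f x) \<le> (LINT x|unit_lborel. norm (f x))"
    by (rule integral_norm_bound)
  also have "\<dots> \<le> (LINT x|unit_lborel. B)"
    using integrable_unit_lborel[OF assms] assms(2)
    by (intro integral_mono) (auto simp: space_restrict_space)
  also have "\<dots> = B" using measure_unit_lborel by simp
  finally show ?thesis .
qed

lemma cis_borel_measurable [measurable]: "(\<lambda>x. cis (c * x)) \<in> borel_measurable borel"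
  by (intro borel_measurable_continuous_onI continuous_intros)

lemma cis_borel_measurable_minus [measurable]: "(\<lambda>x. cis (- (c * x))) \<in> borel_measurable borel"
  by (intro borel_measurable_continuous_onI continuous_intros)

lemma has_vector_derivative_cis:
  "((\<lambda>x. cis (c * x)) has_vector_derivative (\<i> * of_real c) * cis (c * x)) (at x within A)"
proof -
  have "((\<lambda>x. c * x) has_real_derivative c) (at x within A)"
    by (auto intro!: derivative_eq_intros)
  then have "((\<lambda>x. complex_of_real (c * x)) has_vector_derivative complex_of_real c) (at x within A)"
    by (rule has_vector_derivative_of_real)
  moreover have "((\<lambda>z. exp (\<i> * z)) has_field_derivative \<i> * exp (\<i> * complex_of_real (c * x)))
      (at (complex_of_real (c * x)) within (\<lambda>x. complex_of_real (c * x)) ` A)"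
    by (auto intro!: derivative_eq_intros)
  ultimately have "((\<lambda>z. exp (\<i> * z)) \<circ> (\<lambda>x. complex_of_real (c * x)) has_vector_derivative
      complex_of_real c * (\<i> * exp (\<i> * complex_of_real (c * x)))) (at x within A)"
    by (rule field_vector_diff_chain_within)
  then show ?thesis by (simp add: cis_conv_exp o_def mult_ac)
qed

lemma integral_cis_unit: "(LINT x|unit_lborel. cis (2 * pi * of_int k * x)) = (if k = 0 then 1 else 0)"
proof (cases "k = 0")
  case True
  then show ?thesis using measure_unit_lborel by simp
next
  case False
  let ?c = "2 * pi * of_int k :: real"
  have c: "?c \<noteq> 0" using False by simp
  have "(LINT x|unit_lborel. cis (?c * x)) = (LINT x|lborel. indicator {0..<1} x *\<^sub>R cis (?c * x))"
    by (subst integral_restrict_space) auto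
  also have "\<dots> = (LINT x|lborel. indicator {0..1} x *\<^sub>R cis (?c * x))"
  proof (rule integral_cong_AE)
    show "AE x in lborel. indicator {0..<1} x *\<^sub>R cis (?c * x) = indicator {0..1} x *\<^sub>R cis (?c * x)"
      using AE_lborel_singleton[of "1::real"] by eventually_elim (auto simp: indicator_def)
  qed auto
  also have "\<dots> = cis (?c * 1) / (\<i> * of_real ?c) - cis (?c * 0) / (\<i> * of_real ?c)"
  proof (rule integral_FTC_Icc)
    fix x :: real
    have "((\<lambda>x. cis (?c * x) / (\<i> * of_real ?c)) has_vector_derivative ((\<i> * of_real ?c) * cis (?c * x)) / (\<i> * of_real ?c)) (at x within {0..1})"
      by (intro has_vector_derivative_divide has_vector_derivative_cis)
    then show "((\<lambda>x. cis (?c * x) / (\<i> * of_real ?c)) has_vector_derivative cis (?c * x)) (at x within {0..1})"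
      using c by simp
  qed (auto intro!: continuous_intros)
  also have "cis (?c * 1) = 1" unfolding mult_1_right by (rule cis_multiple_2pi) auto
  finally show ?thesis using False by simp
qed

text \<open>The mean square of \<open>G - T\<close> over a period is nonnegative, where
  \<open>T\<close> is the trigonometric polynomial with the coefficients of \<open>G\<close> on
  \<open>S\<close>. The pairings of \<open>G\<close> with \<open>T\<close>, of \<open>T\<close> with
  \<open>G\<close> and of \<open>T\<close> with itself all equal the sum of squares.\<close>

lemma bessel_inequality:
  assumes G: "G \<in> borel_measurable borel" "\<And>x. x \<in> {0..<1} \<Longrightarrow> norm (G x) \<le> B" and "finite S"
  shows "(\<Sum>n\<in>S. (norm (fourier_coeff G n))\<^sup>2) \<le> B\<^sup>2"
proof -
  define c where "c = fourier_coeff G"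
  define E where "E n x = cis (2 * pi * of_int n * x)" for n and x :: real
  have E: "E n \<in> borel_measurable borel" "norm (E n x) = 1" for n x
    unfolding E_def[abs_def] by simp_all
  have cE: "cnj (E n x) = cis (- (2 * pi * of_int n * x))" for n x
    by (simp add: E_def cis_cnj)
  define T where "T x = (\<Sum>n\<in>S. c n * E n x)" for x
  have T: "T \<in> borel_measurable borel" unfolding T_def using E by measurable
  have Tb: "norm (T x) \<le> (\<Sum>n\<in>S. norm (c n))" for x
    unfolding T_def by (rule order_trans[OF norm_sum]) (simp add: norm_mult E)
  have int: "integrable unit_lborel f" if "f \<in> borel_measurable borel" "\<And>x. x \<in> {0..<1} \<Longrightarrow> norm (f x) \<le> K"
    for f :: "real \<Rightarrow> complex" and K
    by (rule integrable_unit_lborel[OF that])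
  have cnjm: "(\<lambda>x. cnj (f x)) \<in> borel_measurable borel" if "f \<in> borel_measurable borel" for f :: "real \<Rightarrow> complex"
    using that by (intro borel_measurable_continuous_on[where f = cnj] continuous_intros)
  have B0: "B \<ge> 0" using order_trans[OF norm_ge_zero G(2)[of 0]] by simp
  have GE: "integrable unit_lborel (\<lambda>x. G x * cnj (E n x))" for n
    by (rule int[of _ B]) (use G E cnjm in \<open>auto simp: norm_mult\<close>)
  have EE: "integrable unit_lborel (\<lambda>x. E n x * cnj (E m x))" for n m
    by (rule int[of _ 1]) (use E cnjm in \<open>auto simp: norm_mult\<close>)
  have iGE: "(LINT x|unit_lborel. G x * cnj (E n x)) = c n" for n
    by (simp add: c_def fourier_coeff_def cE)
  have iEE: "(LINT x|unit_lborel. E n x * cnj (E m x)) = (if n = m then 1 else 0)" for n m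
  proof -
    have "E n x * cnj (E m x) = cis (2 * pi * of_int (n - m) * x)" for x
      unfolding cE unfolding E_def by (simp add: cis_mult algebra_simps)
    then show ?thesis by (simp only: integral_cis_unit) simp
  qed
  have GT: "(LINT x|unit_lborel. G x * cnj (T x)) = (\<Sum>n\<in>S. cnj (c n) * c n)"
  proof -
    have "(LINT x|unit_lborel. G x * cnj (T x)) = (LINT x|unit_lborel. (\<Sum>n\<in>S. cnj (c n) * (G x * cnj (E n x))))"
      by (simp add: T_def sum_distrib_left mult_ac)
    also have "\<dots> = (\<Sum>n\<in>S. cnj (c n) * c n)"
      using GE by (subst Bochner_Integration.integral_sum) (auto simp: iGE)
    finally show ?thesis .
  qed
  have TT: "(LINT x|unit_lborel. T x * cnj (T x)) = (\<Sum>n\<in>S. cnj (c n) * c n)"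
  proof -
    have "(LINT x|unit_lborel. T x * cnj (T x)) =
          (LINT x|unit_lborel. (\<Sum>n\<in>S. \<Sum>m\<in>S. (c n * cnj (c m)) * (E n x * cnj (E m x))))"
      by (simp add: T_def sum_product mult_ac)
    also have "\<dots> = (\<Sum>n\<in>S. \<Sum>m\<in>S. (c n * cnj (c m)) * (if n = m then 1 else 0))"
      using EE by (subst Bochner_Integration.integral_sum; (subst Bochner_Integration.integral_sum)?) (auto simp: iEE)
    also have "\<dots> = (\<Sum>n\<in>S. cnj (c n) * c n)"
      using \<open>finite S\<close> by (simp add: if_distrib cong: if_cong) (simp add: mult.commute)
    finally show ?thesis .
  qed
  let ?K = "\<Sum>n\<in>S. norm (c n)"
  have K0: "?K \<ge> 0" by (rule sum_nonneg) auto
  have iGG: "integrable unit_lborel (\<lambda>x. G x * cnj (G x))"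
    by (rule int[of _ "B * B"]) (use G cnjm B0 in \<open>auto simp: norm_mult intro!: mult_mono\<close>)
  have iGT: "integrable unit_lborel (\<lambda>x. G x * cnj (T x))"
    by (rule int[of _ "B * ?K"]) (use G T cnjm B0 Tb in \<open>auto simp: norm_mult intro!: mult_mono\<close>)
  have iTG: "integrable unit_lborel (\<lambda>x. T x * cnj (G x))"
    by (rule int[of _ "?K * B"]) (use G T cnjm B0 Tb K0 in \<open>auto simp: norm_mult intro!: mult_mono\<close>)
  have iTT: "integrable unit_lborel (\<lambda>x. T x * cnj (T x))"
    by (rule int[of _ "?K * ?K"]) (use T cnjm Tb K0 in \<open>auto simp: norm_mult intro!: mult_mono\<close>)
  have TG: "(LINT x|unit_lborel. T x * cnj (G x)) = (\<Sum>n\<in>S. cnj (c n) * c n)"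
  proof -
    have "(LINT x|unit_lborel. T x * cnj (G x)) = (LINT x|unit_lborel. cnj (G x * cnj (T x)))"
      by (simp add: mult.commute del: Bochner_Integration.integral_cnj)
    also have "\<dots> = cnj (LINT x|unit_lborel. G x * cnj (T x))" by (rule Bochner_Integration.integral_cnj)
    finally have "(LINT x|unit_lborel. T x * cnj (G x)) = cnj (LINT x|unit_lborel. G x * cnj (T x))" .
    then show ?thesis by (simp add: GT mult.commute)
  qed
  have "complex_of_real (LINT x|unit_lborel. (norm (G x - T x))\<^sup>2) = (LINT x|unit_lborel. complex_of_real ((norm (G x - T x))\<^sup>2))"
    by (rule integral_complex_of_real[symmetric])
  also have "\<dots> = (LINT x|unit_lborel. G x * cnj (G x) - G x * cnj (T x) - T x * cnj (G x) + T x * cnj (T x))"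
    by (simp add: complex_norm_square algebra_simps del: of_real_power)
  also have "\<dots> = (LINT x|unit_lborel. G x * cnj (G x)) - (\<Sum>n\<in>S. cnj (c n) * c n)"
    using iGG iGT iTG iTT by (simp add: GT TG TT)
  also have "(\<Sum>n\<in>S. cnj (c n) * c n) = complex_of_real (\<Sum>n\<in>S. (norm (c n))\<^sup>2)"
    by (simp add: complex_norm_square mult.commute del: of_real_power)
  finally have "Re (complex_of_real (LINT x|unit_lborel. (norm (G x - T x))\<^sup>2)) =
      Re ((LINT x|unit_lborel. G x * cnj (G x)) - complex_of_real (\<Sum>n\<in>S. (norm (c n))\<^sup>2))"
    by (rule arg_cong)
  then have "(LINT x|unit_lborel. (norm (G x - T x))\<^sup>2) =
      Re (LINT x|unit_lborel. G x * cnj (G x)) - (\<Sum>n\<in>S. (norm (c n))\<^sup>2)"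
    by (simp only: minus_complex.simps Re_complex_of_real)
  moreover have "(LINT x|unit_lborel. (norm (G x - T x))\<^sup>2) \<ge> 0" by simp
  moreover have "Re (LINT x|unit_lborel. G x * cnj (G x)) \<le> B\<^sup>2"
  proof -
    have "norm (LINT x|unit_lborel. G x * cnj (G x)) \<le> B * B"
      by (rule norm_integral_unit_lborel_le) (use G cnjm B0 in \<open>auto simp: norm_mult intro!: mult_mono\<close>)
    then show ?thesis using complex_Re_le_cmod order_trans by (simp add: power2_eq_square) blast
  qed
  ultimately show ?thesis by (simp add: c_def)
qed

text \<open>A form of the Riemann-Lebesgue lemma: Bessel's inequality bounds the partial sums of
  squares along any injective choice of frequencies, so their terms tend to 0. It is applied towards
  both ends of the integers.\<close>

lemma fourier_coeff_tendsto_0: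
  assumes G: "G \<in> borel_measurable borel" "\<And>x. x \<in> {0..<1} \<Longrightarrow> norm (G x) \<le> B" and h: "inj h"
  shows "(\<lambda>k::nat. fourier_coeff G (h k)) \<longlonglongrightarrow> 0"
proof -
  have "(\<Sum>k<n. (norm (fourier_coeff G (h k)))\<^sup>2) \<le> B\<^sup>2" for n
  proof -
    have "(\<Sum>k<n. (norm (fourier_coeff G (h k)))\<^sup>2) = (\<Sum>m\<in>h ` {..<n}. (norm (fourier_coeff G m))\<^sup>2)"
      using h by (subst sum.reindex) (auto intro: inj_on_subset)
    also have "\<dots> \<le> B\<^sup>2" by (rule bessel_inequality[OF G]) auto
    finally show ?thesis .
  qed
  then have "summable (\<lambda>k. (norm (fourier_coeff G (h k)))\<^sup>2)"
    by (intro summableI_nonneg_bounded) auto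
  then have "(\<lambda>k. (norm (fourier_coeff G (h k)))\<^sup>2) \<longlonglongrightarrow> 0"
    by (rule summable_LIMSEQ_zero)
  then have "(\<lambda>k. norm (fourier_coeff G (h k))) \<longlonglongrightarrow> 0"
    by (simp add: power_tendsto_0_iff)
  then show ?thesis by (simp add: tendsto_norm_zero_iff)
qed

text \<open>The chord has length \<open>2 * \<bar>sin (pi * x)\<bar>\<close> and is compared with
  the distance from \<open>x\<close> to the nearest integer. The bound controls a quotient in the
  Poisson formula and later separates phases on the unit circle.\<close>

lemma norm_cis_minus_1_ge:
  assumes "0 \<le> x" "x \<le> 1"
  shows "norm (cis (2 * pi * x) - 1) \<ge> min x (1 - x)"
proof -
  have sin: "sin (pi * y) \<ge> y" if "0 \<le> y" "y \<le> 1 / 2" for y :: real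
  proof -
    define z where "z = pi * y"
    have z: "0 \<le> z" using that by (simp add: z_def)
    \<comment> \<open>The number 3.2 is a convenient upper bound for pi: with
      \<open>z \<le> 1.6\<close> the cubic error in the sine is at most
      \<open>z / 2\<close>.\<close>
    have "pi * y \<le> 3.2 * (1 / 2)" using that pi_less_4 pi_approx by (intro mult_mono) auto
    then have "z\<^sup>2 \<le> 1.6\<^sup>2" using z by (intro power_mono) (auto simp: z_def)
    then have z2: "z\<^sup>2 \<le> 3" by (simp add: power2_eq_square)
    have "\<bar>sin z - (\<Sum>m<3. sin_coeff m * z ^ m)\<bar> \<le> inverse (fact 3) * \<bar>z\<bar> ^ 3"
      by (rule Maclaurin_sin_bound)
    then have "\<bar>sin z - z\<bar> \<le> z * z\<^sup>2 / 6"
      using z by (simp add: sin_coeff_def numeral_3_eq_3 fact_numeral power2_eq_square)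
    moreover have "z * z\<^sup>2 \<le> z * 3" using z z2 by (intro mult_left_mono) auto
    ultimately have "sin z \<ge> z / 2" by linarith
    moreover have "2 * y \<le> pi * y" using pi_ge_two that by (intro mult_right_mono) auto
    ultimately show ?thesis by (simp add: z_def)
  qed
  have "norm (cis (2 * pi * x) - 1) = 2 * \<bar>sin (pi * x)\<bar>"
    using dist_exp_i_1[of "2 * pi * x"] by (simp add: cis_conv_exp)
  moreover have "\<bar>sin (pi * x)\<bar> \<ge> min x (1 - x)"
  proof (cases "x \<le> 1 / 2")
    case True
    then show ?thesis using sin[of x] assms by linarith
  next
    case False
    have "sin (pi * (1 - x)) = sin (pi * x)" by (simp add: right_diff_distrib sin_diff)
    then show ?thesis using sin[of "1 - x"] assms False by linarith
  qed
  ultimately show ?thesis using assms by linarith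
qed

section \<open>Poisson summation for compactly supported Lipschitz functions\<close>

lemma lipschitz_continuous:
  fixes g :: "real \<Rightarrow> complex"
  assumes "\<And>x y. norm (g x - g y) \<le> \<Lambda> * \<bar>x - y\<bar>"
  shows "continuous_on A g"
proof -
  have "\<Lambda> \<ge> 0" using order_trans[OF norm_ge_zero assms[of 0 1]] by simp
  then have "\<Lambda>-lipschitz_on A g" using assms by (auto simp: lipschitz_on_def dist_norm)
  then show ?thesis by (rule lipschitz_on_continuous_on)
qed

text \<open>The line is cut into integer translates of [0, 1), and the exponential has period 1.
  Each \<open>x\<close> in the support belongs to the translate by its floor, which lies in
  \<open>{-M..M}\<close>.\<close>

lemma integral_periodize:
  fixes g :: "real \<Rightarrow> complex"
  assumes g: "continuous_on UNIV g" and supp: "\<And>x. \<bar>x\<bar> > of_int M \<Longrightarrow> g x = 0"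
  shows "(LINT x|lborel. g x * cis (- (2 * pi * of_int n * x))) =
         fourier_coeff (\<lambda>x. \<Sum>m\<in>{-M..M}. g (x + of_int m)) n"
proof -
  define e where "e x = cis (- (2 * pi * of_int n * x))" for x :: real
  have gm [measurable]: "g \<in> borel_measurable borel" by (rule borel_measurable_continuous_onI[OF g])
  have em [measurable]: "e \<in> borel_measurable borel" unfolding e_def by measurable
  have per: "e (x + of_int m) = e x" for x m
  proof -
    have "e (x + of_int m) = e x * cis (2 * pi * of_int (- (n * m)))"
      by (simp add: e_def cis_mult algebra_simps)
    also have "cis (2 * pi * of_int (- (n * m))) = 1" by (rule cis_multiple_2pi) auto
    finally show ?thesis by simp
  qed
  obtain B where B: "\<And>x. norm (g x) \<le> B"
  proof -
    have "compact (g ` {- of_int M..of_int M})"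
      by (intro compact_continuous_image continuous_on_subset[OF g]) auto
    then have "bounded (insert 0 (g ` {- of_int M..of_int M}))" by (simp add: compact_imp_bounded)
    then obtain B where B: "\<And>y. y \<in> insert 0 (g ` {- of_int M..of_int M}) \<Longrightarrow> norm y \<le> B"
      unfolding bounded_iff by blast
    have "norm (g x) \<le> B" for x
    proof (cases "\<bar>x\<bar> > of_int M")
      case True
      then show ?thesis using B[of 0] supp by simp
    next
      case False
      then have "x \<in> {- of_int M..of_int M}" by auto
      then show ?thesis using B by blast
    qed
    then show thesis by (rule that)
  qed
  have int: "integrable unit_lborel (\<lambda>x. g (x + of_int m) * e x)" for m
    by (rule integrable_unit_lborel[where B = B]) (auto simp: norm_mult e_def B)
  then have int': "integrable lborel (\<lambda>x. indicator {0..<1} x *\<^sub>R (g (x + of_int m) * e x))" for m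
    by (subst (asm) integrable_restrict_space) auto
  have int'': "integrable lborel (\<lambda>x. indicator {0..<1} (x - of_int m) *\<^sub>R (g x * e x))" for m
  proof -
    have "integrable lborel (\<lambda>x. indicator {0..<1} (- of_int m + 1 * x) *\<^sub>R (g ((- of_int m + 1 * x) + of_int m) * e (- of_int m + 1 * x)))"
      by (intro lborel_integrable_real_affine[where f = "\<lambda>x. indicator {0..<1} x *\<^sub>R (g (x + of_int m) * e x)"] int') simp
    then show ?thesis using per[of _ "-m"] by (simp add: add.commute)
  qed
  have floor: "g x = (\<Sum>m\<in>{-M..M}. indicator {0..<1} (x - of_int m) *\<^sub>R g x)" for x
  proof (cases "g x = 0")
    case False
    then have "\<bar>x\<bar> \<le> of_int M" using supp not_le by blast
    then have fl: "\<lfloor>x\<rfloor> \<in> {-M..M}" by (simp add: floor_le_iff le_floor_iff) linarith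
    have "(\<Sum>m\<in>{-M..M}. indicator {0..<1} (x - of_int m) *\<^sub>R g x) = (\<Sum>m\<in>{-M..M}. if m = \<lfloor>x\<rfloor> then g x else 0)"
    proof (rule sum.cong[OF refl])
      fix m
      have "x - of_int m \<in> {0..<1} \<longleftrightarrow> m = \<lfloor>x\<rfloor>" by (auto simp: floor_eq_iff intro: floor_unique[symmetric]) linarith+
      then show "indicator {0..<1} (x - of_int m) *\<^sub>R g x = (if m = \<lfloor>x\<rfloor> then g x else 0)" by (simp add: indicator_def)
    qed
    then show ?thesis using fl by simp
  qed simp
  have "(LINT x|lborel. g x * e x) = (LINT x|lborel. (\<Sum>m\<in>{-M..M}. indicator {0..<1} (x - of_int m) *\<^sub>R g x) * e x)"
    by (simp only: floor[symmetric])
  also have "\<dots> = (LINT x|lborel. (\<Sum>m\<in>{-M..M}. indicator {0..<1} (x - of_int m) *\<^sub>R (g x * e x)))"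
    by (simp only: sum_distrib_right mult_scaleR_left)
  also have "\<dots> = (\<Sum>m\<in>{-M..M}. (LINT x|lborel. indicator {0..<1} (x - of_int m) *\<^sub>R (g x * e x)))"
    using int'' by (intro Bochner_Integration.integral_sum) auto
  also have "\<dots> = (\<Sum>m\<in>{-M..M}. (LINT x|unit_lborel. g (x + of_int m) * e x))"
  proof (rule sum.cong[OF refl])
    fix m
    have "(LINT x|lborel. indicator {0..<1} (x - of_int m) *\<^sub>R (g x * e x)) =
        (LINT x|lborel. indicator {0..<1} x *\<^sub>R (g (x + of_int m) * e x))"
      using per by (subst lborel_integral_real_affine[where c = 1 and t = "of_int m"]) (auto simp: add.commute)
    also have "\<dots> = (LINT x|unit_lborel. g (x + of_int m) * e x)"
      by (subst integral_restrict_space) auto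
    finally show "(LINT x|lborel. indicator {0..<1} (x - of_int m) *\<^sub>R (g x * e x)) = (LINT x|unit_lborel. g (x + of_int m) * e x)" .
  qed
  also have "\<dots> = (LINT x|unit_lborel. (\<Sum>m\<in>{-M..M}. g (x + of_int m)) * e x)"
    using int by (simp add: sum_distrib_right Bochner_Integration.integral_sum)
  finally show ?thesis by (simp add: e_def fourier_coeff_def)
qed

text \<open>
  Writing the periodization as \<open>F = F 0 + (cis (2 * pi * x) - 1) G\<close> with a bounded \<open>G\<close> makes
  the Fourier series at 0 telescope, and the coefficients of \<open>G\<close> tend to 0 by Bessel's inequality.
\<close>

lemma poisson_summation_lipschitz:
  fixes g :: "real \<Rightarrow> complex"
  assumes lip: "\<And>x y. norm (g x - g y) \<le> \<Lambda> * \<bar>x - y\<bar>"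
    and supp: "\<And>x. \<bar>x\<bar> \<ge> of_int M \<Longrightarrow> g x = 0" and "M \<ge> 0"
  shows "(\<lambda>N. \<Sum>n\<in>{-int N..int N}. (LINT x|lborel. g x * cis (- (2 * pi * of_int n * x))))
           \<longlonglongrightarrow> (\<Sum>m\<in>{-M..M}. g (of_int m))"
proof -
  have cont: "continuous_on A g" for A by (rule lipschitz_continuous[OF lip])
  have \<Lambda>: "\<Lambda> \<ge> 0" using order_trans[OF norm_ge_zero lip[of 0 1]] by simp
  define F where "F x = (\<Sum>m\<in>{-M..M}. g (x + of_int m))" for x
  define G where "G x = (F x - F 0) / (cis (2 * pi * x) - 1)" for x
  define B where "B = of_int (2 * M + 1) * \<Lambda>"
  have B0: "B \<ge> 0" using \<Lambda> \<open>M \<ge> 0\<close> by (simp add: B_def)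
  have F_lip: "norm (F x - F y) \<le> B * \<bar>x - y\<bar>" for x y
  proof -
    have "norm (F x - F y) \<le> (\<Sum>m\<in>{-M..M}. norm (g (x + of_int m) - g (y + of_int m)))"
      unfolding F_def by (simp only: sum_subtractf[symmetric] norm_sum)
    also have "\<dots> \<le> (\<Sum>m\<in>{-M..M}. \<Lambda> * \<bar>x - y\<bar>)"
      using lip[of "x + of_int m" "y + of_int m" for m] by (intro sum_mono) auto
    also have "\<dots> = B * \<bar>x - y\<bar>" using \<open>M \<ge> 0\<close> by (simp add: B_def)
    finally show ?thesis .
  qed
  have F_cont: "continuous_on A F" for A by (rule lipschitz_continuous[OF F_lip])
  have g0: "g (of_int (M + 1)) = 0" using \<open>M \<ge> 0\<close> by (intro supp) auto
  have gM: "g (of_int (- M)) = 0" using \<open>M \<ge> 0\<close> by (intro supp) auto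
  \<comment> \<open>The sum over a fixed window of translates is not periodic in general. Only its
    values on [0, 1] matter, and going from 0 to 1 exchanges \<open>g (-M)\<close> for
    \<open>g (M + 1)\<close>; both are 0 because the support hypothesis includes the
    endpoints.\<close>
  have F1: "F 1 = F 0"
  proof -
    have "F 1 = (\<Sum>m\<in>{-M..M}. g (of_int (m + 1)))" by (simp add: F_def add.commute)
    also have "\<dots> = (\<Sum>m\<in>{-M+1..M+1}. g (of_int m))"
      by (rule sum.reindex_bij_witness[of _ "\<lambda>m. m - 1" "\<lambda>m. m + 1"]) auto
    also have "\<dots> = (\<Sum>m\<in>{-M+1..M}. g (of_int m))"
    proof -
      have "{-M+1..M+1} = insert (M + 1) {-M+1..M}" using \<open>M \<ge> 0\<close> by auto
      then show ?thesis using g0 by simp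
    qed
    also have "\<dots> = (\<Sum>m\<in>{-M..M}. g (of_int m))"
    proof -
      have "{-M..M} = insert (- M) {-M+1..M}" using \<open>M \<ge> 0\<close> by auto
      then show ?thesis using gM by simp
    qed
    finally show ?thesis by (simp add: F_def)
  qed
  have Gb: "norm (G x) \<le> B" if "x \<in> {0..<1}" for x
  proof (cases "x = 0")
    case False
    then have m: "min x (1 - x) > 0" using that by auto
    \<comment> \<open>The Lipschitz bounds measured from 0 and from 1, together with
      \<open>F 1 = F 0\<close>, make the numerator of \<open>G\<close> vanish linearly at both zeros
      of the denominator.\<close>
    have "norm (F x - F 0) \<le> B * min x (1 - x)"
      using F_lip[of x 0] F_lip[of x 1] F1 that by (auto simp: min_def abs_if)
    also have "\<dots> \<le> B * norm (cis (2 * pi * x) - 1)"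
      using that B0 by (intro mult_left_mono norm_cis_minus_1_ge) auto
    finally have "norm (F x - F 0) \<le> B * norm (cis (2 * pi * x) - 1)" .
    moreover have "norm (cis (2 * pi * x) - 1) > 0"
      using norm_cis_minus_1_ge[of x] that m by auto
    ultimately show ?thesis by (simp add: G_def norm_divide field_simps)
  qed (use B0 in \<open>simp add: G_def\<close>)
  have Gm: "G \<in> borel_measurable borel"
  proof -
    have [measurable]: "F \<in> borel_measurable borel" by (rule borel_measurable_continuous_onI[OF F_cont])
    show ?thesis unfolding G_def by measurable
  qed
  have GE: "fourier_coeff F n = fourier_coeff G (n - 1) - fourier_coeff G n + (if n = 0 then F 0 else 0)" for n
  proof -
    have "F x * cis (- (2 * pi * of_int n * x)) = G x * cis (- (2 * pi * of_int (n - 1) * x))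
        - G x * cis (- (2 * pi * of_int n * x)) + F 0 * cis (2 * pi * of_int (- n) * x)" if "x \<in> {0..<1}" for x
    proof -
      have "F x - F 0 = G x * (cis (2 * pi * x) - 1)"
      proof (cases "x = 0")
        case False
        then have "norm (cis (2 * pi * x) - 1) > 0"
          using norm_cis_minus_1_ge[of x] that by auto
        then show ?thesis by (auto simp: G_def)
      qed simp
      then have "F x = G x * (cis (2 * pi * x) - 1) + F 0" by (simp add: algebra_simps)
      moreover have "cis (- (2 * pi * of_int (n - 1) * x)) = cis (2 * pi * x) * cis (- (2 * pi * of_int n * x))"
        by (simp add: cis_mult algebra_simps)
      moreover have "cis (2 * pi * of_int (- n) * x) = cis (- (2 * pi * of_int n * x))" by simp
      moreover have "(a * (b - 1) + c) * d = a * (b * d) - a * d + c * d" for a b c d :: complex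
        by (simp add: algebra_simps)
      ultimately show ?thesis by (simp only:)
    qed
    then have "fourier_coeff F n = (LINT x|unit_lborel. G x * cis (- (2 * pi * of_int (n - 1) * x))
        - G x * cis (- (2 * pi * of_int n * x)) + F 0 * cis (2 * pi * of_int (- n) * x))"
      unfolding fourier_coeff_def by (intro Bochner_Integration.integral_cong) (auto simp: space_restrict_space)
    also have "\<dots> = (LINT x|unit_lborel. G x * cis (- (2 * pi * of_int (n - 1) * x)))
        - (LINT x|unit_lborel. G x * cis (- (2 * pi * of_int n * x))) + (LINT x|unit_lborel. F 0 * cis (2 * pi * of_int (- n) * x))"
    proof -
      have "integrable unit_lborel (\<lambda>x. G x * cis (- (2 * pi * of_int k * x)))" for k
        using Gb Gm by (intro integrable_unit_lborel[where B = B]) (auto simp: norm_mult)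
      moreover have "integrable unit_lborel (\<lambda>x. F 0 * cis (2 * pi * of_int (- n) * x))"
        by (intro integrable_unit_lborel[where B = "norm (F 0)"]) (auto simp: norm_mult simp del: of_int_minus)
      ultimately show ?thesis
        by (simp only: Bochner_Integration.integral_diff Bochner_Integration.integral_add Bochner_Integration.integrable_diff)
    qed
    also have "(LINT x|unit_lborel. F 0 * cis (2 * pi * of_int (- n) * x)) = (if n = 0 then F 0 else 0)"
      by (simp only: integral_mult_right_zero integral_cis_unit) simp
    finally show ?thesis by (simp only: fourier_coeff_def)
  qed
  have "(\<Sum>n\<in>{-int N..int N}. fourier_coeff F n) = fourier_coeff G (- int (Suc N)) - fourier_coeff G (int N) + F 0" for N
  proof (induction N)
    case 0
    then show ?case by (simp add: GE)
  next
    case (Suc N)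
    have "{-int (Suc N)..int (Suc N)} = insert (- int (Suc N)) (insert (int (Suc N)) {-int N..int N})" by auto
    then have "(\<Sum>n\<in>{-int (Suc N)..int (Suc N)}. fourier_coeff F n) = fourier_coeff F (- int (Suc N)) + fourier_coeff F (int (Suc N))
        + (\<Sum>n\<in>{-int N..int N}. fourier_coeff F n)" by (simp add: add.assoc)
    then show ?case unfolding Suc by (simp add: GE algebra_simps)
  qed
  moreover have "(\<lambda>N. fourier_coeff G (- int (Suc N)) - fourier_coeff G (int N) + F 0) \<longlonglongrightarrow> 0 - 0 + F 0"
    by (intro tendsto_intros fourier_coeff_tendsto_0[OF Gm Gb]) (auto simp: inj_def)
  ultimately have "(\<lambda>N. \<Sum>n\<in>{-int N..int N}. fourier_coeff F n) \<longlonglongrightarrow> F 0" by simp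
  moreover have "(LINT x|lborel. g x * cis (- (2 * pi * of_int n * x))) = fourier_coeff F n" for n
    unfolding F_def by (rule integral_periodize[OF cont supp]) simp
  ultimately show ?thesis by (simp add: F_def)
qed

section \<open>Poisson summation\<close>

lemma fourier_cis: "fourier \<phi> y = (LINT x|lborel. \<phi> x * cis (- (2 * pi * y * x)))"
  unfolding fourier_def by (simp add: cis_conv_exp mult_ac)

section \<open>Decay of the Fourier transform of a test function\<close>

lemma integrable_bounded_support:
  fixes \<psi> :: "real \<Rightarrow> complex"
  assumes cont: "continuous_on UNIV \<psi>" and supp: "\<And>x. \<bar>x\<bar> > M \<Longrightarrow> \<psi> x = 0"
  shows "integrable lborel \<psi>"
proof -
  have "integrable lborel (\<lambda>x. indicator {-M..M} x *\<^sub>R \<psi> x)"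
    by (intro borel_integrable_compact continuous_on_subset[OF cont]) auto
  moreover have "indicator {-M..M} x *\<^sub>R \<psi> x = \<psi> x" for x
    using supp[of x] by (auto simp: indicator_def)
  ultimately show ?thesis by simp
qed

lemma norm_fourier_le: "norm (fourier \<phi> y) \<le> (LINT x|lborel. norm (\<phi> x))"
  unfolding fourier_cis using integral_norm_bound[of lborel "\<lambda>x. \<phi> x * cis (- (2 * pi * y * x))"]
  by (simp add: norm_mult)

lemma fourier_vderivs_Suc:
  assumes \<phi>: "\<phi> \<in> test_functions"
  shows "fourier (vderivs (Suc n) \<phi>) y = 2 * pi * \<i> * y * fourier (vderivs n \<phi>) y"
proof -
  obtain M where M: "\<And>x. \<bar>x\<bar> > M \<Longrightarrow> \<phi> x = 0" "M \<ge> 0" using test_functions_bound[OF \<phi>] by blast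
  have sm: "smooth \<phi>" by (rule test_functions_smooth[OF \<phi>])
  have M': "vderivs k \<phi> x = 0" if "\<bar>x\<bar> > M" for k x by (rule vderivs_eq_0[OF sm M(1) that])
  define e where "e x = cis (- (2 * pi * y) * x)" for x
  define c where "c = \<i> * of_real (- (2 * pi * y))"
  have e: "(e has_vector_derivative c * e x) (at x within A)" for x A
    unfolding e_def c_def by (rule has_vector_derivative_cis)
  have econt: "continuous_on A e" for A unfolding e_def by (intro continuous_intros)
  have vcont: "continuous_on A (vderivs k \<phi>)" for A k by (rule smooth_continuous[OF sm])
  let ?f = "\<lambda>x. vderivs n \<phi> x * (c * e x) + vderivs (Suc n) \<phi> x * e x"
  \<comment> \<open>\<open>M'\<close> speaks of points strictly beyond \<open>M\<close>; at radius
    \<open>M + 1\<close> the boundary terms of the integration by parts therefore vanish.\<close>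
  let ?a = "M + 1"
  have int: "integrable lborel (\<lambda>x. vderivs k \<phi> x * e x)" for k
    using M' by (intro integrable_bounded_support[where M = M] continuous_intros vcont econt) simp
  have "(LINT x|lborel. indicator {- ?a..?a} x *\<^sub>R ?f x) = vderivs n \<phi> ?a * e ?a - vderivs n \<phi> (- ?a) * e (- ?a)"
  proof (rule integral_FTC_Icc)
    fix x
    show "((\<lambda>x. vderivs n \<phi> x * e x) has_vector_derivative ?f x) (at x within {- ?a..?a})"
      by (intro has_vector_derivative_mult e has_vector_derivative_at_within[OF smooth_has_vector_derivative[OF sm]])
    show "continuous_on {- ?a..?a} ?f" by (intro continuous_intros vcont econt)
  qed (use M(2) in auto)
  moreover have "indicator {- ?a..?a} x *\<^sub>R ?f x = ?f x" for x
    using M'[of x] by (auto simp: indicator_def simp del: vderivs.simps)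
  ultimately have "(LINT x|lborel. ?f x) = 0" using M(2) by (simp add: M' del: vderivs.simps)
  moreover have "(LINT x|lborel. ?f x) = (LINT x|lborel. c * (vderivs n \<phi> x * e x)) + (LINT x|lborel. vderivs (Suc n) \<phi> x * e x)"
  proof -
    have "integrable lborel (\<lambda>x. c * (vderivs n \<phi> x * e x))" by (intro integrable_mult_right int)
    from Bochner_Integration.integral_add[OF this int[of "Suc n"]] show ?thesis
      by (simp only: mult.left_commute)
  qed
  ultimately have "(LINT x|lborel. c * (vderivs n \<phi> x * e x)) + (LINT x|lborel. vderivs (Suc n) \<phi> x * e x) = 0"
    by (simp only:)
  then have "(LINT x|lborel. vderivs (Suc n) \<phi> x * e x) = - (LINT x|lborel. c * (vderivs n \<phi> x * e x))"
    by (simp only: add_eq_0_iff)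
  also have "\<dots> = - c * (LINT x|lborel. vderivs n \<phi> x * e x)" by simp
  finally show ?thesis by (simp add: fourier_cis e_def c_def mult_ac del: vderivs.simps)
qed

text \<open>Two derivatives multiply the transform by a factor of order \<open>y\<^sup>2\<close> and
  leave it bounded. Quadratic decay is enough for absolute summability along an arithmetic
  progression.\<close>

lemma fourier_decay:
  assumes \<phi>: "\<phi> \<in> test_functions"
  obtains D where "D \<ge> 0" "\<And>y. norm (fourier \<phi> y) * (1 + y\<^sup>2) \<le> D"
proof -
  define I where "I k = (LINT x|lborel. norm (vderivs k \<phi> x))" for k
  have I0: "I k \<ge> 0" for k by (simp add: I_def)
  show thesis
  proof (rule that)
    show "I 0 + I 2 \<ge> 0" using I0 by (simp add: add_nonneg_nonneg)
    fix y :: real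
    have "norm (fourier (vderivs 2 \<phi>) y) \<le> I 2" unfolding I_def by (rule norm_fourier_le)
    moreover have "norm (fourier (vderivs 2 \<phi>) y) = (2 * pi * \<bar>y\<bar>)\<^sup>2 * norm (fourier \<phi> y)"
      using fourier_vderivs_Suc[OF \<phi>, of 1 y] fourier_vderivs_Suc[OF \<phi>, of 0 y]
      by (simp add: numeral_2_eq_2 norm_mult power2_eq_square)
    moreover have "y\<^sup>2 * norm (fourier \<phi> y) \<le> (2 * pi * \<bar>y\<bar>)\<^sup>2 * norm (fourier \<phi> y)"
    proof (rule mult_right_mono)
      have "1 * \<bar>y\<bar> \<le> (2 * pi) * \<bar>y\<bar>" using pi_ge_two by (intro mult_right_mono) auto
      then show "y\<^sup>2 \<le> (2 * pi * \<bar>y\<bar>)\<^sup>2" by (intro power2_le_iff_abs_le[THEN iffD2]) (auto simp: abs_mult)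
    qed simp
    moreover have "norm (fourier \<phi> y) \<le> I 0" using norm_fourier_le[of \<phi> y] by (simp add: I_def)
    ultimately show "norm (fourier \<phi> y) * (1 + y\<^sup>2) \<le> I 0 + I 2"
      by (simp add: distrib_left mult.commute)
  qed
qed

lemma fourier_shift: "fourier (\<lambda>x. \<phi> (x + b)) y = cis (2 * pi * b * y) * fourier \<phi> y"
proof -
  have "fourier (\<lambda>x. \<phi> (x + b)) y = (LINT x|lborel. \<phi> x * cis (- (2 * pi * y * (x - b))))"
    unfolding fourier_cis by (subst lborel_integral_real_affine[where c = 1 and t = "-b"]) (auto simp: algebra_simps)
  also have "\<dots> = (LINT x|lborel. cis (2 * pi * b * y) * (\<phi> x * cis (- (2 * pi * y * x))))"
    by (rule Bochner_Integration.integral_cong) (auto simp: cis_mult algebra_simps)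
  finally show ?thesis by (simp add: fourier_cis)
qed

lemma test_function_lipschitz:
  assumes \<phi>: "\<phi> \<in> test_functions"
  obtains \<Lambda> where "\<And>x y. norm (\<phi> x - \<phi> y) \<le> \<Lambda> * \<bar>x - y\<bar>"
proof -
  have sm: "smooth \<phi>" by (rule test_functions_smooth[OF \<phi>])
  have "\<phi> \<in> schwartz" using \<phi> test_functions_subset_schwartz by blast
  then have "bounded (range (\<lambda>x. x ^ 0 *\<^sub>R vderivs 1 \<phi> x))" unfolding schwartz_def by blast
  then obtain \<Lambda> where \<Lambda>: "\<And>x. norm (vderivs 1 \<phi> x) \<le> \<Lambda>" by (auto simp: bounded_iff)
  have "norm (\<phi> x - \<phi> y) \<le> \<Lambda> * norm (x - y)" for x y
  proof (rule differentiable_bound[of UNIV \<phi> "\<lambda>x h. h *\<^sub>R vderivs 1 \<phi> x"])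
    fix x
    show "(\<phi> has_derivative (\<lambda>h. h *\<^sub>R vderivs 1 \<phi> x)) (at x within UNIV)"
      using smooth_has_vector_derivative[OF sm, of 0 x] by (simp add: has_vector_derivative_def)
    show "onorm (\<lambda>h. h *\<^sub>R vderivs 1 \<phi> x) \<le> \<Lambda>"
    proof (rule onorm_le)
      fix h :: real
      show "norm (h *\<^sub>R vderivs 1 \<phi> x) \<le> \<Lambda> * norm h"
        using mult_left_mono[OF \<Lambda>[of x] abs_ge_zero[of h]] by (simp add: mult.commute)
    qed
  qed auto
  then show thesis by (intro that[of \<Lambda>]) simp
qed

lemma norm_cis_diff_le: "norm (cis a - cis b) \<le> \<bar>a - b\<bar>"
proof -
  have "cis a - cis b = cis b * (cis (a - b) - 1)" by (simp add: algebra_simps cis_mult)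
  then have "norm (cis a - cis b) = norm (cis (a - b) - 1)" by (simp add: norm_mult)
  also have "\<dots> = 2 * \<bar>sin ((a - b) / 2)\<bar>"
    using dist_exp_i_1[of "a - b"] by (simp add: cis_conv_exp)
  also have "\<dots> \<le> \<bar>a - b\<bar>" using abs_sin_x_le_abs_x[of "(a - b) / 2"] by simp
  finally show ?thesis .
qed

lemma summable_inverse_squares_int: "(\<lambda>n::int. 1 / (1 + \<bar>of_int n\<bar>)\<^sup>2 :: real) summable_on UNIV"
proof -
  have "summable (\<lambda>n. 1 / (1 + real n)\<^sup>2)"
    using inverse_power_summable[of 2, where 'a = real] summable_Suc_iff[of "\<lambda>n. inverse (real n ^ 2)"]
    by (simp add: divide_inverse add.commute)
  then have "(\<lambda>n. 1 / (1 + real n)\<^sup>2) summable_on UNIV"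
    by (intro norm_summable_imp_summable_on) simp
  then have "(\<lambda>n::int. 1 / (1 + \<bar>of_int n\<bar>)\<^sup>2 :: real) summable_on range int"
            "(\<lambda>n::int. 1 / (1 + \<bar>of_int n\<bar>)\<^sup>2 :: real) summable_on range (\<lambda>n. - int n)"
    by (subst summable_on_reindex; simp add: inj_def o_def)+
  then have "(\<lambda>n::int. 1 / (1 + \<bar>of_int n\<bar>)\<^sup>2 :: real) summable_on (range int \<union> range (\<lambda>n. - int n))"
    by (rule summable_on_union)
  moreover have "range int \<union> range (\<lambda>n. - int n) = UNIV"
  proof -
    have "n \<in> range int \<union> range (\<lambda>n. - int n)" for n
      by (cases n rule: int_cases2) auto
    then show ?thesis by blast
  qed
  ultimately show ?thesis by simp
qed

lemma summable_on_int_if_quadratic_decay: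
  fixes f :: "int \<Rightarrow> complex"
  assumes "\<And>n. norm (f n) \<le> C / (1 + \<bar>of_int n\<bar>)\<^sup>2"
  shows "(\<lambda>n. norm (f n)) summable_on UNIV"
proof (rule summable_on_comparison_test)
  show "(\<lambda>n::int. C * (1 / (1 + \<bar>of_int n\<bar>)\<^sup>2)) summable_on UNIV"
    by (intro summable_on_cmult_right summable_inverse_squares_int)
qed (use assms in auto)

lemma fourier_abs_summable:
  assumes \<phi>: "\<phi> \<in> test_functions" and L: "L > 0"
  shows "(\<lambda>n::int. norm (fourier \<phi> (L * of_int n + s))) summable_on UNIV"
proof -
  obtain D where D: "D \<ge> 0" "\<And>y. norm (fourier \<phi> y) * (1 + y\<^sup>2) \<le> D"
    using fourier_decay[OF \<phi>] by blast
  define K where "K = 1 + (1 + \<bar>s\<bar>) / L"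
  have K: "K \<ge> 1" using L by (simp add: K_def)
  have "norm (fourier \<phi> (L * of_int n + s)) \<le> (D * (2 * (K + 1 / L)\<^sup>2)) / (1 + \<bar>of_int n\<bar>)\<^sup>2" for n
  proof -
    define y where "y = L * of_int n + s"
    have "of_int n = (y - s) / L" using L by (simp add: y_def)
    then have "\<bar>of_int n :: real\<bar> = \<bar>y - s\<bar> / L" using L by simp
    also have "\<dots> \<le> (\<bar>y\<bar> + \<bar>s\<bar>) / L" using L by (intro divide_right_mono) auto
    also have "\<dots> = \<bar>y\<bar> * (1 / L) + \<bar>s\<bar> / L" by (simp add: add_divide_distrib)
    moreover have "K = 1 + 1 / L + \<bar>s\<bar> / L" "1 / L \<ge> 0" using L by (simp_all add: K_def add_divide_distrib)
    ultimately have "1 + \<bar>of_int n :: real\<bar> \<le> K + \<bar>y\<bar> * (1 / L)" by linarith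
    also have "\<dots> \<le> (K + 1 / L) * (1 + \<bar>y\<bar>)" using K L by (simp add: algebra_simps)
    finally have "(1 + \<bar>of_int n :: real\<bar>)\<^sup>2 \<le> ((K + 1 / L) * (1 + \<bar>y\<bar>))\<^sup>2" by (intro power_mono) auto
    also have "\<dots> = (K + 1 / L)\<^sup>2 * (1 + \<bar>y\<bar>)\<^sup>2" by (simp add: power_mult_distrib)
    also have "(1 + \<bar>y\<bar>)\<^sup>2 \<le> 2 * (1 + y\<^sup>2)"
      using sum_squares_bound[of 1 "\<bar>y\<bar>"] by (simp add: power2_eq_square algebra_simps)
    finally have *: "(1 + \<bar>of_int n :: real\<bar>)\<^sup>2 \<le> (K + 1 / L)\<^sup>2 * (2 * (1 + y\<^sup>2))" by (simp add: mult_left_mono)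
    have "norm (fourier \<phi> y) * (1 + \<bar>of_int n :: real\<bar>)\<^sup>2 \<le> norm (fourier \<phi> y) * ((K + 1 / L)\<^sup>2 * (2 * (1 + y\<^sup>2)))"
      using * by (rule mult_left_mono) simp
    also have "\<dots> = (norm (fourier \<phi> y) * (1 + y\<^sup>2)) * (2 * (K + 1 / L)\<^sup>2)" by (simp only: mult_ac)
    also have "\<dots> \<le> D * (2 * (K + 1 / L)\<^sup>2)" using D(2) by (rule mult_right_mono) simp
    finally show ?thesis unfolding y_def by (subst pos_le_divide_eq) (auto intro: zero_less_power)
  qed
  then show ?thesis by (rule summable_on_int_if_quadratic_decay)
qed

lemma filterlim_symmetric_interval_finite_subsets:
  "filterlim (\<lambda>N. {- int N..int N}) (finite_subsets_at_top UNIV) sequentially"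
  unfolding filterlim_finite_subsets_at_top
proof (intro allI impI)
  fix X :: "int set" assume "finite X \<and> X \<subseteq> UNIV"
  then have "finite X" by simp
  then obtain b where b: "\<And>x. x \<in> X \<Longrightarrow> \<bar>x\<bar> \<le> b"
    using finite_imp_bounded[of "abs ` X"] by (metis Max_ge finite_imageI image_eqI)
  show "\<forall>\<^sub>F N in sequentially. finite {- int N..int N} \<and> X \<subseteq> {- int N..int N} \<and> {- int N..int N} \<subseteq> UNIV"
    using eventually_ge_at_top[of "nat b"]
  proof eventually_elim
    case (elim N)
    have "x \<in> {- int N..int N}" if "x \<in> X" for x
      using b[OF that] elim by auto
    then show ?case by auto
  qed
qed

text \<open>The step \<open>L\<close> and the offset \<open>s\<close> are absorbed into one rescaled
  and modulated function \<open>g\<close>, whose Fourier integral at \<open>n\<close> is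
  \<open>fourier \<phi> (L * of_int n + s)\<close>. The Lipschitz version yields the limit of the
  symmetric partial sums, and absolute summability identifies it with the unordered sum.
  \<open>J\<close> may be any finite set outside which \<open>\<phi>\<close> vanishes at the dual
  points, so that a function and its translate can share one.\<close>

theorem poisson_summation:
  assumes \<phi>: "\<phi> \<in> test_functions" and L: "L > 0"
    and J: "finite J" "\<And>m. m \<notin> J \<Longrightarrow> \<phi> (of_int m / L) = 0"
  shows "((\<lambda>n::int. fourier \<phi> (L * of_int n + s)) has_sum
           (\<Sum>m\<in>J. \<phi> (of_int m / L) * cis (- (2 * pi * s * (of_int m / L)))) / L) UNIV"
proof -
  define g where "g u = \<phi> (u / L) * cis (- (2 * pi * s * (u / L))) / L" for u
  obtain \<Lambda> where \<Lambda>: "\<And>x y. norm (\<phi> x - \<phi> y) \<le> \<Lambda> * \<bar>x - y\<bar>" using test_function_lipschitz[OF \<phi>] by blast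
  obtain R where R: "\<And>x. \<bar>x\<bar> > R \<Longrightarrow> \<phi> x = 0" "R \<ge> 0" using test_functions_bound[OF \<phi>] by blast
  define M where "M = \<lfloor>R * L\<rfloor> + 1"
  have M: "M \<ge> 0" using R(2) L by (simp add: M_def)
  have supp: "g u = 0" if "\<bar>u\<bar> \<ge> of_int M" for u
  proof -
    have "R * L < of_int M" by (simp add: M_def)
    then have "R * L < \<bar>u\<bar>" using that by simp
    then have "\<bar>u / L\<bar> > R" using L by (simp add: field_simps)
    then show ?thesis by (simp add: g_def R(1))
  qed
  obtain B where B: "\<And>x. norm (\<phi> x) \<le> B"
  proof -
    have "\<phi> \<in> schwartz" using \<phi> test_functions_subset_schwartz by blast
    then have "bounded (range (\<lambda>x. x ^ 0 *\<^sub>R vderivs 0 \<phi> x))" unfolding schwartz_def by blast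
    then show thesis using that by (auto simp: bounded_iff)
  qed
  have lip: "norm (g u - g v) \<le> ((\<Lambda> + B * (2 * pi * \<bar>s\<bar>)) / (L * L)) * \<bar>u - v\<bar>" for u v
  proof -
    define x y where "x = u / L" and "y = v / L"
    define c where "c x = cis (- (2 * pi * s * x))" for x
    have xy: "\<bar>x - y\<bar> = \<bar>u - v\<bar> / L" using L by (simp add: x_def y_def diff_divide_distrib[symmetric])
    have "\<phi> x * c x - \<phi> y * c y = (\<phi> x - \<phi> y) * c x + \<phi> y * (c x - c y)" by (simp add: algebra_simps)
    then have "norm (\<phi> x * c x - \<phi> y * c y) \<le> norm (\<phi> x - \<phi> y) * norm (c x) + norm (\<phi> y) * norm (c x - c y)"
      by (metis norm_triangle_ineq norm_mult)
    also have "\<dots> \<le> \<Lambda> * \<bar>x - y\<bar> + B * (2 * pi * \<bar>s\<bar> * \<bar>x - y\<bar>)"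
    proof (rule add_mono)
      show "norm (\<phi> x - \<phi> y) * norm (c x) \<le> \<Lambda> * \<bar>x - y\<bar>" using \<Lambda> by (simp add: c_def)
      have "norm (c x - c y) \<le> \<bar>(- (2 * pi * s * x)) - (- (2 * pi * s * y))\<bar>"
        unfolding c_def by (rule norm_cis_diff_le)
      also have "(- (2 * pi * s * x)) - (- (2 * pi * s * y)) = - ((2 * pi * s) * (x - y))" by (simp add: algebra_simps)
      also have "\<bar>- ((2 * pi * s) * (x - y))\<bar> = 2 * pi * \<bar>s\<bar> * \<bar>x - y\<bar>" by (simp add: abs_mult)
      finally show "norm (\<phi> y) * norm (c x - c y) \<le> B * (2 * pi * \<bar>s\<bar> * \<bar>x - y\<bar>)"
        using B order_trans[OF norm_ge_zero B[of 0]] by (intro mult_mono) auto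
    qed
    also have "\<dots> = (\<Lambda> + B * (2 * pi * \<bar>s\<bar>)) * (\<bar>u - v\<bar> / L)" by (simp add: xy algebra_simps)
    finally have "norm (\<phi> x * c x - \<phi> y * c y) / L \<le> (\<Lambda> + B * (2 * pi * \<bar>s\<bar>)) * (\<bar>u - v\<bar> / L) / L"
      using L by (intro divide_right_mono) auto
    moreover have "g u - g v = (\<phi> x * c x - \<phi> y * c y) / L"
      by (simp add: g_def x_def y_def c_def diff_divide_distrib)
    ultimately show ?thesis using L by (simp add: norm_divide)
  qed
  have eq: "(LINT u|lborel. g u * cis (- (2 * pi * of_int n * u))) = fourier \<phi> (L * of_int n + s)" for n :: int
  proof -
    have "(LINT u|lborel. g u * cis (- (2 * pi * of_int n * u))) =
        L *\<^sub>R (LINT x|lborel. g (L * x) * cis (- (2 * pi * of_int n * (L * x))))"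
      using L by (subst lborel_integral_real_affine[where c = L and t = 0]) auto
    also have "\<dots> = (LINT x|lborel. L *\<^sub>R (g (L * x) * cis (- (2 * pi * of_int n * (L * x)))))"
      by simp
    also have "\<dots> = (LINT x|lborel. \<phi> x * cis (- (2 * pi * (L * of_int n + s) * x)))"
    proof (rule Bochner_Integration.integral_cong[OF refl])
      fix x
      have "L *\<^sub>R (g (L * x) * cis (- (2 * pi * of_int n * (L * x)))) =
            \<phi> x * (cis (- (2 * pi * s * x)) * cis (- (2 * pi * of_int n * (L * x))))"
        using L by (simp add: g_def scaleR_conv_of_real)
      also have "cis (- (2 * pi * s * x)) * cis (- (2 * pi * of_int n * (L * x))) = cis (- (2 * pi * (L * of_int n + s) * x))"
        by (simp add: cis_mult algebra_simps)
      finally show "L *\<^sub>R (g (L * x) * cis (- (2 * pi * of_int n * (L * x)))) = \<phi> x * cis (- (2 * pi * (L * of_int n + s) * x))" .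
    qed
    finally show ?thesis by (simp add: fourier_cis)
  qed
  have lim: "(\<lambda>N. \<Sum>n\<in>{-int N..int N}. fourier \<phi> (L * of_int n + s)) \<longlonglongrightarrow> (\<Sum>m\<in>{-M..M}. g (of_int m))"
    using poisson_summation_lipschitz[OF lip supp M] unfolding eq by simp
  have "(\<lambda>n::int. fourier \<phi> (L * of_int n + s)) summable_on UNIV"
    by (rule abs_summable_summable[OF fourier_abs_summable[OF \<phi> L]])
  then have hs: "((\<lambda>n::int. fourier \<phi> (L * of_int n + s)) has_sum (\<Sum>\<^sub>\<infinity>n. fourier \<phi> (L * of_int n + s))) UNIV"
    by (rule has_sum_infsum)
  then have "(\<lambda>N. \<Sum>n\<in>{-int N..int N}. fourier \<phi> (L * of_int n + s)) \<longlonglongrightarrow> (\<Sum>\<^sub>\<infinity>n. fourier \<phi> (L * of_int n + s))"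
    unfolding has_sum_def by (rule filterlim_compose[OF _ filterlim_symmetric_interval_finite_subsets])
  then have "(\<Sum>\<^sub>\<infinity>n. fourier \<phi> (L * of_int n + s)) = (\<Sum>m\<in>{-M..M}. g (of_int m))"
    using lim by (rule LIMSEQ_unique)
  also have "\<dots> = (\<Sum>m\<in>J. g (of_int m))"
  proof -
    have gJ: "g (of_int m) = 0" if "m \<notin> J" for m using J(2)[OF that] by (simp add: g_def)
    have gM: "g (of_int m) = 0" if "m \<notin> {-M..M}" for m
    proof (rule supp)
      show "of_int M \<le> \<bar>of_int m :: real\<bar>" using that by auto
    qed
    have "(\<Sum>m\<in>{-M..M}. g (of_int m)) = (\<Sum>m\<in>{-M..M} \<union> J. g (of_int m))"
      using J(1) gM by (intro sum.mono_neutral_left) auto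
    also have "\<dots> = (\<Sum>m\<in>J. g (of_int m))"
      using J(1) gJ by (intro sum.mono_neutral_right) auto
    finally show ?thesis .
  qed
  also have "\<dots> = (\<Sum>m\<in>J. \<phi> (of_int m / L) * cis (- (2 * pi * s * (of_int m / L)))) / L"
    by (simp add: g_def sum_divide_distrib)
  finally show ?thesis using hs by simp
qed

section \<open>Combs with gaps\<close>

text \<open>For test functions so narrow that they meet at most one atom; the bound then does not
  grow with the number of indices.\<close>

lemma norm_sum_le_if_at_most_one:
  fixes f :: "'a \<Rightarrow> 'b::real_normed_vector"
  assumes "\<And>m n. f m \<noteq> 0 \<Longrightarrow> f n \<noteq> 0 \<Longrightarrow> m = n" "\<And>n. norm (f n) \<le> B"
  shows "norm (sum f J) \<le> B"
proof (cases "\<exists>m\<in>J. f m \<noteq> 0")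
  case False
  then have "sum f J = 0" by (intro sum.neutral) auto
  then show ?thesis using order_trans[OF norm_ge_zero assms(2)] by simp
next
  case True
  then obtain m where m: "m \<in> J" "f m \<noteq> 0" by blast
  show ?thesis
  proof (cases "finite J")
    case True
    then have "sum f J = sum f {m}" using m assms(1) by (intro sum.mono_neutral_right) auto
    then show ?thesis using assms(2) by simp
  next
    case False
    then show ?thesis using order_trans[OF norm_ge_zero assms(2)[of m]] by simp
  qed
qed

lemma infsum_eq_single:
  fixes f :: "'a \<Rightarrow> 'b::{comm_monoid_add, t2_space}"
  assumes "\<And>n. n \<noteq> m \<Longrightarrow> f n = 0"
  shows "infsum f UNIV = f m"
  using assms by (subst infsum_cong_neutral[of "{m}" UNIV f f]) auto

lemma norm_infsum_le_if_at_most_one: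
  fixes f :: "'a \<Rightarrow> 'b::real_normed_vector"
  assumes "\<And>m n. f m \<noteq> 0 \<Longrightarrow> f n \<noteq> 0 \<Longrightarrow> m = n" "\<And>n. norm (f n) \<le> B"
  shows "norm (infsum f UNIV) \<le> B"
proof (cases "\<exists>m. f m \<noteq> 0")
  case True
  then obtain m where "f m \<noteq> 0" by blast
  then have "infsum f UNIV = f m" using assms(1) by (intro infsum_eq_single) blast
  then show ?thesis using assms(2) by simp
next
  case False
  then have "infsum f UNIV = 0" by (intro infsum_0) auto
  then show ?thesis using order_trans[OF norm_ge_zero assms(2)] by simp
qed

section \<open>Polynomials with prescribed roots on the unit circle\<close>

definition gap_degree :: "nat \<Rightarrow> nat" where
  "gap_degree K = 2 * K + 1"

lemma gap_degree_pos [simp]: "gap_degree K > 0"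
  by (simp add: gap_degree_def)

text \<open>The phase that the frequency \<open>k / L\<close> acquires over a step
  \<open>L / (4 * real (gap_degree K))\<close>, the distance between neighbouring points within a
  period. The period \<open>L\<close> cancels, so the polynomial depends on \<open>K\<close>
  alone.\<close>

definition gap_root :: "nat \<Rightarrow> int \<Rightarrow> complex" where
  "gap_root K k = cis (- (2 * pi * (of_int k / (4 * real (gap_degree K)))))"

definition gap_poly :: "nat \<Rightarrow> complex poly" where
  "gap_poly K = (\<Prod>k\<in>{-int K..int K}. [:- gap_root K k, 1:])"

lemma degree_gap_poly: "degree (gap_poly K) = gap_degree K"
  unfolding gap_poly_def gap_degree_def by (subst degree_prod_eq_sum_degree) auto

lemma poly_gap_poly: "poly (gap_poly K) z = (\<Prod>k\<in>{-int K..int K}. z - gap_root K k)"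
  by (simp add: gap_poly_def poly_prod)

lemma poly_gap_poly_sum: "poly (gap_poly K) z = (\<Sum>l\<le>gap_degree K. coeff (gap_poly K) l * z ^ l)"
  by (simp add: poly_altdef degree_gap_poly)

text \<open>All roots have modulus 1. The first point of every period thus has a weight of known
  size before modulation, and it will carry the peak.\<close>

lemma norm_coeff_0_gap_poly: "norm (coeff (gap_poly K) 0) = 1"
proof -
  have "coeff (gap_poly K) 0 = (\<Prod>k\<in>{-int K..int K}. - gap_root K k)"
    using poly_gap_poly[of K 0] by (simp add: poly_0_coeff_0)
  then show ?thesis by (simp add: prod_norm[symmetric] gap_root_def)
qed

lemma poly_gap_poly_eq_0: "\<bar>m\<bar> \<le> int K \<Longrightarrow> poly (gap_poly K) (gap_root K m) = 0"
  unfolding poly_gap_poly by (intro prod_zero bexI[of _ m]) auto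

text \<open>The phases of \<open>K + 1\<close> and of a root \<open>k\<close> differ by at most a
  quarter turn, since \<open>K + 1 - k\<close> is between 1 and \<open>gap_degree K\<close>. So the
  first frequency beyond the gap carries an atom, the one later tested against the
  variation.\<close>

lemma poly_gap_poly_neq_0: "poly (gap_poly K) (gap_root K (int K + 1)) \<noteq> 0"
proof -
  have "gap_root K (int K + 1) \<noteq> gap_root K k" if "k \<in> {-int K..int K}" for k
  proof
    define d where "d = real (gap_degree K)"
    have dpos: "d > 0" by (simp add: d_def)
    assume "gap_root K (int K + 1) = gap_root K k"
    then have "cis (- (2 * pi * ((real K + 1) / (4 * d)))) / cis (- (2 * pi * (of_int k / (4 * d)))) = 1"
      by (simp add: gap_root_def d_def add.commute)
    then have "cis (- (2 * pi * ((real K + 1) / (4 * d))) - - (2 * pi * (of_int k / (4 * d)))) = 1"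
      by (simp only: cis_divide)
    also have "- (2 * pi * ((real K + 1) / (4 * d))) - - (2 * pi * (of_int k / (4 * d))) = - (2 * pi * ((real K + 1 - of_int k) / (4 * d)))"
      using dpos by (simp add: field_simps)
    finally have "norm (cis (2 * pi * ((real K + 1 - of_int k) / (4 * d))) - 1) = 0"
      by (metis cis_cnj complex_cnj_one eq_iff_diff_eq_0 minus_minus norm_zero)
    moreover define x where "x = (real K + 1 - of_int k) / (4 * d)"
    have "0 < x" "x < 1"
    proof -
      have "of_int k \<le> real K" "- real K \<le> of_int k" using that by (auto simp: of_int_le_iff[symmetric, where 'a = real] simp del: of_int_le_iff)
      then show "0 < x" "x < 1" by (auto simp: x_def d_def gap_degree_def field_simps)
    qed
    ultimately show False using norm_cis_minus_1_ge[of x] by (auto simp: x_def)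
  qed
  then show ?thesis unfolding poly_gap_poly by (subst prod_zero_iff) auto
qed

text \<open>Total mass of one period before modulation. It bounds the local size of the comb as well
  as every frequency weight.\<close>

definition comb_const :: "nat \<Rightarrow> real" where
  "comb_const K = (\<Sum>l\<le>gap_degree K. norm (coeff (gap_poly K) l))"

lemma comb_const_nonneg: "comb_const K \<ge> 0"
  by (simp add: comb_const_def sum_nonneg)

text \<open>
  In one period of length \<open>L\<close> the weights are the coefficients of a polynomial vanishing at the
  roots of unity for the frequencies \<open>m / L\<close> with \<open>\<bar>m\<bar> \<le> K\<close>; the points stay in the
  third quarter of the period.  The factor \<open>cis (2 * pi * shift * x) - 1\<close> makes the
  distribution small while keeping its values of size about 1 near \<open>1 / (2 * shift)\<close>.
\<close>

locale comb =
  fixes L :: real and K N :: nat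
  assumes L: "L \<ge> 8" and N: "N \<ge> 1"
begin

definition pt :: "int \<Rightarrow> nat \<Rightarrow> real" where
  "pt n l = L * (of_int n + 1 / 2 + real l / (4 * real (gap_degree K)))"

text \<open>Makes \<open>shift * pt (int N) 0\<close> equal to 1 / 2, so that the modulating factor
  is exactly -2 at the first point of period \<open>N\<close>. The odd factor reflects the offset 1
  / 2 in \<open>pt\<close>.\<close>

definition shift :: real where
  "shift = 1 / (L * (2 * real N + 1))"

definition wt :: "int \<Rightarrow> nat \<Rightarrow> complex" where
  "wt n l = coeff (gap_poly K) l * (cis (2 * pi * shift * pt n l) - 1)"

text \<open>The unordered sum has the default value 0 where it does not converge; a bound on
  \<open>\<bar>x\<bar> ^ 3 * norm (\<phi> x)\<close> guarantees convergence.\<close>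

definition comb_dist :: "(real \<Rightarrow> complex) \<Rightarrow> complex" where
  "comb_dist \<phi> = (\<Sum>l\<le>gap_degree K. \<Sum>\<^sub>\<infinity>n. wt n l * \<phi> (pt n l))"

text \<open>Weight at \<open>m / L\<close> of the Fourier transform of the comb before modulation: a
  phase sum over the points of one period, with the factor 1 / L of Poisson summation.\<close>

definition freq_wt :: "int \<Rightarrow> complex" where
  "freq_wt m = (\<Sum>l\<le>gap_degree K. coeff (gap_poly K) l * cis (- (2 * pi * pt 0 l * (of_int m / L)))) / L"

lemma Lpos: "L > 0" using L by simp

lemma shift_pos: "shift > 0" and shift_le: "shift \<le> 1 / (3 * L)"
proof -
  show "shift > 0" using Lpos by (simp add: shift_def)
  have "L * 3 \<le> L * (2 * real N + 1)" using N Lpos by (intro mult_left_mono) auto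
  then show "shift \<le> 1 / (3 * L)" unfolding shift_def using Lpos by (intro divide_left_mono) auto
qed

text \<open>The points of period \<open>n\<close> lie between \<open>L * (n + 1 / 2)\<close> and
  \<open>L * (n + 3 / 4)\<close>. Equality for \<open>n = -1\<close> and
  \<open>l = gap_degree K\<close> explains the constant 1 / 8.\<close>

lemma pt_ge:
  assumes "l \<le> gap_degree K"
  shows "\<bar>pt n l\<bar> \<ge> L / 8 * (1 + \<bar>of_int n\<bar>)"
proof -
  define q where "q = real l / (4 * real (gap_degree K))"
  have q: "0 \<le> q" "q \<le> 1 / 4"
  proof -
    have "real l \<le> 1 * real (gap_degree K)" using assms by (simp only: mult_1 of_nat_le_iff)
    then show "q \<le> 1 / 4" unfolding q_def by (simp add: divide_le_eq)
  qed (simp add: q_def)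
  have "\<bar>of_int n + 1 / 2 + q\<bar> \<ge> (1 + \<bar>of_int n\<bar>) / 8"
  proof (cases "n \<ge> 0")
    case True
    then have "(of_int n :: real) \<ge> 0" by simp
    then show ?thesis using q by simp
  next
    case False
    then have "(of_int n :: real) \<le> - 1" by (metis le_minus_one_simps(3) linorder_not_le of_int_1 of_int_le_iff of_int_minus zle_diff1_eq diff_0 not_le)
    then show ?thesis using q by simp
  qed
  then have "L * ((1 + \<bar>of_int n\<bar>) / 8) \<le> L * \<bar>of_int n + 1 / 2 + q\<bar>"
    using Lpos by (intro mult_left_mono) auto
  then show ?thesis using Lpos by (simp add: pt_def q_def abs_mult)
qed

lemma pt_ge_1: "l \<le> gap_degree K \<Longrightarrow> \<bar>pt n l\<bar> \<ge> 1 + \<bar>of_int n\<bar>"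
proof -
  assume "l \<le> gap_degree K"
  have "1 * (1 + \<bar>of_int n\<bar>) \<le> L / 8 * (1 + \<bar>of_int n :: real\<bar>)"
    using L by (intro mult_right_mono) auto
  also have "\<dots> \<le> \<bar>pt n l\<bar>" by (rule pt_ge) fact
  finally show "1 + \<bar>of_int n\<bar> \<le> \<bar>pt n l\<bar>" by simp
qed

section \<open>Convergence and size of a single comb\<close>

lemma norm_wt_le: "norm (wt n l) \<le> 2 * norm (coeff (gap_poly K) l)"
proof -
  have "norm (cis (2 * pi * shift * pt n l) - 1) \<le> 2"
    using norm_triangle_ineq4[of "cis (2 * pi * shift * pt n l)" 1] by simp
  then show ?thesis unfolding wt_def norm_mult
    by (subst mult.commute) (intro mult_right_mono, auto)
qed

text \<open>One of the three powers of \<open>\<bar>x\<bar>\<close> pays for the estimate of the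
  modulating factor by \<open>2 * pi * shift * \<bar>x\<bar>\<close>, the other two for summability
  over \<open>n\<close>. This is the source of the factor \<open>shift\<close> in the size of the
  comb.\<close>

lemma comb_term_bound:
  assumes l: "l \<le> gap_degree K" and \<phi>: "\<And>x. \<bar>x\<bar> ^ 3 * norm (\<phi> x) \<le> Q"
  shows "norm (wt n l * \<phi> (pt n l)) \<le> (norm (coeff (gap_poly K) l) * (2 * pi * shift) * Q) * (1 / (1 + \<bar>of_int n\<bar>)\<^sup>2)"
proof -
  define x where "x = pt n l"
  have x: "\<bar>x\<bar> \<ge> 1 + \<bar>of_int n\<bar>" unfolding x_def by (rule pt_ge_1[OF l])
  then have x0: "\<bar>x\<bar> > 0" by linarith
  have Q: "Q \<ge> 0" using \<phi>[of 0] by simp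
  have "norm (cis (2 * pi * shift * x) - 1) \<le> 2 * pi * shift * \<bar>x\<bar>"
    using norm_cis_diff_le[of "2 * pi * shift * x" 0] shift_pos by (simp add: abs_mult)
  then have "norm (cis (2 * pi * shift * x) - 1) * norm (\<phi> x) \<le> (2 * pi * shift * \<bar>x\<bar>) * norm (\<phi> x)"
    by (rule mult_right_mono) simp
  also have "\<dots> = (2 * pi * shift) * (\<bar>x\<bar> * norm (\<phi> x))" by simp
  also have "\<bar>x\<bar> * norm (\<phi> x) \<le> Q / \<bar>x\<bar>\<^sup>2"
  proof (subst pos_le_divide_eq)
    have "\<bar>x\<bar> * norm (\<phi> x) * \<bar>x\<bar>\<^sup>2 = \<bar>x\<bar> ^ 3 * norm (\<phi> x)" by (simp only: power2_eq_square power3_eq_cube mult_ac)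
    then show "\<bar>x\<bar> * norm (\<phi> x) * \<bar>x\<bar>\<^sup>2 \<le> Q" using \<phi>[of x] by (simp only:)
  qed (use x0 in simp)
  also have "Q / \<bar>x\<bar>\<^sup>2 \<le> Q / (1 + \<bar>of_int n\<bar>)\<^sup>2"
    using x Q by (intro divide_left_mono power_mono mult_pos_pos zero_less_power) auto
  finally have "norm (cis (2 * pi * shift * x) - 1) * norm (\<phi> x) \<le> (2 * pi * shift) * (Q / (1 + \<bar>of_int n\<bar>)\<^sup>2)"
    using shift_pos by (simp add: mult_left_mono)
  then have "norm (coeff (gap_poly K) l) * (norm (cis (2 * pi * shift * x) - 1) * norm (\<phi> x)) \<le>
      norm (coeff (gap_poly K) l) * ((2 * pi * shift) * (Q / (1 + \<bar>of_int n\<bar>)\<^sup>2))"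
    by (rule mult_left_mono) simp
  then show ?thesis by (simp add: wt_def norm_mult x_def mult_ac)
qed

lemma comb_summable:
  assumes l: "l \<le> gap_degree K" and \<phi>: "\<And>x. \<bar>x\<bar> ^ 3 * norm (\<phi> x) \<le> Q"
  shows "(\<lambda>n. wt n l * \<phi> (pt n l)) summable_on UNIV"
proof (rule abs_summable_summable[OF summable_on_int_if_quadratic_decay])
  show "norm (wt n l * \<phi> (pt n l)) \<le> (norm (coeff (gap_poly K) l) * (2 * pi * shift) * Q) / (1 + \<bar>of_int n\<bar>)\<^sup>2" for n
    using comb_term_bound[OF l \<phi>] by simp
qed

lemma norm_comb_dist_le:
  assumes \<phi>: "\<And>x. \<bar>x\<bar> ^ 3 * norm (\<phi> x) \<le> Q"
  shows "norm (comb_dist \<phi>) \<le> 2 * pi * comb_const K * (\<Sum>\<^sub>\<infinity>n::int. 1 / (1 + \<bar>of_int n\<bar>)\<^sup>2) * shift * Q"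
proof -
  let ?Z = "\<Sum>\<^sub>\<infinity>n::int. 1 / (1 + \<bar>of_int n\<bar>)\<^sup>2 :: real"
  have "norm (comb_dist \<phi>) \<le> (\<Sum>l\<le>gap_degree K. norm (\<Sum>\<^sub>\<infinity>n. wt n l * \<phi> (pt n l)))"
    unfolding comb_dist_def by (rule norm_sum)
  also have "\<dots> \<le> (\<Sum>l\<le>gap_degree K. (norm (coeff (gap_poly K) l) * (2 * pi * shift) * Q) * ?Z)"
  proof (rule sum_mono)
    fix l assume "l \<in> {..gap_degree K}"
    then have l: "l \<le> gap_degree K" by simp
    show "norm (\<Sum>\<^sub>\<infinity>n. wt n l * \<phi> (pt n l)) \<le> (norm (coeff (gap_poly K) l) * (2 * pi * shift) * Q) * ?Z"
      by (rule norm_infsum_le[OF has_sum_infsum[OF comb_summable[OF l \<phi>]]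
            has_sum_cmult_right[OF has_sum_infsum[OF summable_inverse_squares_int]] comb_term_bound[OF l \<phi>]])
  qed
  also have "\<dots> = 2 * pi * comb_const K * ?Z * shift * Q"
    by (simp add: comb_const_def sum_distrib_left sum_distrib_right mult_ac)
  finally show ?thesis .
qed

lemma comb_dist_add:
  assumes "\<And>x. \<bar>x\<bar> ^ 3 * norm (\<phi> x) \<le> Q" "\<And>x. \<bar>x\<bar> ^ 3 * norm (\<psi> x) \<le> Q'"
  shows "comb_dist (\<lambda>x. \<phi> x + \<psi> x) = comb_dist \<phi> + comb_dist \<psi>"
proof -
  have "(\<Sum>\<^sub>\<infinity>n. wt n l * (\<phi> (pt n l) + \<psi> (pt n l))) =
      (\<Sum>\<^sub>\<infinity>n. wt n l * \<phi> (pt n l)) + (\<Sum>\<^sub>\<infinity>n. wt n l * \<psi> (pt n l))" if "l \<le> gap_degree K" for l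
    unfolding distrib_left
    by (rule infsum_add[OF comb_summable[OF that assms(1)] comb_summable[OF that assms(2)]])
  then show ?thesis by (simp add: comb_dist_def sum.distrib)
qed

lemma comb_dist_cmult: "comb_dist (\<lambda>x. c * \<phi> x) = c * comb_dist \<phi>"
proof -
  have "(\<Sum>\<^sub>\<infinity>n. wt n l * (c * \<phi> (pt n l))) = c * (\<Sum>\<^sub>\<infinity>n. wt n l * \<phi> (pt n l))" for l
    by (subst infsum_cmult_right'[symmetric]) (simp add: mult_ac)
  then show ?thesis by (simp add: comb_dist_def sum_distrib_left)
qed

lemma comb_dist_finite:
  assumes "\<And>x. \<bar>x\<bar> > r \<Longrightarrow> \<phi> x = 0" "r \<le> of_int M"
  shows "comb_dist \<phi> = (\<Sum>l\<le>gap_degree K. \<Sum>n\<in>{-M..M}. wt n l * \<phi> (pt n l))"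
  unfolding comb_dist_def
proof (rule sum.cong[OF refl])
  fix l assume "l \<in> {..gap_degree K}"
  then have l: "l \<le> gap_degree K" by simp
  have "\<phi> (pt n l) = 0" if "n \<notin> {-M..M}" for n
  proof (rule assms(1))
    have "of_int M < \<bar>of_int n :: real\<bar>" using that by auto
    then show "r < \<bar>pt n l\<bar>" using pt_ge_1[OF l, of n] assms(2) by linarith
  qed
  then have "(\<Sum>\<^sub>\<infinity>n. wt n l * \<phi> (pt n l)) = infsum (\<lambda>n. wt n l * \<phi> (pt n l)) {-M..M}"
    by (intro infsum_cong_neutral) auto
  then show "(\<Sum>\<^sub>\<infinity>n. wt n l * \<phi> (pt n l)) = (\<Sum>n\<in>{-M..M}. wt n l * \<phi> (pt n l))" by simp
qed

lemma comb_dist_eq_0: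
  assumes "\<And>x. \<bar>x\<bar> \<ge> L / 8 \<Longrightarrow> \<phi> x = 0"
  shows "comb_dist \<phi> = 0"
proof -
  have "\<phi> (pt n l) = 0" if "l \<le> gap_degree K" for n l
  proof (rule assms)
    have "L / 8 * 1 \<le> L / 8 * (1 + \<bar>of_int n\<bar>)" using Lpos by (intro mult_left_mono) auto
    then show "L / 8 \<le> \<bar>pt n l\<bar>" using pt_ge[OF that, of n] by simp
  qed
  then show ?thesis by (simp add: comb_dist_def)
qed

text \<open>For each \<open>l\<close> the points form a progression of step \<open>L\<close>, to
  which Poisson summation with offset \<open>pt 0 l\<close> applies. Modulation at the points is
  translation by \<open>shift\<close> in frequency, so an atom \<open>freq_wt m\<close> at
  \<open>m / L + shift\<close> comes with its negative at \<open>m / L\<close>.\<close>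

lemma comb_dist_fourier:
  assumes \<phi>: "\<phi> \<in> test_functions" and J: "finite J"
    "\<And>m. m \<notin> J \<Longrightarrow> \<phi> (of_int m / L) = 0" "\<And>m. m \<notin> J \<Longrightarrow> \<phi> (of_int m / L + shift) = 0"
  shows "comb_dist (fourier \<phi>) = (\<Sum>m\<in>J. freq_wt m * (\<phi> (of_int m / L + shift) - \<phi> (of_int m / L)))"
proof -
  have "(\<Sum>\<^sub>\<infinity>n. wt n l * fourier \<phi> (pt n l)) =
      (\<Sum>m\<in>J. (coeff (gap_poly K) l * cis (- (2 * pi * pt 0 l * (of_int m / L)))) / L * (\<phi> (of_int m / L + shift) - \<phi> (of_int m / L)))" for l
  proof -
    let ?e = "\<lambda>m::int. cis (- (2 * pi * pt 0 l * (of_int m / L)))"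
    let ?S = "\<lambda>\<phi>. (\<Sum>m\<in>J. \<phi> (of_int m / L) * ?e m) / L"
    have pt: "L * of_int n + pt 0 l = pt n l" for n by (simp add: pt_def algebra_simps)
    have h: "((\<lambda>n. fourier \<phi> (L * of_int n + pt 0 l)) has_sum ?S \<phi>) UNIV"
      by (rule poisson_summation[OF \<phi> Lpos J(1,2)])
    have h': "((\<lambda>n. fourier (\<lambda>x. \<phi> (x + shift)) (L * of_int n + pt 0 l)) has_sum ?S (\<lambda>x. \<phi> (x + shift))) UNIV"
      by (rule poisson_summation[OF test_functions_shift[OF \<phi>] Lpos J(1,3)])
    have "((\<lambda>n. fourier (\<lambda>x. \<phi> (x + shift)) (L * of_int n + pt 0 l) + (- 1) * fourier \<phi> (L * of_int n + pt 0 l)) has_sum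
        (?S (\<lambda>x. \<phi> (x + shift)) + (- 1) * ?S \<phi>)) UNIV"
      by (intro has_sum_add h' has_sum_cmult_right h)
    then have "((\<lambda>n. coeff (gap_poly K) l * (fourier (\<lambda>x. \<phi> (x + shift)) (L * of_int n + pt 0 l) + (- 1) * fourier \<phi> (L * of_int n + pt 0 l))) has_sum
        (coeff (gap_poly K) l * (?S (\<lambda>x. \<phi> (x + shift)) + (- 1) * ?S \<phi>))) UNIV"
      by (rule has_sum_cmult_right)
    moreover have "coeff (gap_poly K) l * (fourier (\<lambda>x. \<phi> (x + shift)) (L * of_int n + pt 0 l) + (- 1) * fourier \<phi> (L * of_int n + pt 0 l)) =
        wt n l * fourier \<phi> (pt n l)" for n
      unfolding fourier_shift pt wt_def by (simp add: algebra_simps)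
    moreover have "coeff (gap_poly K) l * (?S (\<lambda>x. \<phi> (x + shift)) + (- 1) * ?S \<phi>) =
        (\<Sum>m\<in>J. (coeff (gap_poly K) l * ?e m) / L * (\<phi> (of_int m / L + shift) - \<phi> (of_int m / L)))"
    proof -
      have "?S (\<lambda>x. \<phi> (x + shift)) + (- 1) * ?S \<phi> = (\<Sum>m\<in>J. \<phi> (of_int m / L + shift) * ?e m / L - \<phi> (of_int m / L) * ?e m / L)"
        by (simp add: sum_subtractf sum_divide_distrib)
      then show ?thesis
        by (simp only: sum_distrib_left) (rule sum.cong[OF refl], simp only: diff_divide_distrib right_diff_distrib left_diff_distrib times_divide_eq_right times_divide_eq_left mult_ac)
    qed
    ultimately show ?thesis by (simp only: infsumI)
  qed
  then have "comb_dist (fourier \<phi>) = (\<Sum>l\<le>gap_degree K. (\<Sum>m\<in>J. (coeff (gap_poly K) l * cis (- (2 * pi * pt 0 l * (of_int m / L)))) / L * (\<phi> (of_int m / L + shift) - \<phi> (of_int m / L))))"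
    unfolding comb_dist_def by (intro sum.cong refl)
  also have "\<dots> = (\<Sum>m\<in>J. (\<Sum>l\<le>gap_degree K. (coeff (gap_poly K) l * cis (- (2 * pi * pt 0 l * (of_int m / L)))) / L * (\<phi> (of_int m / L + shift) - \<phi> (of_int m / L))))"
    by (rule sum.swap)
  also have "\<dots> = (\<Sum>m\<in>J. freq_wt m * (\<phi> (of_int m / L + shift) - \<phi> (of_int m / L)))"
    unfolding freq_wt_def sum_divide_distrib sum_distrib_right ..
  finally show ?thesis .
qed

text \<open>Neighbouring points of a period always differ by the same phase, so the phase sum is a
  value of the polynomial. The sign factor comes from the offset \<open>L / 2\<close>.\<close>

lemma freq_wt_poly: "freq_wt m = cis (- (pi * of_int m)) * poly (gap_poly K) (gap_root K m) / L"
proof -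
  have "coeff (gap_poly K) l * cis (- (2 * pi * pt 0 l * (of_int m / L))) =
      cis (- (pi * of_int m)) * (coeff (gap_poly K) l * gap_root K m ^ l)" for l
  proof -
    have "gap_root K m ^ l = cis (real l * (- (2 * pi * (of_int m / (4 * real (gap_degree K))))))"
      unfolding gap_root_def by (rule Complex.DeMoivre)
    moreover have "- (2 * pi * pt 0 l * (of_int m / L)) =
        - (pi * of_int m) + real l * (- (2 * pi * (of_int m / (4 * real (gap_degree K)))))"
      using Lpos by (simp add: pt_def field_simps)
    ultimately show ?thesis by (simp only: cis_mult[symmetric] mult_ac)
  qed
  then show ?thesis by (simp only: freq_wt_def poly_gap_poly_sum sum_distrib_left)
qed

lemma freq_wt_eq_0: "\<bar>m\<bar> \<le> int K \<Longrightarrow> freq_wt m = 0"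
  by (simp add: freq_wt_poly poly_gap_poly_eq_0)

lemma norm_freq_wt_first: "norm (freq_wt (int K + 1)) = norm (poly (gap_poly K) (gap_root K (int K + 1))) / L"
  using Lpos by (simp add: freq_wt_poly norm_mult norm_divide)

lemma norm_freq_wt_le: "norm (freq_wt m) \<le> comb_const K"
proof -
  have "norm (\<Sum>l\<le>gap_degree K. coeff (gap_poly K) l * cis (- (2 * pi * pt 0 l * (of_int m / L)))) \<le> comb_const K"
    unfolding comb_const_def by (rule order_trans[OF norm_sum]) (simp add: norm_mult)
  then have "norm (freq_wt m) \<le> comb_const K / L"
    unfolding freq_wt_def norm_divide using Lpos by (simp add: divide_right_mono)
  also have "\<dots> \<le> comb_const K / 1" using L comb_const_nonneg by (intro divide_left_mono) auto
  finally show ?thesis by simp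
qed

lemma finite_freq_support:
  assumes \<phi>: "\<phi> \<in> test_functions"
  obtains J where "finite J" "\<And>m. m \<notin> J \<Longrightarrow> \<phi> (of_int m / L) = 0" "\<And>m. m \<notin> J \<Longrightarrow> \<phi> (of_int m / L + shift) = 0"
proof -
  obtain r where r: "\<And>x. \<bar>x\<bar> > r \<Longrightarrow> \<phi> x = 0" "r \<ge> 0" using test_functions_bound[OF \<phi>] by blast
  \<comment> \<open>The margin 1 absorbs the translation by \<open>shift\<close>.\<close>
  define M where "M = \<lceil>L * (r + 1)\<rceil>"
  have *: "\<bar>of_int m / L\<bar> > r + 1" if "m \<notin> {-M..M}" for m
  proof -
    have "M < \<bar>m\<bar>" using that by auto
    then have "of_int M < \<bar>of_int m :: real\<bar>" by (metis of_int_abs of_int_less_iff)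
    then have "L * (r + 1) < \<bar>of_int m\<bar>" unfolding M_def using le_of_int_ceiling le_less_trans by blast
    then show ?thesis using Lpos by (simp add: field_simps)
  qed
  have "shift \<le> 1"
  proof -
    have "1 / (3 * L) \<le> 1 / 1" using L by (intro divide_left_mono) auto
    then show ?thesis using shift_le by simp
  qed
  show thesis
  proof (rule that[of "{-M..M}"])
    fix m assume m: "m \<notin> {-M..M}"
    show "\<phi> (of_int m / L) = 0" using *[OF m] by (intro r(1)) auto
    show "\<phi> (of_int m / L + shift) = 0" using *[OF m] \<open>shift \<le> 1\<close> shift_pos by (intro r(1)) linarith
  qed simp
qed

lemma freq_separated:
  assumes \<phi>: "\<And>x. \<bar>x - y\<bar> \<ge> \<delta> \<Longrightarrow> \<phi> x = (0::complex)" and \<delta>: "\<delta> \<le> 1 / (2 * L)"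
    and "\<phi> (of_int m / L + b) \<noteq> 0" "\<phi> (of_int n / L + b) \<noteq> 0"
  shows "m = n"
proof -
  have "\<bar>of_int m / L + b - y\<bar> < \<delta>" "\<bar>of_int n / L + b - y\<bar> < \<delta>"
    using assms(3,4) \<phi> not_le by blast+
  then have "\<bar>of_int m / L - of_int n / L\<bar> < 2 * \<delta>" by linarith
  then have "\<bar>of_int m / L - of_int n / L\<bar> < 1 / L" using \<delta> by simp
  then have "\<bar>of_int (m - n)\<bar> / L < 1 / L" using Lpos by (simp add: diff_divide_distrib[symmetric])
  then have "\<bar>of_int (m - n)\<bar> < (1::real)" using Lpos by (simp add: divide_less_cancel)
  then show ?thesis by linarith
qed

text \<open>An open interval of length at most \<open>1 / L\<close> meets at most one of the points
  \<open>m / L\<close> and at most one of the points \<open>m / L + shift\<close>. Each of the two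
  contributes at most \<open>comb_const K\<close>.\<close>

lemma comb_dist_fourier_narrow:
  assumes \<phi>: "\<phi> \<in> test_functions" "\<And>x. \<bar>x - y\<bar> \<ge> \<delta> \<Longrightarrow> \<phi> x = 0" "\<And>x. norm (\<phi> x) \<le> 1"
    and \<delta>: "\<delta> \<le> 1 / (2 * L)"
  shows "norm (comb_dist (fourier \<phi>)) \<le> 2 * comb_const K"
proof -
  obtain J where J: "finite J" "\<And>m. m \<notin> J \<Longrightarrow> \<phi> (of_int m / L) = 0" "\<And>m. m \<notin> J \<Longrightarrow> \<phi> (of_int m / L + shift) = 0"
    using finite_freq_support[OF \<phi>(1)] by blast
  have *: "norm (\<Sum>m\<in>J. freq_wt m * \<phi> (of_int m / L + b)) \<le> comb_const K" for b
  proof (rule norm_sum_le_if_at_most_one)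
    fix m n :: int
    assume "freq_wt m * \<phi> (of_int m / L + b) \<noteq> 0" "freq_wt n * \<phi> (of_int n / L + b) \<noteq> 0"
    then show "m = n" by (intro freq_separated[OF \<phi>(2) \<delta>]) auto
  next
    fix n :: int
    have "norm (freq_wt n * \<phi> (of_int n / L + b)) \<le> comb_const K * 1"
      unfolding norm_mult using norm_freq_wt_le \<phi>(3) comb_const_nonneg by (intro mult_mono) auto
    then show "norm (freq_wt n * \<phi> (of_int n / L + b)) \<le> comb_const K" by simp
  qed
  have "comb_dist (fourier \<phi>) = (\<Sum>m\<in>J. freq_wt m * \<phi> (of_int m / L + shift)) - (\<Sum>m\<in>J. freq_wt m * \<phi> (of_int m / L + 0))"
    using comb_dist_fourier[OF \<phi>(1) J] by (simp add: sum_subtractf right_diff_distrib)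
  then show ?thesis using norm_triangle_ineq4 *[of shift] *[of 0] by (smt (verit))
qed

text \<open>Within distance \<open>shift\<close> of the first frequency beyond the gap only its own
  atom is left: shifted atoms of index at least \<open>K + 1\<close> are at least
  \<open>shift\<close> to the right, the others at least \<open>1 / L - shift\<close> to the left,
  and \<open>shift \<le> 1 / (3 * L)\<close>.\<close>

lemma comb_dist_fourier_first:
  assumes \<phi>: "\<phi> \<in> test_functions" "\<And>x. \<bar>x - (real K + 1) / L\<bar> \<ge> shift \<Longrightarrow> \<phi> x = 0" "\<phi> ((real K + 1) / L) = 1"
  shows "comb_dist (fourier \<phi>) = - freq_wt (int K + 1)"
proof -
  have a: "\<phi> (of_int m / L) = 0" if "m \<noteq> int K + 1" for m
  proof (rule \<phi>(2))
    have "1 \<le> \<bar>m - (int K + 1)\<bar>" using that by linarith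
    then have "of_int 1 \<le> (of_int \<bar>m - (int K + 1)\<bar> :: real)" by (simp only: of_int_le_iff)
    then have "1 \<le> \<bar>of_int m - (real K + 1)\<bar>" by simp
    then have "1 / L \<le> \<bar>of_int m - (real K + 1)\<bar> / L" using Lpos by (intro divide_right_mono) auto
    also have "\<dots> = \<bar>of_int m / L - (real K + 1) / L\<bar>" using Lpos by (simp add: diff_divide_distrib[symmetric])
    finally have "1 / L \<le> \<bar>of_int m / L - (real K + 1) / L\<bar>" .
    moreover have "1 / (3 * L) \<le> 1 / L" using Lpos by (simp add: field_simps)
    ultimately show "shift \<le> \<bar>of_int m / L - (real K + 1) / L\<bar>" using shift_le by linarith
  qed
  have b: "\<phi> (of_int m / L + shift) = 0" for m
  proof (rule \<phi>(2))
    have eq: "of_int m / L + shift - (real K + 1) / L = of_int (m - (int K + 1)) / L + shift"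
      by (simp add: diff_divide_distrib add_divide_distrib)
    show "shift \<le> \<bar>of_int m / L + shift - (real K + 1) / L\<bar>"
    proof (cases "m \<ge> int K + 1")
      case True
      then have "of_int (m - (int K + 1)) / L \<ge> 0" using Lpos by (intro divide_nonneg_pos) (auto simp: of_int_0_le_iff simp del: of_int_diff)
      then show ?thesis unfolding eq using shift_pos by linarith
    next
      case False
      then have "m - (int K + 1) \<le> - 1" by linarith
      then have "(of_int (m - (int K + 1)) :: real) \<le> of_int (- 1)" by (simp only: of_int_le_iff)
      then have "of_int (m - (int K + 1)) / L \<le> (- 1) / L" using Lpos by (intro divide_right_mono) auto
      moreover have "2 * (1 / (3 * L)) \<le> 1 / L" using Lpos by (simp add: field_simps)
      ultimately show ?thesis unfolding eq using shift_le by linarith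
    qed
  qed
  have "comb_dist (fourier \<phi>) = (\<Sum>m\<in>{int K + 1}. freq_wt m * (\<phi> (of_int m / L + shift) - \<phi> (of_int m / L)))"
    by (rule comb_dist_fourier[OF \<phi>(1)]) (auto simp: a b)
  moreover have "\<phi> ((real K + 1) / L + shift) = 0" using b[of "int K + 1"] by simp
  ultimately show ?thesis using \<phi>(3) by simp
qed

text \<open>Frequencies with \<open>\<bar>m\<bar> \<le> K\<close> have weight 0, and all other atoms
  lie outside the support. The 1 subtracted from the radius allows for the shift.\<close>

lemma comb_dist_fourier_eq_0:
  assumes \<phi>: "\<phi> \<in> test_functions" "\<And>x. \<bar>x\<bar> \<ge> real K / L - 1 \<Longrightarrow> \<phi> x = 0"
  shows "comb_dist (fourier \<phi>) = 0"
proof -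
  have *: "\<bar>of_int m / L\<bar> \<ge> real K / L" if "m \<notin> {-int K..int K}" for m
  proof -
    have "int K \<le> \<bar>m\<bar>" using that by auto
    then have "real K \<le> \<bar>of_int m\<bar>" by linarith
    then show ?thesis using Lpos by (simp add: divide_right_mono)
  qed
  have "1 / (3 * L) \<le> 1 / 1" using L by (intro divide_left_mono) auto
  then have "shift \<le> 1" using shift_le by simp
  have "comb_dist (fourier \<phi>) = (\<Sum>m\<in>{-int K..int K}. freq_wt m * (\<phi> (of_int m / L + shift) - \<phi> (of_int m / L)))"
  proof (rule comb_dist_fourier[OF \<phi>(1)])
    fix m assume m: "m \<notin> {-int K..int K}"
    show "\<phi> (of_int m / L) = 0" using *[OF m] by (intro \<phi>(2)) linarith
    show "\<phi> (of_int m / L + shift) = 0" using *[OF m] \<open>shift \<le> 1\<close> shift_pos by (intro \<phi>(2)) linarith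
  qed simp
  also have "\<dots> = 0" by (intro sum.neutral) (auto simp: freq_wt_eq_0)
  finally show ?thesis .
qed

text \<open>For fixed \<open>l\<close> the points are at least 8 apart, more than the length 2 of
  the window of the bump, so at most one \<open>n\<close> contributes, wherever the window
  lies.\<close>

lemma norm_comb_conv_bump_le: "norm (comb_dist (\<lambda>s. complex_of_real (bump (t - s)))) \<le> 2 * comb_const K * bump 0"
proof -
  have "norm (\<Sum>\<^sub>\<infinity>n. wt n l * complex_of_real (bump (t - pt n l))) \<le> 2 * norm (coeff (gap_poly K) l) * bump 0" for l
  proof (rule norm_infsum_le_if_at_most_one)
    fix m n assume "wt m l * complex_of_real (bump (t - pt m l)) \<noteq> 0" "wt n l * complex_of_real (bump (t - pt n l)) \<noteq> 0"
    then have "\<bar>t - pt m l\<bar> < 1" "\<bar>t - pt n l\<bar> < 1" using bump_eq_0 not_le by fastforce+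
    then have "\<bar>pt m l - pt n l\<bar> < 2" by linarith
    moreover define X where "X = \<bar>of_int (m - n) :: real\<bar>"
    moreover have "\<bar>pt m l - pt n l\<bar> = L * X"
      using Lpos by (simp add: X_def pt_def right_diff_distrib[symmetric] abs_mult)
    moreover have "8 * X \<le> L * X" using L by (intro mult_right_mono) (auto simp: X_def)
    ultimately have "X < 1" by linarith
    then show "m = n" unfolding X_def by linarith
  next
    fix n
    show "norm (wt n l * complex_of_real (bump (t - pt n l))) \<le> 2 * norm (coeff (gap_poly K) l) * bump 0"
      unfolding norm_mult using norm_wt_le bump_le bump_nonneg by (intro mult_mono) auto
  qed
  then have "norm (comb_dist (\<lambda>s. complex_of_real (bump (t - s)))) \<le> (\<Sum>l\<le>gap_degree K. 2 * norm (coeff (gap_poly K) l) * bump 0)"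
    unfolding comb_dist_def by (intro order_trans[OF norm_sum] sum_mono)
  also have "\<dots> = 2 * comb_const K * bump 0"
    unfolding comb_const_def sum_distrib_left sum_distrib_right ..
  finally show ?thesis .
qed

text \<open>Distance between neighbouring points of a period, capped at the radius of the
  bump.\<close>

definition spacing :: real where
  "spacing = min 1 (L / (4 * real (gap_degree K)))"

text \<open>The window of the bump is placed off centre around the first point of period
  \<open>N\<close>: on the right it does not pass the second point, and on the left the nearest
  point is at least \<open>3 * L / 4\<close> away. So a single atom is seen, the one whose
  modulating factor is -2, and nothing can cancel it.\<close>

lemma comb_conv_bump_large:
  "norm (comb_dist (\<lambda>s. complex_of_real (bump (pt (int N) 0 - 1 + spacing - s)))) = 2 * bump (1 - spacing)"
proof -
  define h where "h = L / (4 * real (gap_degree K))"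
  define t where "t = pt (int N) 0 - 1 + spacing"
  have h: "h > 0" using Lpos by (simp add: h_def)
  have sp: "spacing > 0" "spacing \<le> 1" "spacing \<le> h" using h by (auto simp: spacing_def h_def)
  have pt: "pt n l = L * of_int n + L / 2 + real l * h" for n l by (simp add: pt_def h_def field_simps)
  have zero: "bump (t - pt n l) = 0" if l: "l \<le> gap_degree K" and ne: "n \<noteq> int N \<or> l \<noteq> 0" for n l
  proof (rule bump_eq_0)
    have lh: "real l * h \<le> L / 4"
    proof -
      have "real l * h \<le> real (gap_degree K) * h" using l h by (intro mult_right_mono) auto
      also have "\<dots> = L / 4" by (simp add: h_def field_simps)
      finally show ?thesis .
    qed
    have eq: "t - pt n l = L * of_int (int N - n) - real l * h - 1 + spacing"
      by (simp add: t_def pt algebra_simps)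
    consider "n > int N" | "n = int N" | "n < int N" by linarith
    then show "1 \<le> \<bar>t - pt n l\<bar>"
    proof cases
      case 1
      then have "of_int (int N - n) \<le> (- 1 :: real)" by linarith
      then have "L * of_int (int N - n) \<le> L * (- 1)" using Lpos by (intro mult_left_mono) auto
      moreover have "real l * h \<ge> 0" using h by simp
      ultimately show ?thesis unfolding eq using L sp by linarith
    next
      case 2
      then have "1 * h \<le> real l * h" using ne h by (intro mult_right_mono) auto
      moreover have "L * of_int (int N - n) = 0" using 2 by simp
      ultimately show ?thesis unfolding eq using sp by linarith
    next
      case 3
      then have "(1 :: real) \<le> of_int (int N - n)" by linarith
      then have "L * 1 \<le> L * of_int (int N - n)" using Lpos by (intro mult_left_mono) auto
      then show ?thesis unfolding eq using L sp lh by linarith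
    qed
  qed
  have "(\<Sum>\<^sub>\<infinity>n. wt n l * complex_of_real (bump (t - pt n l))) = 0" if "l \<in> {..gap_degree K} - {0}" for l
    using that zero by (intro infsum_0) auto
  then have "comb_dist (\<lambda>s. complex_of_real (bump (t - s))) = (\<Sum>l\<in>{0}. \<Sum>\<^sub>\<infinity>n. wt n l * complex_of_real (bump (t - pt n l)))"
    unfolding comb_dist_def by (intro sum.mono_neutral_right) auto
  also have "\<dots> = (\<Sum>\<^sub>\<infinity>n. wt n 0 * complex_of_real (bump (t - pt n 0)))" by simp
  also have "\<dots> = wt (int N) 0 * complex_of_real (bump (t - pt (int N) 0))"
    using zero by (intro infsum_eq_single) auto
  finally have eq: "comb_dist (\<lambda>s. complex_of_real (bump (t - s))) = wt (int N) 0 * complex_of_real (bump (t - pt (int N) 0))" .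
  have "shift * pt (int N) 0 = 1 / 2"
  proof -
    have "pt (int N) 0 = (L * (2 * real N + 1)) / 2" by (simp add: pt_def algebra_simps)
    moreover have "L * (2 * real N + 1) > 0" using Lpos by (intro mult_pos_pos) auto
    ultimately show ?thesis using Lpos by (simp add: shift_def)
  qed
  then have "2 * pi * shift * pt (int N) 0 = pi" by (simp add: mult.assoc)
  then have "cis (2 * pi * shift * pt (int N) 0) = - 1" by (simp only: cis_pi)
  then have "norm (wt (int N) 0) = 2" unfolding wt_def norm_mult norm_coeff_0_gap_poly by (simp only:) simp
  moreover have "bump (t - pt (int N) 0) = bump (1 - spacing)"
    unfolding t_def bump_def by (simp add: abs_minus_commute power2_commute)
  ultimately show ?thesis using eq bump_nonneg by (simp add: norm_mult t_def)
qed

end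

section \<open>The sum of the combs\<close>

text \<open>Chosen so that \<open>gap_L j / 8\<close> is \<open>j + 1\<close> and
  \<open>gap_K j / gap_L j\<close> is \<open>3 * j\<close>, the radii of the gaps. The factor 3
  separates the first frequency of comb \<open>j\<close> from those of all later combs, with room
  for their shifts and for the width of a test function.\<close>

definition gap_L :: "nat \<Rightarrow> real" where "gap_L j = 8 * (real j + 1)"
definition gap_K :: "nat \<Rightarrow> nat" where "gap_K j = 3 * j * (8 * (j + 1))"

lemma gap_L_ge: "gap_L j \<ge> 8"
  by (simp add: gap_L_def)

lemma gap_K_div_L: "real (gap_K j) / gap_L j = 3 * real j"
  by (simp add: gap_K_def gap_L_def field_simps)

text \<open>The off-centre place of \<open>comb_conv_bump_large\<close>.\<close>

definition gap_peak :: "nat \<Rightarrow> nat \<Rightarrow> real" where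
  "gap_peak j N = comb.pt (gap_L j) (gap_K j) (int N) 0 - 1 + comb.spacing (gap_L j) (gap_K j)"

text \<open>Third moment bound for the reflected bump at the peak; it measures how strongly another
  comb can be felt there.\<close>

definition peak_moment :: "nat \<Rightarrow> nat \<Rightarrow> real" where
  "peak_moment j N = (\<bar>gap_peak j N\<bar> + 1) ^ 3 * bump 0"

text \<open>The smaller of two main terms, the peak of the convolution and the first atom of the
  Fourier transform, so that one constant \<open>C j\<close> serves both. It does not involve
  \<open>N\<close>, which can therefore be chosen after \<open>C j\<close>.\<close>

definition gap_size :: "nat \<Rightarrow> real" where
  "gap_size j = min (2 * bump (1 - comb.spacing (gap_L j) (gap_K j)))
     (norm (comb.freq_wt (gap_L j) (gap_K j) (int (gap_K j) + 1)))"

definition gap_moment :: "nat \<Rightarrow> real" where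
  "gap_moment j = 2 * pi * comb_const (gap_K j) * (\<Sum>\<^sub>\<infinity>n::int. 1 / (1 + \<bar>of_int n\<bar>)\<^sup>2)"

lemma comb_gap: "N \<ge> 1 \<Longrightarrow> comb (gap_L j) N"
  by unfold_locales (auto simp: gap_L_ge)

lemma gap_size_pos: "gap_size j > 0"
proof -
  interpret comb "gap_L j" "gap_K j" 1 by (rule comb_gap) simp
  have "spacing > 0" "spacing \<le> 1" using Lpos by (auto simp: spacing_def)
  then have "bump (1 - spacing) > 0" by (intro bump_pos) auto
  moreover have "norm (freq_wt (int (gap_K j) + 1)) > 0"
    using poly_gap_poly_neq_0[of "gap_K j"] Lpos unfolding norm_freq_wt_first by (intro divide_pos_pos) auto
  ultimately show ?thesis by (simp add: gap_size_def)
qed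

lemma gap_moment_nonneg: "gap_moment j \<ge> 0"
  unfolding gap_moment_def using comb_const_nonneg by (intro mult_nonneg_nonneg infsum_nonneg) auto

lemma peak_moment_nonneg: "peak_moment j N \<ge> 0"
  unfolding peak_moment_def using bump_nonneg by (intro mult_nonneg_nonneg) auto

lemma peak_moment:
  "\<bar>x\<bar> ^ 3 * norm (complex_of_real (bump (gap_peak j N - x))) \<le> peak_moment j N"
proof (cases "\<bar>gap_peak j N - x\<bar> \<ge> 1")
  case True
  then show ?thesis using peak_moment_nonneg by (simp add: bump_eq_0)
next
  case False
  then have "\<bar>x\<bar> \<le> \<bar>gap_peak j N\<bar> + 1" by linarith
  then show ?thesis unfolding peak_moment_def using bump_le bump_nonneg
    by (intro mult_mono power_mono) auto
qed

text \<open>Recursion on \<open>j\<close>: \<open>C j\<close> is fixed first, against the earlier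
  combs; then \<open>N j\<close> makes the shift so small that comb \<open>j\<close> is negligible
  as a distribution and also at every earlier peak. The order is possible since
  \<open>gap_size\<close> and \<open>gap_moment\<close> are independent of \<open>N\<close>.\<close>

lemma exists_gap_parameters:
  obtains C :: "nat \<Rightarrow> real" and N :: "nat \<Rightarrow> nat" where
    "\<And>j. C j > 0" "\<And>j. N j \<ge> 1"
    "\<And>j. C j * gap_size j \<ge> exp (real j) + real j + (\<Sum>i<j. C i * (2 * comb_const (gap_K i)))"
    "\<And>j. C j * gap_moment j * comb.shift (gap_L j) (N j) * (1 + (\<Sum>i<j. peak_moment i (N i))) \<le> (1 / 2) ^ j"
proof -
  define P :: "(nat \<Rightarrow> real \<times> nat) \<Rightarrow> nat \<Rightarrow> real \<times> nat \<Rightarrow> bool" where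
    "P f j r \<longleftrightarrow> fst r > 0 \<and> snd r \<ge> 1 \<and>
       fst r * gap_size j \<ge> exp (real j) + real j + (\<Sum>i<j. fst (f i) * (2 * comb_const (gap_K i))) \<and>
       fst r * gap_moment j * comb.shift (gap_L j) (snd r) * (1 + (\<Sum>i<j. peak_moment i (snd (f i)))) \<le> (1 / 2) ^ j" for f j r
  have "\<exists>f. \<forall>j. P f j (f j)"
  proof (rule dependent_wellorder_choice)
    fix r :: "real \<times> nat" and f g :: "nat \<Rightarrow> real \<times> nat" and x
    assume "\<And>y. y < x \<Longrightarrow> f y = g y"
    then have "(\<Sum>i<x. fst (f i) * (2 * comb_const (gap_K i))) = (\<Sum>i<x. fst (g i) * (2 * comb_const (gap_K i)))"
      "(\<Sum>i<x. peak_moment i (snd (f i))) = (\<Sum>i<x. peak_moment i (snd (g i)))" by auto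
    then show "P f x r = P g x r" unfolding P_def by (simp only:)
  next
    fix j and f :: "nat \<Rightarrow> real \<times> nat"
    define B where "B = exp (real j) + real j + (\<Sum>i<j. fst (f i) * (2 * comb_const (gap_K i)))"
    define Q where "Q = 1 + (\<Sum>i<j. peak_moment i (snd (f i)))"
    define c where "c = \<bar>B\<bar> / gap_size j + 1"
    have c: "c > 0" using gap_size_pos[of j] by (simp add: c_def add_nonneg_pos)
    have "c * gap_size j = \<bar>B\<bar> + gap_size j" using gap_size_pos[of j] by (simp add: c_def field_simps)
    then have cB: "c * gap_size j \<ge> B" using gap_size_pos[of j] by linarith
    \<comment> \<open>The value taken is \<open>n + 1\<close>, which is at least 1 and makes the
      inverse of the shift exceed \<open>real n\<close>.\<close>
    obtain n where n: "c * gap_moment j * Q * 2 ^ j \<le> real n" using real_arch_simple by blast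
    define L where "L = gap_L j"
    have L: "L > 0" using gap_L_ge[of j] by (simp add: L_def)
    have "real n \<le> L * (2 * real (n + 1) + 1)"
    proof -
      have "1 * real n \<le> L * (2 * real (n + 1) + 1)" using gap_L_ge[of j] by (intro mult_mono) (auto simp: L_def)
      then show ?thesis by simp
    qed
    then have "c * gap_moment j * Q * 2 ^ j \<le> L * (2 * real (n + 1) + 1)" using n by linarith
    moreover have "L * (2 * real (n + 1) + 1) > 0" using L by (intro mult_pos_pos) auto
    ultimately have "c * gap_moment j * (1 / (L * (2 * real (n + 1) + 1))) * Q \<le> (1 / 2) ^ j"
      by (simp add: power_one_over field_simps)
    then have "c * gap_moment j * comb.shift (gap_L j) (n + 1) * Q \<le> (1 / 2) ^ j"
      using comb.shift_def[OF comb_gap, of "n + 1" j] by (simp only: L_def)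
    then have "P f j (c, n + 1)" using c cB unfolding P_def B_def Q_def by simp
    then show "\<exists>r. P f j r" by blast
  qed
  then obtain f where f: "\<And>j. P f j (f j)" by blast
  show thesis
    by (rule that[of "\<lambda>j. fst (f j)" "\<lambda>j. snd (f j)"]) (use f in \<open>simp_all add: P_def\<close>)
qed

text \<open>By relative density every point is carried into a fixed ball by a translation that
  changes the value by less than 1, and on the ball continuity gives a bound.\<close>

lemma almost_periodic_imp_bounded:
  assumes "almost_periodic g"
  shows "bounded (range g)"
proof -
  have cont: "continuous_on UNIV g"
    using assms by (simp add: almost_periodic_def)
  have "relatively_dense {\<tau>. (SUP x. ennreal (norm (g (x + \<tau>) - g x))) < ennreal 1}"
    using assms[unfolded almost_periodic_def, THEN conjunct2, THEN spec, of 1] zero_less_one by (rule mp)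
  then obtain R where R: "\<And>x. {\<tau>. (SUP x. ennreal (norm (g (x + \<tau>) - g x))) < ennreal 1} \<inter> ball x R \<noteq> {}"
    unfolding relatively_dense_def by blast
  have "compact (g ` cball 0 R)"
    by (intro compact_continuous_image continuous_on_subset[OF cont]) auto
  then have "bounded (g ` cball 0 R)" by (rule compact_imp_bounded)
  then obtain B where B: "\<And>y. y \<in> g ` cball 0 R \<Longrightarrow> norm y \<le> B" unfolding bounded_iff by blast
  have "norm (g x) \<le> B + 1" for x
  proof -
    obtain \<tau> where \<tau>: "(SUP x. ennreal (norm (g (x + \<tau>) - g x))) < ennreal 1" "\<tau> \<in> ball (- x) R"
      using R[of "- x"] by blast
    have "ennreal (norm (g (x + \<tau>) - g x)) \<le> (SUP x. ennreal (norm (g (x + \<tau>) - g x)))"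
      by (rule SUP_upper) simp
    then have "ennreal (norm (g (x + \<tau>) - g x)) < ennreal 1" using \<tau>(1) by (rule le_less_trans)
    then have "norm (g (x + \<tau>) - g x) < 1" by (simp add: ennreal_less_iff)
    moreover have "x + \<tau> \<in> cball 0 R" using \<tau>(2) by (simp add: dist_real_def abs_minus_commute)
    then have "norm (g (x + \<tau>)) \<le> B" by (intro B) auto
    moreover have "norm (g x) \<le> norm (g (x + \<tau>)) + norm (g (x + \<tau>) - g x)"
      using norm_triangle_sub[of "g x" "g (x + \<tau>)"] by (simp add: norm_minus_commute)
    ultimately show ?thesis by linarith
  qed
  then show ?thesis by (auto simp: bounded_iff)
qed

text \<open>Compares with the term of index \<open>n + 1\<close> of the exponential series. The base
  \<open>3 * real j + 2\<close> bounds \<open>1 + \<bar>y\<bar>\<close> at the j-th tested frequency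
  \<open>y\<close>.\<close>

lemma exp_not_polynomially_bounded:
  assumes "\<And>j::nat. exp (real j) \<le> D * (3 * real j + 2) ^ n"
  shows False
proof -
  obtain j :: nat where j: "real j > max 1 (\<bar>D\<bar> * fact (n + 1) * 5 ^ n)" using reals_Archimedean2 by blast
  then have j1: "real j > 1" by simp
  have "exp (- 1 / (1 / real j)) \<le> fact (n + 1) * (1 / real j) ^ (n + 1)"
    using j1 by (intro exp_minus_inverse_le) auto
  then have "real j ^ (n + 1) \<le> fact (n + 1) * exp (real j)"
    using j1 by (simp add: exp_minus power_one_over field_simps del: fact_Suc power_Suc)
  also have "\<dots> \<le> fact (n + 1) * (\<bar>D\<bar> * (5 * real j) ^ n)"
  proof (rule mult_left_mono)
    have "exp (real j) \<le> D * (3 * real j + 2) ^ n" by (rule assms)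
    also have "\<dots> \<le> \<bar>D\<bar> * (5 * real j) ^ n" using j1 by (intro mult_mono power_mono) auto
    finally show "exp (real j) \<le> \<bar>D\<bar> * (5 * real j) ^ n" .
  qed simp
  also have "\<dots> = (\<bar>D\<bar> * fact (n + 1) * 5 ^ n) * real j ^ n" by (simp add: power_mult_distrib mult_ac del: fact_Suc)
  finally have "real j * real j ^ n \<le> (\<bar>D\<bar> * fact (n + 1) * 5 ^ n) * real j ^ n" by simp
  then have "real j \<le> \<bar>D\<bar> * fact (n + 1) * 5 ^ n" using j1 by (subst (asm) mult_le_cancel_right) auto
  then show False using j by simp
qed

lemma norm_add_add_ge:
  fixes a b c :: "'a::real_normed_vector"
  shows "norm c - norm b - norm a \<le> norm (a + (b + c))"
proof -
  have "norm ((a + (b + c)) - (a + b)) \<le> norm (a + (b + c)) + norm (a + b)" by (rule norm_triangle_ineq4)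
  then show ?thesis using norm_triangle_ineq[of a b] by simp
qed

text \<open>In \<open>C_large\<close>, \<open>exp (real j)\<close> and \<open>real j\<close> are the
  growth wanted for the variation and for the convolution, and the sum outweighs the earlier combs.
  In \<open>shift_small\<close> the summand 1 yields convergence, and the sum makes comb
  \<open>j\<close> small at the peaks of its predecessors.\<close>

locale comb_sum =
  fixes C :: "nat \<Rightarrow> real" and N :: "nat \<Rightarrow> nat"
  assumes C_pos: "\<And>j. C j > 0" and N_ge: "\<And>j. N j \<ge> 1"
    and C_large: "\<And>j. C j * gap_size j \<ge> exp (real j) + real j + (\<Sum>i<j. C i * (2 * comb_const (gap_K i)))"
    and shift_small: "\<And>j. C j * gap_moment j * comb.shift (gap_L j) (N j) * (1 + (\<Sum>i<j. peak_moment i (N i))) \<le> (1 / 2) ^ j"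
begin

abbreviation \<tau> :: "nat \<Rightarrow> (real \<Rightarrow> complex) \<Rightarrow> complex" where
  "\<tau> j \<equiv> comb.comb_dist (gap_L j) (gap_K j) (N j)"

abbreviation \<epsilon> :: "nat \<Rightarrow> real" where
  "\<epsilon> j \<equiv> comb.shift (gap_L j) (N j)"

definition \<mu> :: "(real \<Rightarrow> complex) \<Rightarrow> complex" where
  "\<mu> \<phi> = (\<Sum>j. of_real (C j) * \<tau> j \<phi>)"

section \<open>The sum as a tempered distribution\<close>

lemma comb_j: "comb (gap_L j) (N j)"
  by (rule comb_gap[OF N_ge])

lemma term_bound:
  assumes "\<And>x. \<bar>x\<bar> ^ 3 * norm (\<phi> x) \<le> Q"
  shows "norm (of_real (C j) * \<tau> j \<phi>) \<le> C j * gap_moment j * \<epsilon> j * Q"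
proof -
  have "norm (\<tau> j \<phi>) \<le> gap_moment j * \<epsilon> j * Q"
    using comb.norm_comb_dist_le[OF comb_j assms] by (simp add: gap_moment_def)
  then have "C j * norm (\<tau> j \<phi>) \<le> C j * (gap_moment j * \<epsilon> j * Q)"
    using C_pos[of j] by (intro mult_left_mono) auto
  then show ?thesis using C_pos[of j] by (simp add: norm_mult)
qed

lemma coeff_nonneg: "C j * gap_moment j * \<epsilon> j \<ge> 0"
  using C_pos[of j] gap_moment_nonneg[of j] comb.shift_pos[OF comb_j, of j] by simp

lemma term_bound_geometric:
  assumes "\<And>x. \<bar>x\<bar> ^ 3 * norm (\<phi> x) \<le> Q"
  shows "norm (of_real (C j) * \<tau> j \<phi>) \<le> Q * (1 / 2) ^ j"
proof -
  have Q: "Q \<ge> 0" using assms[of 0] by simp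
  have "C j * gap_moment j * \<epsilon> j * 1 \<le> C j * gap_moment j * \<epsilon> j * (1 + (\<Sum>i<j. peak_moment i (N i)))"
    using coeff_nonneg peak_moment_nonneg by (intro mult_left_mono) (auto intro!: sum_nonneg)
  also have "\<dots> \<le> (1 / 2) ^ j" by (rule shift_small)
  finally have "C j * gap_moment j * \<epsilon> j * Q \<le> (1 / 2) ^ j * Q" using Q by (intro mult_right_mono) auto
  then show ?thesis using term_bound[OF assms, of j] by (simp add: mult.commute)
qed

lemma summable_terms:
  assumes "\<And>x. \<bar>x\<bar> ^ 3 * norm (\<phi> x) \<le> Q"
  shows "summable (\<lambda>j. of_real (C j) * \<tau> j \<phi>)"
proof (rule summable_comparison_test'[where N = 0])
  show "summable (\<lambda>j. Q * (1 / 2) ^ j)" by (intro summable_mult summable_geometric) simp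
qed (rule term_bound_geometric[OF assms])

lemma norm_\<mu>_le:
  assumes "\<And>x. \<bar>x\<bar> ^ 3 * norm (\<phi> x) \<le> Q"
  shows "norm (\<mu> \<phi>) \<le> 2 * Q"
proof -
  have s: "summable (\<lambda>j. Q * (1 / 2) ^ j)" by (intro summable_mult summable_geometric) simp
  have "norm (\<mu> \<phi>) \<le> (\<Sum>j. Q * (1 / 2) ^ j)"
    unfolding \<mu>_def by (rule norm_suminf_le) (use s term_bound_geometric[OF assms] in auto)
  also have "\<dots> = 2 * Q" by (subst suminf_mult) (auto simp: suminf_geometric)
  finally show ?thesis .
qed

lemma \<mu>_add:
  assumes "\<And>x. \<bar>x\<bar> ^ 3 * norm (\<phi> x) \<le> Q" "\<And>x. \<bar>x\<bar> ^ 3 * norm (\<psi> x) \<le> Q'"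
  shows "\<mu> (\<lambda>x. \<phi> x + \<psi> x) = \<mu> \<phi> + \<mu> \<psi>"
  unfolding \<mu>_def comb.comb_dist_add[OF comb_j assms] distrib_left
  by (rule suminf_add[symmetric, OF summable_terms[OF assms(1)] summable_terms[OF assms(2)]])

lemma \<mu>_cmult:
  assumes "\<And>x. \<bar>x\<bar> ^ 3 * norm (\<phi> x) \<le> Q"
  shows "\<mu> (\<lambda>x. c * \<phi> x) = c * \<mu> \<phi>"
  unfolding \<mu>_def comb.comb_dist_cmult[OF comb_j] mult.left_commute[of _ c]
  by (rule suminf_mult[OF summable_terms[OF assms]])

lemma schwartz_moment:
  assumes "\<phi> \<in> schwartz"
  obtains Q where "\<And>x. \<bar>x\<bar> ^ 3 * norm (\<phi> x) \<le> Q"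
proof -
  have "bounded (range (\<lambda>x. x ^ 3 *\<^sub>R vderivs 0 \<phi> x))" using assms unfolding schwartz_def by blast
  then show thesis using that by (auto simp: bounded_iff power_abs)
qed

lemma tempered_\<mu>: "tempered_distribution \<mu>"
  unfolding tempered_distribution_def
proof (intro conjI ballI allI impI)
  fix \<phi> \<psi> assume "\<phi> \<in> schwartz" "\<psi> \<in> schwartz"
  then obtain Q Q' where "\<And>x. \<bar>x\<bar> ^ 3 * norm (\<phi> x) \<le> Q" "\<And>x. \<bar>x\<bar> ^ 3 * norm (\<psi> x) \<le> Q'"
    by (metis schwartz_moment)
  then show "\<mu> (\<lambda>x. \<phi> x + \<psi> x) = \<mu> \<phi> + \<mu> \<psi>" by (rule \<mu>_add)
next
  fix c \<phi> assume "\<phi> \<in> schwartz"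
  then obtain Q where "\<And>x. \<bar>x\<bar> ^ 3 * norm (\<phi> x) \<le> Q" by (metis schwartz_moment)
  then show "\<mu> (\<lambda>x. c * \<phi> x) = c * \<mu> \<phi>" by (rule \<mu>_cmult)
next
  fix \<phi> and e :: real assume \<phi>: "\<phi> \<in> schwartz" and e: "e > 0"
  obtain Q where Q: "\<And>x. \<bar>x\<bar> ^ 3 * norm (\<phi> x) \<le> Q" using schwartz_moment[OF \<phi>] by blast
  have "norm (\<mu> \<psi> - \<mu> \<phi>) < e" if \<psi>: "\<psi> \<in> schwartz"
    and s: "\<forall>k\<le>3. \<forall>n\<le>3. schwartz_seminorm k n (\<lambda>x. \<psi> x - \<phi> x) < e / 3" for \<psi>
  proof -
    obtain Q' where Q': "\<And>x. \<bar>x\<bar> ^ 3 * norm (\<psi> x) \<le> Q'" using schwartz_moment[OF \<psi>] by blast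
    let ?d = "\<lambda>x. \<psi> x - \<phi> x"
    have d: "\<bar>x\<bar> ^ 3 * norm (?d x) \<le> Q + Q'" for x
    proof -
      have "\<bar>x\<bar> ^ 3 * norm (?d x) \<le> \<bar>x\<bar> ^ 3 * (norm (\<psi> x) + norm (\<phi> x))"
        by (intro mult_left_mono norm_triangle_ineq4) auto
      then show ?thesis using Q[of x] Q'[of x] by (simp add: distrib_left)
    qed
    have "\<bar>x\<bar> ^ 3 * norm (?d x) \<le> schwartz_seminorm 3 0 ?d" for x
    proof -
      have "norm (x ^ 3 *\<^sub>R vderivs 0 ?d x) \<le> schwartz_seminorm 3 0 ?d"
        unfolding schwartz_seminorm_def
        by (rule cSUP_upper) (use d in \<open>auto intro!: bdd_aboveI[of _ "Q + Q'"] simp: power_abs\<close>)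
      then show ?thesis by (simp add: power_abs)
    qed
    then have "norm (\<mu> ?d) \<le> 2 * schwartz_seminorm 3 0 ?d" by (rule norm_\<mu>_le)
    also have "\<dots> < e" using s[rule_format, of 3 0] e by linarith
    finally have "norm (\<mu> ?d) < e" .
    moreover have "\<mu> (\<lambda>x. ?d x + \<phi> x) = \<mu> ?d + \<mu> \<phi>" by (rule \<mu>_add[OF d Q])
    ultimately show ?thesis by simp
  qed
  then show "\<exists>N. \<exists>\<delta>>0. \<forall>\<psi>\<in>schwartz. (\<forall>k\<le>N. \<forall>n\<le>N. schwartz_seminorm k n (\<lambda>x. \<psi> x - \<phi> x) < \<delta>) \<longrightarrow>
      norm (\<mu> \<psi> - \<mu> \<phi>) < e"
    \<comment> \<open>The seminorm with indices 3 and 0 controls \<open>\<mu>\<close> with the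
      constant 2, so the bound 3 on the indices and \<open>e / 3\<close> are enough.\<close>
    using e by (intro exI[of _ 3] exI[of _ "e / 3"]) auto
qed

section \<open>Local finiteness of the sum and of its Fourier transform\<close>

lemma \<mu>_finite:
  assumes "\<And>j. j \<ge> j0 \<Longrightarrow> \<tau> j \<phi> = 0"
  shows "\<mu> \<phi> = (\<Sum>j<j0. of_real (C j) * \<tau> j \<phi>)"
  unfolding \<mu>_def using assms by (intro suminf_finite) auto

text \<open>The points of comb \<open>j\<close> in period \<open>n\<close> have modulus at least
  \<open>(j + 1) * (1 + \<bar>n\<bar>)\<close>, which bounds both \<open>j\<close> and
  \<open>n\<close> over a bounded set. Triples serve as indices because points of different combs
  may coincide.\<close>

lemma \<mu>_given_by_measure:
  "\<exists>\<nu>. given_by_measure \<mu> \<nu> \<and> locally_finite (measure_support (variation \<nu>))"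
proof -
  let ?d = "\<lambda>j. gap_degree (gap_K j)"
  let ?pt = "\<lambda>j. comb.pt (gap_L j) (gap_K j)"
  let ?wt = "\<lambda>j. comb.wt (gap_L j) (gap_K j) (N j)"
  define I where "I = {(j, n :: int, l). l \<le> ?d j}"
  define s where "s = (\<lambda>(j, n, l). ?pt j n l)"
  define w where "w = (\<lambda>(j, n, l). of_real (C j) * ?wt j n l)"
  have s_ge: "(real j + 1) * (1 + \<bar>of_int n\<bar>) \<le> \<bar>?pt j n l\<bar>" if "l \<le> ?d j" for j n l
  proof -
    have "gap_L j / 8 = real j + 1" by (simp add: gap_L_def)
    then show ?thesis using comb.pt_ge[OF comb_j[of j] that, where n = n] by (simp only:)
  qed
  have s_j: "real j + 1 \<le> \<bar>?pt j n l\<bar>" and s_n: "1 + \<bar>of_int n\<bar> \<le> \<bar>?pt j n l\<bar>" if "l \<le> ?d j" for j n l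
  proof -
    have "(real j + 1) * 1 \<le> (real j + 1) * (1 + \<bar>of_int n\<bar>)" by (intro mult_left_mono) auto
    also have "\<dots> \<le> \<bar>?pt j n l\<bar>" by (rule s_ge[OF that])
    finally show "real j + 1 \<le> \<bar>?pt j n l\<bar>" by simp
    have "1 * (1 + \<bar>of_int n\<bar>) \<le> (real j + 1) * (1 + \<bar>of_int n :: real\<bar>)" by (intro mult_right_mono) auto
    also have "\<dots> \<le> \<bar>?pt j n l\<bar>" by (rule s_ge[OF that])
    finally show "1 + \<bar>of_int n\<bar> \<le> \<bar>?pt j n l\<bar>" by simp
  qed
  define box where "box M = (SIGMA j:{..<nat M}. {-M..M} \<times> {..?d j})" for M
  have fin_box: "finite (box M)" for M by (auto simp: box_def)
  have in_box: "i \<in> box M" if "i \<in> I" "\<bar>s i\<bar> \<le> r" "r \<le> of_int M" for i r M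
  proof -
    obtain j n l where i: "i = (j, n, l)" by (cases i)
    have l: "l \<le> ?d j" using that i by (simp add: I_def)
    have "\<bar>?pt j n l\<bar> \<le> of_int M" using that i by (simp add: s_def)
    then have "real j + 1 \<le> of_int M" "1 + \<bar>of_int n\<bar> \<le> (of_int M :: real)"
      using s_j[OF l, where n = n] s_n[OF l, where n = n] by linarith+
    then have "int j + 1 \<le> M" "1 + \<bar>n\<bar> \<le> M" by linarith+
    then show ?thesis using l i by (auto simp: box_def)
  qed
  show ?thesis
  proof (rule given_by_measure_indexed[where I = I and s = s and w = w])
    fix r
    show "finite {i \<in> I. \<bar>s i\<bar> \<le> r}"
      by (rule finite_subset[OF _ fin_box[of "\<lceil>r\<rceil>"]]) (auto intro: in_box)
  next
    fix \<phi> assume \<phi>: "\<phi> \<in> test_functions"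
    obtain r where r: "\<And>x. \<bar>x\<bar> > r \<Longrightarrow> \<phi> x = 0" "r \<ge> 0" using test_functions_bound[OF \<phi>] by blast
    define M where "M = \<lceil>r\<rceil>"
    have rM: "r \<le> of_int M" by (simp add: M_def)
    have "\<tau> j \<phi> = 0" if "j \<ge> nat M" for j
    proof (rule comb.comb_dist_eq_0[OF comb_j])
      fix x assume "gap_L j / 8 \<le> \<bar>x\<bar>"
      then have "real j + 1 \<le> \<bar>x\<bar>" by (simp add: gap_L_def)
      moreover have "of_int M \<le> real j" using that by linarith
      ultimately show "\<phi> x = 0" using rM by (intro r(1)) linarith
    qed
    then have "\<mu> \<phi> = (\<Sum>j<nat M. of_real (C j) * \<tau> j \<phi>)" by (rule \<mu>_finite)
    also have "\<dots> = (\<Sum>j<nat M. \<Sum>p\<in>{-M..M} \<times> {..?d j}. w (j, p) * \<phi> (s (j, p)))"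
    proof (rule sum.cong[OF refl])
      fix j
      have "of_real (C j) * \<tau> j \<phi> = (\<Sum>l\<le>?d j. \<Sum>n\<in>{-M..M}. w (j, n, l) * \<phi> (s (j, n, l)))"
        by (subst comb.comb_dist_finite[OF comb_j r(1) rM]) (auto simp: sum_distrib_left w_def s_def mult_ac)
      also have "\<dots> = (\<Sum>n\<in>{-M..M}. \<Sum>l\<le>?d j. w (j, n, l) * \<phi> (s (j, n, l)))" by (rule sum.swap)
      also have "\<dots> = (\<Sum>p\<in>{-M..M} \<times> {..?d j}. w (j, p) * \<phi> (s (j, p)))"
        by (simp add: sum.cartesian_product case_prod_unfold)
      finally show "of_real (C j) * \<tau> j \<phi> = (\<Sum>p\<in>{-M..M} \<times> {..?d j}. w (j, p) * \<phi> (s (j, p)))" .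
    qed
    also have "\<dots> = (\<Sum>i\<in>box M. w i * \<phi> (s i))"
      unfolding box_def by (subst sum.Sigma) (auto simp: case_prod_unfold)
    finally have "\<mu> \<phi> = (\<Sum>i\<in>box M. w i * \<phi> (s i))" .
    moreover have "box M \<subseteq> I" by (auto simp: box_def I_def)
    moreover have "\<phi> (s i) = 0" if "i \<in> I - box M" for i
    proof (rule r(1))
      show "r < \<bar>s i\<bar>" using in_box[of i r M] that rM not_le by blast
    qed
    ultimately show "\<exists>J. finite J \<and> J \<subseteq> I \<and> (\<forall>i\<in>I - J. \<phi> (s i) = 0) \<and> \<mu> \<phi> = (\<Sum>i\<in>J. w i * \<phi> (s i))"
      using fin_box by blast
  qed (rule test_functions_borel)
qed

lemma \<epsilon>_bounds: "\<epsilon> j > 0" "\<epsilon> j \<le> 1" "\<epsilon> j \<le> 1 / (3 * gap_L j)"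
proof -
  show "\<epsilon> j > 0" by (rule comb.shift_pos[OF comb_j])
  show le: "\<epsilon> j \<le> 1 / (3 * gap_L j)" by (rule comb.shift_le[OF comb_j])
  have "1 / (3 * gap_L j) \<le> 1 / 1" using gap_L_ge[of j] by (intro divide_left_mono) auto
  then show "\<epsilon> j \<le> 1" using le by simp
qed

lemma fourier_\<mu>_given_by_measure:
  "\<exists>\<nu>. given_by_measure (fourier_dist \<mu>) \<nu> \<and> locally_finite (measure_support (variation \<nu>))"
proof -
  let ?L = gap_L
  let ?c = "\<lambda>j. comb.freq_wt (gap_L j) (gap_K j)"
  \<comment> \<open>Indices inside the spectral gap have weight 0, but they must be left out: every
    comb has such frequencies near 0, which would spoil finiteness over bounded sets. The Boolean
    tells the shifted atom from its negative partner.\<close>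
  define I where "I = {(j, m, b :: bool). int (gap_K j) < \<bar>m\<bar>}"
  define s where "s = (\<lambda>(j, m, b). of_int m / ?L j + (if b then \<epsilon> j else 0))"
  define w where "w = (\<lambda>(j, m, b). of_real (C j) * ?c j m * (if b then 1 else - 1))"
  define box where "box r = (SIGMA j:{..<nat \<lceil>r + 2\<rceil>}. {m. int (gap_K j) < \<bar>m\<bar> \<and> \<bar>m\<bar> \<le> \<lceil>(r + 1) * ?L j\<rceil>} \<times> (UNIV :: bool set))" for r
  have fin: "finite {m. k < \<bar>m\<bar> \<and> \<bar>m\<bar> \<le> k'}" for k k' :: int
    by (rule finite_subset[of _ "{-k'..k'}"]) auto
  have fin_box: "finite (box r)" for r
    unfolding box_def by (intro finite_SigmaI finite_cartesian_product fin) auto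
  have Lpos: "?L j > 0" for j using gap_L_ge[of j] by linarith
  have in_box: "i \<in> box r" if "i \<in> I" "\<bar>s i\<bar> \<le> r" for i r
  proof -
    obtain j m b where i: "i = (j, m, b)" by (cases i)
    have m: "int (gap_K j) < \<bar>m\<bar>" using that i by (simp add: I_def)
    have "\<bar>of_int m / ?L j + (if b then \<epsilon> j else 0)\<bar> \<le> r" using that i by (simp add: s_def)
    then have le: "\<bar>of_int m\<bar> / ?L j \<le> r + 1" using \<epsilon>_bounds[of j] Lpos[of j] by (auto split: if_splits)
    then have mr: "\<bar>of_int m\<bar> \<le> (r + 1) * ?L j" using Lpos[of j] by (simp add: pos_divide_le_eq)
    have "real (gap_K j) \<le> \<bar>of_int m\<bar>" using m by linarith
    then have "real (gap_K j) / ?L j \<le> r + 1" using le Lpos[of j] divide_right_mono[of "real (gap_K j)" "\<bar>of_int m\<bar>" "?L j"] by linarith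
    then have "3 * real j \<le> r + 1" by (simp add: gap_K_div_L)
    then have "real j < r + 2" by linarith
    then have "j < nat \<lceil>r + 2\<rceil>" by linarith
    moreover have "\<bar>m\<bar> \<le> \<lceil>(r + 1) * ?L j\<rceil>" using mr by linarith
    ultimately show ?thesis using m i by (simp add: box_def)
  qed
  show ?thesis
  proof (rule given_by_measure_indexed[where I = I and s = s and w = w])
    fix r
    show "finite {i \<in> I. \<bar>s i\<bar> \<le> r}"
      by (rule finite_subset[OF _ fin_box[of r]]) (auto intro: in_box)
  next
    fix \<phi> assume \<phi>: "\<phi> \<in> test_functions"
    obtain r where r: "\<And>x. \<bar>x\<bar> > r \<Longrightarrow> \<phi> x = 0" "r \<ge> 0" using test_functions_bound[OF \<phi>] by blast
    let ?j0 = "nat \<lceil>r + 2\<rceil>"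
    let ?A = "\<lambda>j. {m. int (gap_K j) < \<bar>m\<bar> \<and> \<bar>m\<bar> \<le> \<lceil>(r + 1) * ?L j\<rceil>}"
    have "\<tau> j (fourier \<phi>) = 0" if "j \<ge> ?j0" for j
    proof (rule comb.comb_dist_fourier_eq_0[OF comb_j \<phi>])
      fix x assume "real (gap_K j) / ?L j - 1 \<le> \<bar>x\<bar>"
      then have "3 * real j - 1 \<le> \<bar>x\<bar>" by (simp add: gap_K_div_L)
      moreover have "r + 2 \<le> real j" using that by linarith
      ultimately show "\<phi> x = 0" using r(2) by (intro r(1)) linarith
    qed
    then have "\<mu> (fourier \<phi>) = (\<Sum>j<?j0. of_real (C j) * \<tau> j (fourier \<phi>))" by (rule \<mu>_finite)
    also have "\<dots> = (\<Sum>j<?j0. \<Sum>p\<in>?A j \<times> UNIV. w (j, p) * \<phi> (s (j, p)))"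
    proof (rule sum.cong[OF refl])
      fix j
      define M where "M = \<lceil>(r + 1) * ?L j\<rceil>"
      have big: "\<bar>of_int m / ?L j\<bar> > r + 1" if "m \<notin> {-M..M}" for m
      proof -
        have "M < \<bar>m\<bar>" using that by auto
        then have "(r + 1) * ?L j < \<bar>of_int m\<bar>" unfolding M_def by linarith
        then show ?thesis using Lpos[of j] by (simp add: field_simps)
      qed
      have "\<tau> j (fourier \<phi>) = (\<Sum>m\<in>{-M..M}. ?c j m * (\<phi> (of_int m / ?L j + \<epsilon> j) - \<phi> (of_int m / ?L j)))"
      proof (rule comb.comb_dist_fourier[OF comb_j \<phi>])
        fix m assume m: "m \<notin> {-M..M}"
        show "\<phi> (of_int m / ?L j) = 0" using big[OF m] by (intro r(1)) linarith
        show "\<phi> (of_int m / ?L j + \<epsilon> j) = 0" using big[OF m] \<epsilon>_bounds[of j] by (intro r(1)) linarith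
      qed simp
      also have "\<dots> = (\<Sum>m\<in>?A j. ?c j m * (\<phi> (of_int m / ?L j + \<epsilon> j) - \<phi> (of_int m / ?L j)))"
      proof (rule sum.mono_neutral_right)
        show "\<forall>m\<in>{-M..M} - ?A j. ?c j m * (\<phi> (of_int m / ?L j + \<epsilon> j) - \<phi> (of_int m / ?L j)) = 0"
        proof
          fix m assume "m \<in> {-M..M} - ?A j"
          then have "\<bar>m\<bar> \<le> int (gap_K j)" by (auto simp: M_def)
          then show "?c j m * (\<phi> (of_int m / ?L j + \<epsilon> j) - \<phi> (of_int m / ?L j)) = 0"
            by (simp add: comb.freq_wt_eq_0[OF comb_j[of j]])
        qed
      qed (auto simp: M_def)
      finally have "of_real (C j) * \<tau> j (fourier \<phi>) = (\<Sum>m\<in>?A j. \<Sum>b\<in>UNIV. w (j, m, b) * \<phi> (s (j, m, b)))"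
        by (simp add: sum_distrib_left w_def s_def UNIV_bool algebra_simps)
      also have "\<dots> = (\<Sum>p\<in>?A j \<times> UNIV. w (j, p) * \<phi> (s (j, p)))"
        by (simp add: sum.cartesian_product case_prod_unfold)
      finally show "of_real (C j) * \<tau> j (fourier \<phi>) = (\<Sum>p\<in>?A j \<times> UNIV. w (j, p) * \<phi> (s (j, p)))" .
    qed
    also have "\<dots> = (\<Sum>i\<in>box r. w i * \<phi> (s i))"
      unfolding box_def by (subst sum.Sigma) (auto simp: case_prod_unfold intro!: fin)
    finally have "fourier_dist \<mu> \<phi> = (\<Sum>i\<in>box r. w i * \<phi> (s i))" by (simp add: fourier_dist_def)
    moreover have "box r \<subseteq> I" by (auto simp: box_def I_def)
    moreover have "\<phi> (s i) = 0" if "i \<in> I - box r" for i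
    proof (rule r(1))
      show "r < \<bar>s i\<bar>" using in_box[of i r] that not_le by blast
    qed
    ultimately show "\<exists>J. finite J \<and> J \<subseteq> I \<and> (\<forall>i\<in>I - J. \<phi> (s i) = 0) \<and> fourier_dist \<mu> \<phi> = (\<Sum>i\<in>J. w i * \<phi> (s i))"
      using fin_box by blast
  qed (rule test_functions_borel)
qed

lemma crystalline_\<mu>: "crystalline_measure \<mu>"
  using tempered_\<mu> \<mu>_given_by_measure fourier_\<mu>_given_by_measure
  unfolding crystalline_measure_def by blast

section \<open>Unbounded convolution and failure of the quasicrystal property\<close>

lemma norm_earlier_terms_le:
  assumes "\<And>i. i < j \<Longrightarrow> norm (\<tau> i \<phi>) \<le> 2 * comb_const (gap_K i)"
  shows "norm (\<Sum>i<j. of_real (C i) * \<tau> i \<phi>) \<le> (\<Sum>i<j. C i * (2 * comb_const (gap_K i)))"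
  using C_pos assms by (intro order_trans[OF norm_sum] sum_mono) (auto simp: norm_mult abs_of_pos intro!: mult_left_mono less_imp_le)

text \<open>At the peak of comb \<open>j\<close> its own term exceeds the sum of the earlier ones by
  at least \<open>j\<close>. The later terms add up to at most 2, because their smallness was
  prescribed in terms of the moment of this very peak.\<close>

lemma unbounded_conv: "\<not> bounded (range (dist_conv \<mu> (\<lambda>x. complex_of_real (bump x))))"
proof
  assume "bounded (range (dist_conv \<mu> (\<lambda>x. complex_of_real (bump x))))"
  then obtain b where b: "\<And>t. norm (dist_conv \<mu> (\<lambda>x. complex_of_real (bump x)) t) \<le> b"
    by (auto simp: bounded_iff)
  have large: "norm (dist_conv \<mu> (\<lambda>x. complex_of_real (bump x)) (gap_peak j (N j))) \<ge> real j - 2" for j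
  proof -
    let ?\<phi> = "\<lambda>s. complex_of_real (bump (gap_peak j (N j) - s))"
    let ?f = "\<lambda>i. of_real (C i) * \<tau> i ?\<phi>"
    have sm: "summable ?f" by (rule summable_terms[OF peak_moment])
    have tail: "norm (?f (i + Suc j)) \<le> (1 / 2) ^ i" for i
    proof -
      let ?i = "i + Suc j"
      have "norm (?f ?i) \<le> C ?i * gap_moment ?i * \<epsilon> ?i * peak_moment j (N j)"
        by (rule term_bound[OF peak_moment])
      also have "\<dots> \<le> C ?i * gap_moment ?i * \<epsilon> ?i * (1 + (\<Sum>i<?i. peak_moment i (N i)))"
      proof (intro mult_left_mono coeff_nonneg)
        have "peak_moment j (N j) \<le> (\<Sum>i<?i. peak_moment i (N i))"
          using peak_moment_nonneg by (intro member_le_sum) auto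
        then show "peak_moment j (N j) \<le> 1 + (\<Sum>i<?i. peak_moment i (N i))" by simp
      qed
      also have "\<dots> \<le> (1 / 2) ^ ?i" by (rule shift_small)
      also have "\<dots> \<le> (1 / 2) ^ i" by (rule power_decreasing) auto
      finally show ?thesis .
    qed
    have "norm (\<Sum>i. ?f (i + Suc j)) \<le> (\<Sum>i. (1 / 2) ^ i)"
      by (rule norm_suminf_le) (use tail in \<open>auto intro: summable_geometric\<close>)
    also have "\<dots> = (2 :: real)" by (subst suminf_geometric) auto
    finally have t2: "norm (\<Sum>i. ?f (i + Suc j)) \<le> 2" .
    have e: "norm (\<Sum>i<j. ?f i) \<le> (\<Sum>i<j. C i * (2 * comb_const (gap_K i)))"
    proof (rule norm_earlier_terms_le)
      fix i
      have "norm (\<tau> i ?\<phi>) \<le> 2 * comb_const (gap_K i) * bump 0" by (rule comb.norm_comb_conv_bump_le[OF comb_j])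
      also have "\<dots> \<le> 2 * comb_const (gap_K i) * 1" using comb_const_nonneg by (intro mult_left_mono) (auto simp: bump_def)
      finally show "norm (\<tau> i ?\<phi>) \<le> 2 * comb_const (gap_K i)" by simp
    qed
    have "norm (\<tau> j ?\<phi>) = 2 * bump (1 - comb.spacing (gap_L j) (gap_K j))"
      unfolding gap_peak_def by (rule comb.comb_conv_bump_large[OF comb_j])
    then have "gap_size j \<le> norm (\<tau> j ?\<phi>)" by (simp add: gap_size_def)
    then have "C j * gap_size j \<le> norm (?f j)" using C_pos[of j] by (simp add: norm_mult)
    then have m: "norm (?f j) \<ge> real j + (\<Sum>i<j. C i * (2 * comb_const (gap_K i)))"
      using C_large[of j] exp_ge_zero[of "real j"] by linarith
    have "\<mu> ?\<phi> = (\<Sum>i. ?f (i + Suc j)) + (\<Sum>i<Suc j. ?f i)"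
      unfolding \<mu>_def by (rule suminf_split_initial_segment[OF sm])
    then have "\<mu> ?\<phi> = (\<Sum>i. ?f (i + Suc j)) + ((\<Sum>i<j. ?f i) + ?f j)" by simp
    then have "norm (\<mu> ?\<phi>) \<ge> norm (?f j) - norm (\<Sum>i<j. ?f i) - norm (\<Sum>i. ?f (i + Suc j))"
      by (simp only: norm_add_add_ge)
    then have "norm (\<mu> ?\<phi>) \<ge> real j - 2" using e m t2 by linarith
    then show ?thesis by (simp add: dist_conv_def)
  qed
  obtain j :: nat where "real j > b + 2" using reals_Archimedean2 by blast
  then show False using large[of j] b[of "gap_peak j (N j)"] by linarith
qed

text \<open>A function of radius \<open>\<epsilon> j\<close> at the first frequency beyond the gap
  of comb \<open>j\<close> isolates one atom of a pair. Later combs vanish on it by their gaps and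
  the earlier ones are outweighed, so the pairing is at least \<open>exp (real j)\<close>. Up to a
  constant factor the function lies below a translate of a fixed bump, whose integral against a
  tempered variation grows only polynomially in \<open>j\<close>. Here \<open>\<nu>\<close> is any
  measure representing the transform, not the one constructed above.\<close>

lemma not_fourier_quasicrystal: "\<not> fourier_quasicrystal \<mu>"
proof
  assume "fourier_quasicrystal \<mu>"
  then obtain \<nu> where \<nu>: "given_by_measure (fourier_dist \<mu>) \<nu>" "locally_finite (measure_support (variation \<nu>))"
    "tempered_measure (variation \<nu>)"
    unfolding fourier_quasicrystal_def by blast
  from \<nu>(3)[unfolded tempered_measure_def] obtain f where f: "tempered_distribution f"
    "\<And>\<phi>. \<phi> \<in> test_functions \<Longrightarrow> f \<phi> = (LINT x|variation \<nu>. \<phi> x)"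
    by (elim exE conjE) (simp only:)
  obtain D n where D: "\<And>a. norm (f (\<lambda>x. complex_of_real (bump (x - a)))) \<le> D * (1 + \<bar>a\<bar>) ^ n"
    using tempered_distribution_bump_bound[OF f(1)] by blast
  have cm: "complex_measure \<nu>" using \<nu>(1) by (simp add: given_by_measure_def)
  have bump0: "bump 0 > 0" by (simp add: bump_pos)
  have "exp (real j) \<le> (\<bar>D\<bar> / bump 0) * (3 * real j + 2) ^ n" for j
  proof -
    define y where "y = (real (gap_K j) + 1) / gap_L j"
    have Lpos: "gap_L j > 0" using gap_L_ge[of j] by linarith
    have y: "0 \<le> y" "y \<le> 3 * real j + 1"
    proof -
      have "y = 3 * real j + 1 / gap_L j" by (simp add: y_def add_divide_distrib gap_K_div_L)
      moreover have "1 / gap_L j \<le> 1" "0 \<le> 1 / gap_L j" using gap_L_ge[of j] by auto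
      ultimately show "0 \<le> y" "y \<le> 3 * real j + 1" by linarith+
    qed
    \<comment> \<open>Value 1 at \<open>y\<close> and radius \<open>\<epsilon> j\<close>, just small
      enough to exclude the partner atom at \<open>y + \<epsilon> j\<close>.\<close>
    define \<psi> where "\<psi> x = bump ((1 / \<epsilon> j) * x + (- y / \<epsilon> j)) / bump 0" for x
    have \<psi>': "complex_of_real (\<psi> x) = (1 / of_real (bump 0)) * complex_of_real (bump ((1 / \<epsilon> j) * x + (- y / \<epsilon> j)))" for x
      by (simp add: \<psi>_def)
    have \<psi>_test: "(\<lambda>x. complex_of_real (\<psi> x)) \<in> test_functions"
      unfolding \<psi>' using \<epsilon>_bounds[of j] by (intro bump_affine_test_function) auto
    have \<psi>_eq: "\<psi> x = bump ((x - y) / \<epsilon> j) / bump 0" for x by (simp add: \<psi>_def diff_divide_distrib)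
    have \<psi>_supp: "complex_of_real (\<psi> x) = 0" if "\<epsilon> j \<le> \<bar>x - y\<bar>" for x
    proof -
      have "\<bar>(x - y) / \<epsilon> j\<bar> \<ge> 1" using that \<epsilon>_bounds[of j] by (simp add: le_divide_eq)
      then show ?thesis by (simp add: \<psi>_eq bump_eq_0)
    qed
    \<comment> \<open>Since \<open>\<epsilon> j \<le> 1\<close>, the dilation only narrows a bump
      that decreases away from its centre.\<close>
    have \<psi>_le: "\<psi> x \<le> bump (x - y) / bump 0" for x
    proof -
      have "\<bar>x - y\<bar> \<le> \<bar>(x - y) / \<epsilon> j\<bar>"
        using \<epsilon>_bounds[of j] by (simp add: le_divide_eq mult_left_le)
      then show ?thesis unfolding \<psi>_eq using bump0 by (intro divide_right_mono bump_decreasing) auto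
    qed
    have \<psi>_ge0: "\<psi> x \<ge> 0" for x using bump_nonneg bump0 by (simp add: \<psi>_eq)
    have \<psi>_le1: "norm (complex_of_real (\<psi> x)) \<le> 1" for x
    proof -
      have "\<psi> x \<le> 1" unfolding \<psi>_eq using bump_le bump0 by simp
      then show ?thesis using \<psi>_ge0[of x] by (simp only: norm_of_real abs_of_nonneg)
    qed
    let ?\<phi> = "\<lambda>x. complex_of_real (\<psi> x)"
    let ?t = "\<lambda>i. \<tau> i (fourier ?\<phi>)"
    have "?t i = 0" if "i \<ge> Suc j" for i
    proof (rule comb.comb_dist_fourier_eq_0[OF comb_j \<psi>_test])
      fix x assume "real (gap_K i) / gap_L i - 1 \<le> \<bar>x\<bar>"
      then have "3 * real i - 1 \<le> \<bar>x\<bar>" by (simp add: gap_K_div_L)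
      moreover have "real j + 1 \<le> real i" using that by linarith
      ultimately show "?\<phi> x = 0" using y \<epsilon>_bounds(2)[of j] by (intro \<psi>_supp) linarith
    qed
    then have \<mu>: "\<mu> (fourier ?\<phi>) = (\<Sum>i<Suc j. of_real (C i) * ?t i)" by (rule \<mu>_finite)
    have e: "norm (\<Sum>i<j. of_real (C i) * ?t i) \<le> (\<Sum>i<j. C i * (2 * comb_const (gap_K i)))"
    proof (rule norm_earlier_terms_le)
      fix i assume "i < j"
      then have "gap_L i \<le> gap_L j" by (simp add: gap_L_def)
      \<comment> \<open>The period of comb \<open>i\<close> is no longer than that of comb
        \<open>j\<close>, so its frequencies are at least \<open>1 / gap_L j\<close> apart, more
        than the length of the support of \<open>\<psi>\<close>.\<close>
      then have "1 / (3 * gap_L j) \<le> 1 / (2 * gap_L i)" using gap_L_ge[of i] gap_L_ge[of j] by (intro divide_left_mono) auto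
      then have le: "\<epsilon> j \<le> 1 / (2 * gap_L i)" using \<epsilon>_bounds(3)[of j] by linarith
      show "norm (?t i) \<le> 2 * comb_const (gap_K i)"
        by (rule comb.comb_dist_fourier_narrow[OF comb_j \<psi>_test _ \<psi>_le1 le]) (rule \<psi>_supp)
    qed
    have "?t j = - comb.freq_wt (gap_L j) (gap_K j) (int (gap_K j) + 1)"
      using \<psi>_supp bump0 unfolding y_def by (intro comb.comb_dist_fourier_first[OF comb_j \<psi>_test]) (auto simp: \<psi>_eq y_def)
    then have "gap_size j \<le> norm (?t j)" by (simp add: gap_size_def)
    then have "C j * gap_size j \<le> norm (of_real (C j) * ?t j)" using C_pos[of j] by (simp add: norm_mult)
    then have m: "norm (of_real (C j) * ?t j) \<ge> exp (real j) + (\<Sum>i<j. C i * (2 * comb_const (gap_K i)))"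
      using C_large[of j] by linarith
    \<comment> \<open>There is no tail on the frequency side; 0 takes its place in the three-term
      estimate.\<close>
    have "\<mu> (fourier ?\<phi>) = 0 + ((\<Sum>i<j. of_real (C i) * ?t i) + of_real (C j) * ?t j)" using \<mu> by simp
    then have "norm (\<mu> (fourier ?\<phi>)) \<ge> norm (of_real (C j) * ?t j) - norm (\<Sum>i<j. of_real (C i) * ?t i) - norm (0 :: complex)"
      by (simp only: norm_add_add_ge)
    then have "norm (\<mu> (fourier ?\<phi>)) \<ge> norm (of_real (C j) * ?t j) - norm (\<Sum>i<j. of_real (C i) * ?t i)"
      by simp
    then have "exp (real j) \<le> norm (\<mu> (fourier ?\<phi>))" using m e by linarith
    also have "\<mu> (fourier ?\<phi>) = complex_measure_integral \<nu> ?\<phi>"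
      using \<nu>(1) \<psi>_test unfolding given_by_measure_def fourier_dist_def by blast
    also have "norm \<dots> \<le> norm (LINT x|variation \<nu>. complex_of_real (bump (x - y) / bump 0))"
    proof (rule norm_complex_measure_integral_le[OF cm \<nu>(2)])
      have t: "(\<lambda>x. 1 * complex_of_real (bump (1 * x + - y))) \<in> test_functions"
        by (rule bump_affine_test_function) simp
      then have "(\<lambda>x. Re (complex_of_real (bump (x - y)))) \<in> borel_measurable borel"
        using test_functions_borel[OF t] by (intro borel_measurable_continuous_on[where f = Re] continuous_intros) auto
      then show "(\<lambda>x. bump (x - y) / bump 0) \<in> borel_measurable borel" by simp
      have "bounded {x. complex_of_real (bump (x - y)) \<noteq> 0}" using t by (simp add: test_functions_def)
      then show "bounded {x. bump (x - y) / bump 0 \<noteq> 0}" using bump0 by simp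
      show "?\<phi> \<in> borel_measurable borel" by (rule test_functions_borel[OF \<psi>_test])
      show "bounded {x. ?\<phi> x \<noteq> 0}" using \<psi>_test by (simp add: test_functions_def)
      show "norm (?\<phi> x) \<le> bump (x - y) / bump 0" for x using \<psi>_le[of x] \<psi>_ge0[of x] by simp
    qed
    also have "(LINT x|variation \<nu>. complex_of_real (bump (x - y) / bump 0)) = (LINT x|variation \<nu>. complex_of_real (bump (x - y))) / of_real (bump 0)"
      by simp
    also have "(LINT x|variation \<nu>. complex_of_real (bump (x - y))) = f (\<lambda>x. complex_of_real (bump (x - y)))"
      using bump_affine_test_function[of 1 1 "- y"] by (intro f(2)[symmetric]) simp
    also have "norm (f (\<lambda>x. complex_of_real (bump (x - y))) / of_real (bump 0)) \<le> (\<bar>D\<bar> * (3 * real j + 2) ^ n) / bump 0"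
    proof -
      have "norm (f (\<lambda>x. complex_of_real (bump (x - y)))) \<le> D * (1 + \<bar>y\<bar>) ^ n" by (rule D)
      also have "\<dots> \<le> \<bar>D\<bar> * (3 * real j + 2) ^ n" using y by (intro mult_mono power_mono) auto
      finally show ?thesis using bump0 by (simp add: norm_divide divide_right_mono)
    qed
    finally show ?thesis by simp
  qed
  then show False by (rule exp_not_polynomially_bounded)
qed

end

theorem theorem6:
  "\<exists>\<mu>. crystalline_measure \<mu> \<and>
       (\<exists>\<psi>\<in>schwartz. \<not> bounded (range (dist_conv \<mu> \<psi>))) \<and>
       \<not> s_almost_periodic \<mu> \<and>
       \<not> fourier_quasicrystal \<mu>"
proof -
  obtain C N where "comb_sum C N"
    by (rule exists_gap_parameters) (use comb_sum.intro in blast)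
  then interpret comb_sum C N .
  let ?\<psi> = "\<lambda>x. complex_of_real (bump x)"
  have \<psi>: "?\<psi> \<in> schwartz" using bump_test_function test_functions_subset_schwartz by blast
  have "\<not> s_almost_periodic \<mu>"
    using \<psi> unbounded_conv almost_periodic_imp_bounded unfolding s_almost_periodic_def by blast
  then show ?thesis
    using crystalline_\<mu> \<psi> unbounded_conv not_fourier_quasicrystal by blast
qed

end
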